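(* Let $\Lambda\in\mathbb{R}$ be given. Then $$\lambda_0(d,\Lambda)\to\bar\alpha\quad\text{as }d\to\infty,$$ where $\bar\alpha$ is the real number uniquely determined by $$\int_0^1\int_0^{a_c}\beta(a,x)e^{-\bar\alpha a}e^{-\int_0^a\int_0^1\mu(s,y)\,dy\,ds}\,da\,dx=1.$$
   Context: Setting. Let $a_m\in(0,\infty]$ (maximum age), $d>0$, $\Lambda\in\mathbb{R}$, and let $q:[0,1]\to(0,\infty)$ be continuous. The functions $\beta,\mu$ of $(a,x)$, $a\in(0,a_m)$, $x\in[0,1]$, are nonnegative and satisfy: (i) $x\mapsto\beta(\cdot,x)$ is of class $C^2$ from $[0,1]$ to $L^\infty(0,a_m)$, with values in nonnegative functions; (ii) there is $a_c\in(0,a_m)$ such that $\beta\equiv0$ on $[a_c,a_m)\times[0,1]$ and $\int_a^{a_c}\underline\beta(l)\,dl>0$ for every $a\in[0,a_c)$, where $\underline\beta(a)=\min_{x\in[0,1]}\beta(a,x)$; (iii) $x\mapsto\mu(\cdot,x)$ is continuous from $[0,1]$ to $L^\infty_{\rm loc}(0,a_m)$ with values in nonnegative functions, i.e. $\mu(\cdot,x)\in L^\infty(0,a_+)$ for every $a_+<a_m$, continuously in $x$ (so $\mu$ may blow up at $a_m$). Consider the eigenvalue problem $$\begin{cases}u_a=du_{xx}+\Lambda q(x)u_x-\mu(a,x)u-\lambda u,&(a,x)\in(0,a_m)\times(0,1),\\ u_x(a,0)=0,\ u_x(a,1)=0,& a\in(0,a_m),\\ u(0,x)=\int_0^{a_m}\beta(a,x)u(a,x)\,da,&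 x\in(0,1).\end{cases}$$ A real number $\lambda_0$ is called a principal eigenvalue if there is $u$ such that $(\lambda_0,u)$ solves this problem and $u\ge0$, $u\not\equiv0$ (eigenfunctions are taken in $W^{1,1}((0,a_m),W^{2,p}(0,1))$, $p>1$). For every $d>0$ and $\Lambda\in\mathbb{R}$, with $q:[0,1]\to(0,\infty)$ continuous and with nonnegative $\beta,\mu$ satisfying (i), (ii) and (iii), the principal eigenvalue exists and is unique; it is denoted $\lambda_0(d,\Lambda)$. *)

theory Defs
  imports "HOL-Analysis.Analysis" "HOL-Probability.Essential_Supremum"
begin

text \<open>
  Functions of age \<open>a\<close> and position \<open>x\<close> are curried, age first. The space variable ranges over
  \<open>[0,1]\<close>; the maximum age is an \<open>ereal\<close>, so that \<open>\<infinity>\<close> is allowed.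
\<close>

definition ages :: "ereal \<Rightarrow> real set" where
  "ages am = {a. 0 < a \<and> ereal a < am}"

subsection \<open>Maps from \<open>[0,1]\<close> to \<open>L\<^sup>\<infinity>(I)\<close>\<close>

definition Linf_norm :: "real set \<Rightarrow> (real \<Rightarrow> real) \<Rightarrow> ennreal" where
  "Linf_norm I g = esssup (lebesgue_on I) (\<lambda>a. ennreal \<bar>g a\<bar>)"

definition in_Linf :: "real set \<Rightarrow> (real \<Rightarrow> real) \<Rightarrow> bool" where
  "in_Linf I g \<longleftrightarrow> g \<in> borel_measurable (lebesgue_on I) \<and> Linf_norm I g < \<infinity>"

text \<open>
  A norm-continuous map \<open>x \<mapsto> f(\<cdot>,x)\<close> from \<open>[0,1]\<close> to \<open>L\<^sup>\<infinity>(I)\<close> has a version, unique up to a null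
  set of \<open>a\<close> not depending on \<open>x\<close>, for which \<open>f(a,\<cdot>)\<close> is continuous. The second conjunct below
  says that \<open>f\<close> is such a version. It gives a meaning to expressions such as
  \<open>min\<^sub>x f(a,x)\<close> or \<open>\<integral> f(a,x) dx\<close> at fixed \<open>a\<close>.
\<close>

definition Linf_continuous :: "real set \<Rightarrow> (real \<Rightarrow> real \<Rightarrow> real) \<Rightarrow> bool" where
  "Linf_continuous I f \<longleftrightarrow>
     (\<forall>x\<in>{0..1}. in_Linf I (\<lambda>a. f a x)) \<and>
     (AE a in lebesgue_on I. continuous_on {0..1} (f a)) \<and>
     (\<forall>x\<in>{0..1}. ((\<lambda>y. Linf_norm I (\<lambda>a. f a y - f a x)) \<longlongrightarrow> 0) (at x within {0..1}))"

definition Linf_has_derivative ::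
    "real set \<Rightarrow> (real \<Rightarrow> real \<Rightarrow> real) \<Rightarrow> (real \<Rightarrow> real \<Rightarrow> real) \<Rightarrow> bool" where
  "Linf_has_derivative I f f' \<longleftrightarrow>
     (\<forall>x\<in>{0..1}. ((\<lambda>y. Linf_norm I (\<lambda>a. (f a y - f a x) / (y - x) - f' a x)) \<longlongrightarrow> 0)
                    (at x within {0..1}))"

definition Linf_C2 :: "real set \<Rightarrow> (real \<Rightarrow> real \<Rightarrow> real) \<Rightarrow> bool" where
  "Linf_C2 I f \<longleftrightarrow> Linf_continuous I f \<and>
     (\<exists>f1 f2. Linf_continuous I f1 \<and> Linf_continuous I f2 \<and>
        Linf_has_derivative I f f1 \<and> Linf_has_derivative I f1 f2)"

subsection \<open>Sobolev spaces\<close>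

definition test_function :: "real set \<Rightarrow> (real \<Rightarrow> real) \<Rightarrow> bool" where
  "test_function U \<phi> \<longleftrightarrow>
     (\<forall>n x. ((deriv ^^ n) \<phi>) differentiable (at x)) \<and>
     (\<exists>K. compact K \<and> K \<subseteq> U \<and> (\<forall>x. x \<notin> K \<longrightarrow> \<phi> x = 0))"

definition in_Lp :: "real \<Rightarrow> (real \<Rightarrow> real) \<Rightarrow> bool" where
  "in_Lp p w \<longleftrightarrow> set_borel_measurable lebesgue {0<..<1} w \<and>
     set_integrable lebesgue {0<..<1} (\<lambda>x. \<bar>w x\<bar> powr p)"

definition Lp_norm :: "real \<Rightarrow> (real \<Rightarrow> real) \<Rightarrow> real" where
  "Lp_norm p w = (LINT x:{0<..<1}|lebesgue. \<bar>w x\<bar> powr p) powr (1 / p)"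

definition weak_derivative :: "(real \<Rightarrow> real) \<Rightarrow> (real \<Rightarrow> real) \<Rightarrow> bool" where
  "weak_derivative w w' \<longleftrightarrow> (\<forall>\<phi>. test_function {0<..<1} \<phi> \<longrightarrow>
     (LINT x:{0<..<1}|lebesgue. w x * deriv \<phi> x) = - (LINT x:{0<..<1}|lebesgue. w' x * \<phi> x))"

text \<open>\<open>w\<close> lies in \<open>W\<^sup>2\<^sup>,\<^sup>p(0,1)\<close>, with weak derivatives \<open>w1\<close> and \<open>w2\<close>.\<close>

definition in_W2p :: "real \<Rightarrow> (real \<Rightarrow> real) \<Rightarrow> (real \<Rightarrow> real) \<Rightarrow> (real \<Rightarrow> real) \<Rightarrow> bool" where
  "in_W2p p w w1 w2 \<longleftrightarrow> in_Lp p w \<and> in_Lp p w1 \<and> in_Lp p w2 \<and>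
     weak_derivative w w1 \<and> weak_derivative w1 w2"

text \<open>
  \<open>w\<close> lies in the Bochner space \<open>L\<^sup>1(I, W\<^sup>2\<^sup>,\<^sup>p(0,1))\<close>, with weak \<open>x\<close>-derivatives \<open>wx\<close> and \<open>wxx\<close>.
  As \<open>L\<^sup>p(0,1)\<close> is separable for finite \<open>p\<close>, strongly measurable functions of \<open>a\<close> with values in it
  are identified with jointly measurable functions of \<open>(a,x)\<close>.
\<close>

definition in_L1_W2p :: "real set \<Rightarrow> real \<Rightarrow> (real \<Rightarrow> real \<Rightarrow> real) \<Rightarrow> (real \<Rightarrow> real \<Rightarrow> real) \<Rightarrow>
    (real \<Rightarrow> real \<Rightarrow> real) \<Rightarrow> bool" where
  "in_L1_W2p I p w wx wxx \<longleftrightarrow>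
     (\<lambda>(a, x). w a x) \<in> borel_measurable (lebesgue_on (I \<times> {0<..<1})) \<and>
     (\<lambda>(a, x). wx a x) \<in> borel_measurable (lebesgue_on (I \<times> {0<..<1})) \<and>
     (\<lambda>(a, x). wxx a x) \<in> borel_measurable (lebesgue_on (I \<times> {0<..<1})) \<and>
     (AE a in lebesgue_on I. in_W2p p (w a) (wx a) (wxx a)) \<and>
     set_integrable lebesgue I (\<lambda>a. Lp_norm p (w a) + Lp_norm p (wx a) + Lp_norm p (wxx a))"

definition in_L1_Lp :: "real set \<Rightarrow> real \<Rightarrow> (real \<Rightarrow> real \<Rightarrow> real) \<Rightarrow> bool" where
  "in_L1_Lp I p w \<longleftrightarrow>
     (\<lambda>(a, x). w a x) \<in> borel_measurable (lebesgue_on (I \<times> {0<..<1})) \<and>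
     (AE a in lebesgue_on I. in_Lp p (w a)) \<and>
     set_integrable lebesgue I (\<lambda>a. Lp_norm p (w a))"

text \<open>
  \<open>u\<close> is \<open>W\<^sup>1\<^sup>,\<^sup>1\<close> in age and \<open>W\<^sup>2\<^sup>,\<^sup>p\<close> in space, with weak derivatives \<open>ux\<close>, \<open>uxx\<close>, \<open>ua\<close>: on every
  \<open>(0,a')\<close> with \<open>a' < am\<close> it lies in \<open>L\<^sup>1((0,a'), W\<^sup>2\<^sup>,\<^sup>p(0,1))\<close>, and its age derivative lies in
  \<open>L\<^sup>1((0,a'), L\<^sup>p(0,1))\<close>.

  This class contains \<open>W\<^sup>1\<^sup>,\<^sup>1((0,am), W\<^sup>2\<^sup>,\<^sup>p(0,1))\<close>. It is larger in two respects, both needed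
  for a principal eigenvalue to exist under the general assumptions on the birth and death rates.
  If \<open>ua\<close> were integrable with values in \<open>W\<^sup>2\<^sup>,\<^sup>p\<close>, the Neumann condition would extend to \<open>a = 0\<close>,
  which the renewal condition for \<open>u(0,\<cdot>)\<close> violates unless the birth rate is compatible with it.
  If integrability were required up to \<open>am\<close>, then for \<open>am = \<infinity>\<close> eigenfunctions like
  \<open>exp (-l * a)\<close> with \<open>l \<le> 0\<close> would be excluded.

  The Bochner integrals against a test function of \<open>a\<close> are evaluated pointwise for almost every
  \<open>x\<close>. The class embeds into \<open>C([0,am), L\<^sup>p(0,1))\<close>, and \<open>W\<^sup>2\<^sup>,\<^sup>p(0,1)\<close> into \<open>C\<^sup>1[0,1]\<close>; the last two
  conjuncts select the corresponding representatives of \<open>u\<close> and \<open>ux\<close>, so that \<open>u(0,\<cdot>)\<close>,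
  \<open>ux(a,0)\<close> and \<open>ux(a,1)\<close> are traces.
\<close>

definition in_W11_W2p :: "ereal \<Rightarrow> real \<Rightarrow> (real \<Rightarrow> real \<Rightarrow> real) \<Rightarrow> (real \<Rightarrow> real \<Rightarrow> real) \<Rightarrow>
    (real \<Rightarrow> real \<Rightarrow> real) \<Rightarrow> (real \<Rightarrow> real \<Rightarrow> real) \<Rightarrow> bool" where
  "in_W11_W2p am p u ux uxx ua \<longleftrightarrow>
     (\<forall>a'\<in>ages am. in_L1_W2p {0<..<a'} p u ux uxx \<and> in_L1_Lp {0<..<a'} p ua) \<and>
     (\<forall>\<phi>. test_function (ages am) \<phi> \<longrightarrow>
        (AE x in lebesgue_on {0<..<1}.
          (LINT a:ages am|lebesgue. deriv \<phi> a * u a x) =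
          - (LINT a:ages am|lebesgue. \<phi> a * ua a x))) \<and>
     (\<forall>a\<in>insert 0 (ages am). in_Lp p (u a) \<and>
        ((\<lambda>s. Lp_norm p (\<lambda>x. u s x - u a x)) \<longlongrightarrow> 0) (at a within insert 0 (ages am))) \<and>
     (AE a in lebesgue_on (ages am). continuous_on {0..1} (ux a))"

subsection \<open>The eigenvalue problem\<close>

definition eigen_solution ::
    "ereal \<Rightarrow> real \<Rightarrow> real \<Rightarrow> real \<Rightarrow> (real \<Rightarrow> real) \<Rightarrow> (real \<Rightarrow> real \<Rightarrow> real) \<Rightarrow> (real \<Rightarrow> real \<Rightarrow> real) \<Rightarrow>
     real \<Rightarrow> (real \<Rightarrow> real \<Rightarrow> real) \<Rightarrow> bool" where
  "eigen_solution am p d \<Lambda> q \<beta> \<mu> l u \<longleftrightarrow>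
     (\<exists>ux uxx ua. in_W11_W2p am p u ux uxx ua \<and>
        (AE (a, x) in lebesgue_on (ages am \<times> {0<..<1}).
           ua a x = d * uxx a x + \<Lambda> * q x * ux a x - \<mu> a x * u a x - l * u a x) \<and>
        (AE a in lebesgue_on (ages am). ux a 0 = 0 \<and> ux a 1 = 0) \<and>
        (AE x in lebesgue_on {0<..<1}. u 0 x = (LINT a:ages am|lebesgue. \<beta> a x * u a x)))"

definition principal_eigenvalue ::
    "ereal \<Rightarrow> real \<Rightarrow> real \<Rightarrow> real \<Rightarrow> (real \<Rightarrow> real) \<Rightarrow> (real \<Rightarrow> real \<Rightarrow> real) \<Rightarrow> (real \<Rightarrow> real \<Rightarrow> real) \<Rightarrow>
     real \<Rightarrow> bool" where
  "principal_eigenvalue am p d \<Lambda> q \<beta> \<mu> l \<longleftrightarrow>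
     (\<exists>u. eigen_solution am p d \<Lambda> q \<beta> \<mu> l u \<and>
        (AE (a, x) in lebesgue_on (ages am \<times> {0<..<1}). 0 \<le> u a x) \<and>
        \<not> (AE (a, x) in lebesgue_on (ages am \<times> {0<..<1}). u a x = 0))"

text \<open>The equation that determines the limit as \<open>d \<rightarrow> \<infinity>\<close>.\<close>

definition limit_equation ::
    "real \<Rightarrow> (real \<Rightarrow> real \<Rightarrow> real) \<Rightarrow> (real \<Rightarrow> real \<Rightarrow> real) \<Rightarrow> real \<Rightarrow> bool" where
  "limit_equation ac \<beta> \<mu> \<alpha> \<longleftrightarrow>
     (LINT x:{0..1}|lebesgue. LINT a:{0..ac}|lebesgue.
        \<beta> a x * exp (- \<alpha> * a) *
        exp (- (LINT s:{0..a}|lebesgue. LINT y:{0..1}|lebesgue. \<mu> s y))) = 1"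

end

theory Submission
  imports Defs
begin

text \<open>
  With the weight \<open>W(x) = exp ((\<Lambda>/d) \<integral>\<^sub>0\<^sup>x q)\<close> the spatial operator is \<open>(d/W) (W u\<^sub>x)\<^sub>x\<close>, hence symmetric, and
  an eigenfunction enters only through its moments \<open>a \<mapsto> \<integral> W G(a,\<cdot>) u(a,\<cdot>) dx\<close>. If \<open>X'' = \<eta> - mean \<eta>\<close>
  with Neumann conditions, the equation for the moment of \<open>X\<close> gives
  \<open>d (moment of \<eta> - mean \<eta> \<cdot> mass) = O(mass)\<close> after integration in age against a smooth function. By
  approximation the moments of \<open>\<beta>\<close> and \<open>\<mu>\<close> may be replaced by their spatial means times the mass,
  up to \<open>o(1)\<close> as \<open>d \<rightarrow> \<infinity>\<close>. Pairing the mass with the adjoint solution \<open>\<psi>\<close> of the averaged problem at the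
  root \<open>\<alpha>\<close> of the limit equation yields \<open>(l - \<alpha>) \<integral> mass \<cdot> \<psi> = o(1) mass(0)\<close>, while the mass is
  comparable to its initial value uniformly in \<open>d\<close>.
\<close>

section \<open>Functions with an integrable derivative\<close>

text \<open>No bound on the eigenfunction itself is used. Everything is measured against the
  weighted mass, whose equation contains neither diffusion nor drift; this bounds \<open>l\<close>
  and the mass uniformly in \<open>d\<close> without compactness. Symmetry lets both space
  derivatives fall on the corrector, so that the drift costs only \<open>\<Lambda> q X'\<close>,
  without a factor \<open>d\<close>. Hence the limit contains the unweighted means of
  \<open>\<beta>\<close> and \<open>\<mu>\<close>, although the moments carry the weight. A second
  obstacle is roughness in age: the rates are merely bounded and measurable there, whereas
  integrating by parts needs a factor with bounded derivative. They are therefore split, up to a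
  small error, into finitely many products of a function of age and an indicator in space, and the
  age factor is approximated in \<open>L1\<close> by a polynomial. The third is that the derivatives
  of an eigenfunction are weak and its equation holds almost everywhere; the moments have to be
  shown absolutely continuous up to \<open>a = 0\<close>, where the renewal condition fixes the
  initial mass.\<close>

text \<open>
  Proves the product rule and the chain rule for \<open>exp\<close> below from estimates of increments, without
  differentiating an indefinite integral almost everywhere.
\<close>

lemma const_if_increment_le_product:
  fixes D R S :: "real \<Rightarrow> real"
  assumes R: "continuous_on {0..b} R"
    and monoR: "\<And>s t. 0 \<le> s \<Longrightarrow> s \<le> t \<Longrightarrow> t \<le> b \<Longrightarrow> R s \<le> R t"
    and monoS: "\<And>s t. 0 \<le> s \<Longrightarrow> s \<le> t \<Longrightarrow> t \<le> b \<Longrightarrow> S s \<le> S t"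
    and D: "\<And>s t. 0 \<le> s \<Longrightarrow> s \<le> t \<Longrightarrow> t \<le> b \<Longrightarrow> \<bar>D t - D s\<bar> \<le> (R t - R s) * (S t - S s)"
    and t: "0 \<le> t" "t \<le> b"
  shows "D t = D 0"
proof -
  have bound: "\<bar>D t - D 0\<bar> \<le> e * (S t - S 0)" if e: "e > 0" for e
  proof -
    have "uniformly_continuous_on {0..b} R"
      using R by (simp add: compact_uniformly_continuous)
    then obtain \<delta> where \<delta>: "\<delta> > 0"
      and uc: "\<And>x y. x \<in> {0..b} \<Longrightarrow> y \<in> {0..b} \<Longrightarrow> dist y x < \<delta> \<Longrightarrow> dist (R y) (R x) < e"
      using e unfolding uniformly_continuous_on_def by metis
    obtain n :: nat where n: "t / \<delta> < real n" using reals_Archimedean2 by blast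
    have n0: "real n > 0" using n \<delta> t by (smt (verit) divide_nonneg_pos)
    \<comment> \<open>Equal steps shorter than \<open>\<delta>\<close>: each increment of
      \<open>R\<close> is then at most \<open>e\<close>, so the products that bound the increments
      of \<open>D\<close> add up to at most \<open>e * (S t - S 0)\<close>.\<close>
    define P where "P k = real k * (t / real n)" for k :: nat
    have h: "0 \<le> t / real n" "t / real n < \<delta>" using n \<delta> t n0 by (auto simp: field_simps)
    have Pk: "0 \<le> P k" "P k \<le> t" if "k \<le> n" for k
    proof -
      show "0 \<le> P k" using h(1) unfolding P_def by (intro mult_nonneg_nonneg) auto
      have "P k \<le> real n * (t / real n)" unfolding P_def using that h by (intro mult_right_mono) auto
      then show "P k \<le> t" using n0 by simp
    qed
    have PS: "P (Suc k) = P k + t / real n" for k by (simp add: P_def algebra_simps add_divide_distrib)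
    have "k \<le> n \<Longrightarrow> \<bar>D (P k) - D 0\<bar> \<le> e * (S (P k) - S 0)" for k
    proof (induction k)
      case 0 then show ?case by (simp add: P_def)
    next
      case (Suc k)
      have a: "0 \<le> P k" "P k \<le> P (Suc k)" "P (Suc k) \<le> b"
        using Pk[of k] Pk[of "Suc k"] Suc.prems PS h t by auto
      have "R (P (Suc k)) - R (P k) \<le> e"
        using uc[of "P k" "P (Suc k)"] a h PS[of k] t by (auto simp: dist_real_def)
      then have "\<bar>D (P (Suc k)) - D (P k)\<bar> \<le> e * (S (P (Suc k)) - S (P k))"
        using D[OF a] monoS[OF a] mult_right_mono[of "R (P (Suc k)) - R (P k)" e "S (P (Suc k)) - S (P k)"]
        by linarith
      then show ?case using Suc by (simp add: algebra_simps)
    qed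
    from this[of n] show ?thesis using n0 by (simp add: P_def)
  qed
  define c where "c = S t - S 0"
  have c: "c \<ge> 0" using monoS[of 0 t] t by (simp add: c_def)
  have "\<bar>D t - D 0\<bar> \<le> 0"
  proof (rule field_le_epsilon)
    fix e :: real assume "e > 0"
    \<comment> \<open>The divisor is \<open>c + 1\<close> because \<open>c\<close> may be
      \<open>0\<close>.\<close>
    then have "\<bar>D t - D 0\<bar> \<le> e / (c + 1) * c" using bound[of "e / (c + 1)"] c by (simp add: c_def)
    also have "\<dots> \<le> e" using c \<open>e > 0\<close> by (simp add: field_simps)
    finally show "\<bar>D t - D 0\<bar> \<le> 0 + e" by simp
  qed
  then show ?thesis by simp
qed

lemma absolutely_integrable_imp_integrable_sub:
  fixes f :: "real \<Rightarrow> real"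
  assumes "f absolutely_integrable_on {0..b}" "{s..t} \<subseteq> {0..b}"
  shows "f integrable_on {s..t}"
  using absolutely_integrable_on_subinterval[OF assms] by (simp add: absolutely_integrable_on_def)

text \<open>Absolute continuity on \<open>{0..b}\<close> in integrated form. \<open>F\<close> is a
  function defined at every point, so boundary values can be read off, and no pointwise derivative
  of \<open>F\<close> is ever taken.\<close>

definition primitive_on :: "real \<Rightarrow> (real \<Rightarrow> real) \<Rightarrow> (real \<Rightarrow> real) \<Rightarrow> bool" where
  "primitive_on b F f \<longleftrightarrow> f absolutely_integrable_on {0..b} \<and>
     (\<forall>t\<in>{0..b}. integral {0..t} f = F t - F 0)"

lemma primitive_on_integrable: "primitive_on b F f \<Longrightarrow> f absolutely_integrable_on {0..b}"
  by (simp add: primitive_on_def)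

lemma primitive_on_eq:
  "primitive_on b F f \<Longrightarrow> 0 \<le> t \<Longrightarrow> t \<le> b \<Longrightarrow> F t = F 0 + integral {0..t} f"
  by (simp add: primitive_on_def)

lemma primitive_on_diff:
  assumes "primitive_on b F f" "0 \<le> s" "s \<le> t" "t \<le> b"
  shows "F t - F s = integral {s..t} f"
proof -
  have "f integrable_on {0..t}"
    using primitive_on_integrable[OF assms(1)] assms(2-) by (intro absolutely_integrable_imp_integrable_sub) auto
  then have "integral {0..s} f + integral {s..t} f = integral {0..t} f"
    using assms by (intro Henstock_Kurzweil_Integration.integral_combine) auto
  then show ?thesis
    using primitive_on_eq[OF assms(1), of s] primitive_on_eq[OF assms(1), of t] assms by simp
qed

lemma primitive_on_integral:
  "f absolutely_integrable_on {0..b} \<Longrightarrow> primitive_on b (\<lambda>t. c + integral {0..t} f) f"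
  by (simp add: primitive_on_def)

lemma primitive_on_continuous: "primitive_on b F f \<Longrightarrow> continuous_on {0..b} F"
proof -
  assume *: "primitive_on b F f"
  have "continuous_on {0..b} (\<lambda>t. F 0 + integral {0..t} f)"
    using * by (intro continuous_intros indefinite_integral_continuous_1)
      (simp add: primitive_on_def absolutely_integrable_on_def)
  then show ?thesis
    by (rule continuous_on_eq) (use * in \<open>simp add: primitive_on_def\<close>)
qed

lemma primitive_on_cong:
  assumes "primitive_on b F f" "\<And>t. t \<in> {0..b} \<Longrightarrow> F t = G t" "\<And>t. t \<in> {0..b} \<Longrightarrow> f t = g t"
  shows "primitive_on b G g"
proof (cases "0 \<le> b")
  case True
  have "g absolutely_integrable_on {0..b}"
    using primitive_on_integrable[OF assms(1)] assms(3) by (subst set_integrable_cong[OF refl]) auto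
  moreover have "integral {0..t} f = integral {0..t} g" if "t \<in> {0..b}" for t
    by (rule Henstock_Kurzweil_Integration.integral_cong) (use that assms(3) in auto)
  ultimately show ?thesis using assms(1,2) True by (auto simp: primitive_on_def)
qed (auto simp: primitive_on_def absolutely_integrable_on_def)

lemma primitive_on_add:
  assumes "primitive_on b F f" "primitive_on b G g"
  shows "primitive_on b (\<lambda>t. F t + G t) (\<lambda>t. f t + g t)"
proof -
  have "integral {0..t} (\<lambda>t. f t + g t) = integral {0..t} f + integral {0..t} g" if "t \<in> {0..b}" for t
    using primitive_on_integrable[OF assms(1)] primitive_on_integrable[OF assms(2)] that
    by (intro integral_add) (auto elim!: absolutely_integrable_imp_integrable_sub)
  then show ?thesis using assms by (auto simp: primitive_on_def)
qed

lemma primitive_on_cmult: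
  "primitive_on b F f \<Longrightarrow> primitive_on b (\<lambda>t. c * F t) (\<lambda>t. c * f t)"
  by (auto simp: primitive_on_def right_diff_distrib[symmetric])

lemma primitive_on_C1:
  assumes "\<And>t. t \<in> {0..b} \<Longrightarrow> (F has_real_derivative f t) (at t within {0..b})" "continuous_on {0..b} f"
  shows "primitive_on b F f"
proof -
  have "integral {0..t} f = F t - F 0" if t: "t \<in> {0..b}" for t
  proof -
    have "(f has_integral (F t - F 0)) {0..t}"
    proof (rule fundamental_theorem_of_calculus)
      fix x assume x: "x \<in> {0..t}"
      have "(F has_real_derivative f x) (at x within {0..t})"
        by (rule DERIV_subset[OF assms(1)]) (use x t in auto)
      then show "(F has_vector_derivative f x) (at x within {0..t})"
        by (simp add: has_real_derivative_iff_has_vector_derivative)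
    qed (use t in auto)
    then show ?thesis by blast
  qed
  then show ?thesis
    using assms(2) by (auto simp: primitive_on_def intro: absolutely_integrable_continuous_real)
qed

lemma absolutely_integrable_mult_continuous:
  fixes f g :: "real \<Rightarrow> real"
  assumes "f absolutely_integrable_on {a..b}" "continuous_on {a..b} g"
  shows "(\<lambda>x. f x * g x) absolutely_integrable_on {a..b}" "(\<lambda>x. g x * f x) absolutely_integrable_on {a..b}"
proof -
  have "g \<in> borel_measurable (lebesgue_on {a..b})"
    using assms(2) by (intro continuous_imp_measurable_on_sets_lebesgue) auto
  moreover have "bounded (g ` {a..b})"
    using assms(2) by (intro compact_imp_bounded compact_continuous_image) auto
  ultimately show "(\<lambda>x. g x * f x) absolutely_integrable_on {a..b}"
    using assms by (intro absolutely_integrable_bounded_measurable_product_real) auto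
  then show "(\<lambda>x. f x * g x) absolutely_integrable_on {a..b}" by (simp add: mult.commute)
qed

lemma integral_mult_le_sup:
  fixes f g :: "real \<Rightarrow> real"
  assumes "f absolutely_integrable_on {s..t}" "continuous_on {s..t} g" "\<And>x. x \<in> {s..t} \<Longrightarrow> \<bar>g x\<bar> \<le> B"
  shows "\<bar>integral {s..t} (\<lambda>x. f x * g x)\<bar> \<le> B * integral {s..t} (\<lambda>x. \<bar>f x\<bar>)"
proof -
  have "norm (integral {s..t} (\<lambda>x. f x * g x)) \<le> integral {s..t} (\<lambda>x. B * \<bar>f x\<bar>)"
  proof (rule Henstock_Kurzweil_Integration.integral_norm_bound_integral)
    show "(\<lambda>x. f x * g x) integrable_on {s..t}"
      using absolutely_integrable_mult_continuous(1)[OF assms(1,2)] by (simp add: absolutely_integrable_on_def)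
    show "(\<lambda>x. B * \<bar>f x\<bar>) integrable_on {s..t}"
      using assms(1) by (intro integrable_on_mult_right) (simp add: absolutely_integrable_on_def)
    show "norm (f x * g x) \<le> B * \<bar>f x\<bar>" if "x \<in> {s..t}" for x
      using mult_right_mono[OF assms(3)[OF that], of "\<bar>f x\<bar>"] by (simp add: abs_mult mult.commute)
  qed
  then show ?thesis by simp
qed

lemma abs_integral_le:
  fixes f :: "real \<Rightarrow> real"
  assumes "f absolutely_integrable_on {s..t}"
  shows "\<bar>integral {s..t} f\<bar> \<le> integral {s..t} (\<lambda>x. \<bar>f x\<bar>)"
  using assms integral_norm_bound_integral[of f "{s..t}" "\<lambda>x. \<bar>f x\<bar>"]
  by (auto simp: absolutely_integrable_on_def)

text \<open>\<open>R\<close> is the variation of a primitive of \<open>f\<close>: a continuous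
  increasing function that dominates the increments, as \<open>const_if_increment_le_product\<close>
  requires.\<close>

lemma primitive_on_variation:
  fixes f :: "real \<Rightarrow> real"
  assumes "f absolutely_integrable_on {0..b}"
  defines "R \<equiv> (\<lambda>t. integral {0..t} (\<lambda>x. \<bar>f x\<bar>))"
  shows "continuous_on {0..b} R"
    "\<And>s t. 0 \<le> s \<Longrightarrow> s \<le> t \<Longrightarrow> t \<le> b \<Longrightarrow> R t - R s = integral {s..t} (\<lambda>x. \<bar>f x\<bar>)"
    "\<And>s t. 0 \<le> s \<Longrightarrow> s \<le> t \<Longrightarrow> t \<le> b \<Longrightarrow> R s \<le> R t"
proof -
  have "(\<lambda>x. \<bar>f x\<bar>) absolutely_integrable_on {0..b}"
    using set_integrable_norm[OF assms(1)] by simp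
  then have *: "primitive_on b (\<lambda>t. 0 + R t) (\<lambda>x. \<bar>f x\<bar>)" unfolding R_def by (rule primitive_on_integral)
  show "continuous_on {0..b} R" using primitive_on_continuous[OF *] by simp
  show **: "R t - R s = integral {s..t} (\<lambda>x. \<bar>f x\<bar>)" if "0 \<le> s" "s \<le> t" "t \<le> b" for s t
    using primitive_on_diff[OF *] that by simp
  show "R s \<le> R t" if "0 \<le> s" "s \<le> t" "t \<le> b" for s t
  proof -
    have "(\<lambda>x. \<bar>f x\<bar>) integrable_on {s..t}"
      using primitive_on_integrable[OF *] that by (auto elim!: absolutely_integrable_imp_integrable_sub)
    then have "0 \<le> integral {s..t} (\<lambda>x. \<bar>f x\<bar>)" by (intro integral_nonneg) auto
    then show ?thesis using **[OF that] by simp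
  qed
qed

lemma primitive_on_abs_diff_le:
  assumes F: "primitive_on b F f" and x: "0 \<le> s" "s \<le> x" "x \<le> t" "t \<le> b"
  defines "R \<equiv> (\<lambda>t. integral {0..t} (\<lambda>x. \<bar>f x\<bar>))"
  shows "\<bar>F x - F s\<bar> \<le> R t - R s"
proof -
  note fi = primitive_on_integrable[OF F]
  note RR = primitive_on_variation[OF fi]
  have "\<bar>F x - F s\<bar> = \<bar>integral {s..x} f\<bar>" using primitive_on_diff[OF F, of s x] x by simp
  also have "\<dots> \<le> integral {s..x} (\<lambda>x. \<bar>f x\<bar>)"
    using x by (intro abs_integral_le absolutely_integrable_on_subinterval[OF fi]) auto
  also have "\<dots> = R x - R s" using RR(2)[of s x] x by (simp add: R_def)
  also have "\<dots> \<le> R t - R s" using RR(3)[of x t] x by (simp add: R_def)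
  finally show ?thesis .
qed

text \<open>The defect \<open>D\<close>, the product minus the integral of its expected derivative,
  has increments of second order: each is \<open>(F t - F s) * (G t - G s)\<close> minus the
  integrals of \<open>f * (G - G s)\<close> and \<open>g * (F - F s)\<close> over
  \<open>{s..t}\<close>. Each of these three terms is at most the product of the variations of
  \<open>F\<close> and \<open>G\<close> over \<open>{s..t}\<close>, so \<open>D\<close> is
  constant.\<close>

lemma primitive_on_mult:
  assumes F: "primitive_on b F f" and G: "primitive_on b G g"
  shows "primitive_on b (\<lambda>t. F t * G t) (\<lambda>t. f t * G t + F t * g t)"
proof -
  define R where "R t = integral {0..t} (\<lambda>x. \<bar>f x\<bar>)" for t
  define S where "S t = integral {0..t} (\<lambda>x. \<bar>g x\<bar>)" for t
  note fi = primitive_on_integrable[OF F] and gi = primitive_on_integrable[OF G]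
  note contF = primitive_on_continuous[OF F] and contG = primitive_on_continuous[OF G]
  note RR = primitive_on_variation[OF fi, folded R_def] and SS = primitive_on_variation[OF gi, folded S_def]
  have i1: "(\<lambda>t. f t * G t) absolutely_integrable_on {0..b}" "(\<lambda>t. F t * g t) absolutely_integrable_on {0..b}"
    using absolutely_integrable_mult_continuous fi gi contF contG by blast+
  then have i: "(\<lambda>t. f t * G t + F t * g t) absolutely_integrable_on {0..b}"
    by (rule set_integral_add)
  define D where "D t = F t * G t - integral {0..t} (\<lambda>t. f t * G t + F t * g t)" for t
  have pD: "primitive_on b (\<lambda>t. 0 + integral {0..t} (\<lambda>t. f t * G t + F t * g t)) (\<lambda>t. f t * G t + F t * g t)"
    by (rule primitive_on_integral[OF i])
  have "\<bar>D t - D s\<bar> \<le> (3 * R t - 3 * R s) * (S t - S s)" if st: "0 \<le> s" "s \<le> t" "t \<le> b" for s t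
  proof -
    have sub: "{s..t} \<subseteq> {0..b}" using st by auto
    have fi': "f absolutely_integrable_on {s..t}" "g absolutely_integrable_on {s..t}"
      using fi gi sub absolutely_integrable_on_subinterval by blast+
    have c': "continuous_on {s..t} F" "continuous_on {s..t} G"
      using contF contG sub continuous_on_subset by blast+
    have j1: "(\<lambda>x. f x * G x) integrable_on {s..t}" "(\<lambda>x. F x * g x) integrable_on {s..t}"
      using absolutely_integrable_mult_continuous fi' c' absolutely_integrable_on_def by blast+
    have j2: "f integrable_on {s..t}" "g integrable_on {s..t}"
      using fi' absolutely_integrable_on_def by blast+
    have e1: "integral {s..t} (\<lambda>x. f x * (G x - G s)) = integral {s..t} (\<lambda>x. f x * G x) - integral {s..t} f * G s"
      using integral_diff[OF j1(1) integrable_on_mult_left[OF j2(1), of "G s"]] by (simp add: right_diff_distrib)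
    have e2: "integral {s..t} (\<lambda>x. g x * (F x - F s)) = integral {s..t} (\<lambda>x. F x * g x) - integral {s..t} g * F s"
      using integral_diff[OF j1(2) integrable_on_mult_left[OF j2(2), of "F s"]] by (simp add: right_diff_distrib mult.commute)
    have e3: "integral {s..t} (\<lambda>x. f x * G x + F x * g x) = integral {s..t} (\<lambda>x. f x * G x) + integral {s..t} (\<lambda>x. F x * g x)"
      using j1 by (simp add: integral_add)
    have b1: "\<bar>integral {s..t} (\<lambda>x. f x * (G x - G s))\<bar> \<le> (S t - S s) * (R t - R s)"
    proof -
      have "\<bar>G x - G s\<bar> \<le> S t - S s" if "x \<in> {s..t}" for x
        using primitive_on_abs_diff_le[OF G, folded S_def] that st by simp
      then have "\<bar>integral {s..t} (\<lambda>x. f x * (G x - G s))\<bar> \<le> (S t - S s) * integral {s..t} (\<lambda>x. \<bar>f x\<bar>)"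
        using fi' c' by (intro integral_mult_le_sup continuous_intros) auto
      then show ?thesis using RR(2)[OF st] by simp
    qed
    have b2: "\<bar>integral {s..t} (\<lambda>x. g x * (F x - F s))\<bar> \<le> (R t - R s) * (S t - S s)"
    proof -
      have "\<bar>F x - F s\<bar> \<le> R t - R s" if "x \<in> {s..t}" for x
        using primitive_on_abs_diff_le[OF F, folded R_def] that st by simp
      then have "\<bar>integral {s..t} (\<lambda>x. g x * (F x - F s))\<bar> \<le> (R t - R s) * integral {s..t} (\<lambda>x. \<bar>g x\<bar>)"
        using fi' c' by (intro integral_mult_le_sup continuous_intros) auto
      then show ?thesis using SS(2)[OF st] by simp
    qed
    have dF: "F t - F s = integral {s..t} f" and dG: "G t - G s = integral {s..t} g"
      using primitive_on_diff F G st by blast+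
    have "\<bar>(F t - F s) * (G t - G s)\<bar> \<le> (R t - R s) * (S t - S s)"
    proof -
      have "\<bar>F t - F s\<bar> \<le> R t - R s" "\<bar>G t - G s\<bar> \<le> S t - S s"
        using dF dG abs_integral_le[OF fi'(1)] abs_integral_le[OF fi'(2)] RR(2)[OF st] SS(2)[OF st] by auto
      then show ?thesis by (simp add: abs_mult mult_mono)
    qed
    moreover have "D t - D s = (F t - F s) * (G t - G s) - integral {s..t} (\<lambda>x. f x * (G x - G s))
        - integral {s..t} (\<lambda>x. g x * (F x - F s))"
    proof -
      have "D t - D s = F t * G t - F s * G s - integral {s..t} (\<lambda>x. f x * G x + F x * g x)"
        using primitive_on_diff[OF pD, of s t] st by (simp add: D_def)
      then show ?thesis unfolding e1 e2 e3 dF[symmetric] dG[symmetric] by (simp add: algebra_simps)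
    qed
    ultimately have "\<bar>D t - D s\<bar> \<le> 3 * ((R t - R s) * (S t - S s))" using b1 b2
      by (simp add: abs_le_iff mult.commute)
    then show ?thesis by (simp add: algebra_simps)
  qed
  then have "D t = D 0" if "t \<in> {0..b}" for t
    using that RR SS by (intro const_if_increment_le_product[of b "\<lambda>t. 3 * R t" S D]) (auto intro!: continuous_intros)
  then show ?thesis using i by (fastforce simp: primitive_on_def D_def)
qed

lemma exp_remainder_bound:
  fixes x :: real
  assumes "\<bar>x\<bar> \<le> B"
  shows "\<bar>exp x - 1 - x\<bar> \<le> exp B * x\<^sup>2" "\<bar>exp x - 1\<bar> \<le> exp B * \<bar>x\<bar>"
proof -
  obtain t where t: "\<bar>t\<bar> \<le> \<bar>x\<bar>" "exp x = (\<Sum>m<2. x ^ m / fact m) + exp t / fact 2 * x ^ 2"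
    using Maclaurin_exp_le[of x 2] by blast
  have "exp t \<le> exp B" using t(1) assms by simp
  then have "exp t * x\<^sup>2 / 2 \<le> exp B * x\<^sup>2"
    using mult_right_mono[of "exp t" "exp B" "x\<^sup>2"] by (smt (verit) exp_gt_zero field_sum_of_halves zero_le_power2 mult_nonneg_nonneg)
  moreover have "exp x - 1 - x = exp t * x\<^sup>2 / 2" using t(2) by (simp add: numeral_2_eq_2)
  moreover have "0 \<le> exp t * x\<^sup>2 / 2" by simp
  ultimately show "\<bar>exp x - 1 - x\<bar> \<le> exp B * x\<^sup>2" by linarith
  obtain t where t: "\<bar>t\<bar> \<le> \<bar>x\<bar>" "exp x = (\<Sum>m<1. x ^ m / fact m) + exp t / fact 1 * x ^ 1"
    using Maclaurin_exp_le[of x 1] by blast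
  have "exp t \<le> exp B" using t(1) assms by simp
  then have "exp t * \<bar>x\<bar> \<le> exp B * \<bar>x\<bar>" by (intro mult_right_mono) auto
  then show "\<bar>exp x - 1\<bar> \<le> exp B * \<bar>x\<bar>" using t(2) by (simp add: abs_mult)
qed

text \<open>The argument is that of \<open>primitive_on_mult\<close>: by Taylor's formula the defect
  has increments of the order of the squared variation of \<open>F\<close>, and so it is
  constant.\<close>

lemma primitive_on_exp:
  assumes F: "primitive_on b F f"
  shows "primitive_on b (\<lambda>t. exp (F t)) (\<lambda>t. f t * exp (F t))"
proof -
  define R where "R t = integral {0..t} (\<lambda>x. \<bar>f x\<bar>)" for t
  note fi = primitive_on_integrable[OF F]
  note contF = primitive_on_continuous[OF F]
  note RR = primitive_on_variation[OF fi, folded R_def]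
  have contE: "continuous_on {0..b} (\<lambda>t. exp (F t))" using contF by (intro continuous_intros)
  have i: "(\<lambda>t. f t * exp (F t)) absolutely_integrable_on {0..b}"
    using absolutely_integrable_mult_continuous fi contE by blast
  obtain B0 where B0: "\<And>t. t \<in> {0..b} \<Longrightarrow> \<bar>F t\<bar> \<le> B0"
    using compact_imp_bounded[OF compact_continuous_image[OF contF compact_Icc]]
    unfolding bounded_iff real_norm_def by (metis imageI)
  \<comment> \<open>\<open>exp B0\<close> bounds the prefactor \<open>exp (F s)\<close>;
    \<open>exp (2 * B0)\<close> is the Taylor constant, since \<open>F x - F s\<close> stays within
    \<open>2 * B0\<close>.\<close>
  define C where "C = exp B0 * exp (2 * B0)"
  define D where "D t = exp (F t) - integral {0..t} (\<lambda>t. f t * exp (F t))" for t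
  have pD: "primitive_on b (\<lambda>t. 0 + integral {0..t} (\<lambda>t. f t * exp (F t))) (\<lambda>t. f t * exp (F t))"
    by (rule primitive_on_integral[OF i])
  have C0: "C > 0" by (simp add: C_def)
  have "\<bar>D t - D s\<bar> \<le> (2 * C * R t - 2 * C * R s) * (R t - R s)" if st: "0 \<le> s" "s \<le> t" "t \<le> b" for s t
  proof -
    have sub: "{s..t} \<subseteq> {0..b}" using st by auto
    have fi': "f absolutely_integrable_on {s..t}"
      using fi sub absolutely_integrable_on_subinterval by blast
    have c': "continuous_on {s..t} (\<lambda>t. exp (F t))" using contE sub continuous_on_subset by blast
    have dR: "\<bar>F x - F s\<bar> \<le> R t - R s" if "x \<in> {s..t}" for x
      using primitive_on_abs_diff_le[OF F, folded R_def] that st by simp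
    have es: "exp (F s) \<le> exp B0" using B0[of s] st by auto
    have dB: "\<bar>F x - F s\<bar> \<le> 2 * B0" if "x \<in> {s..t}" for x
      using B0[of s] B0[of x] that st by auto
    have q1: "\<bar>exp (F t) - exp (F s) - exp (F s) * (F t - F s)\<bar> \<le> C * (R t - R s)\<^sup>2"
    proof -
      have "exp (F t) - exp (F s) - exp (F s) * (F t - F s) = exp (F s) * (exp (F t - F s) - 1 - (F t - F s))"
        by (simp add: algebra_simps exp_diff)
      then have "\<bar>exp (F t) - exp (F s) - exp (F s) * (F t - F s)\<bar> = exp (F s) * \<bar>exp (F t - F s) - 1 - (F t - F s)\<bar>"
        by (simp add: abs_mult)
      also have "\<dots> \<le> exp B0 * (exp (2 * B0) * (F t - F s)\<^sup>2)"
        using es exp_remainder_bound(1)[OF dB[of t]] st by (intro mult_mono) auto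
      also have "\<dots> \<le> exp B0 * (exp (2 * B0) * (R t - R s)\<^sup>2)"
        using dR[of t] st by (intro mult_left_mono) (auto simp: abs_le_square_iff[symmetric])
      finally show ?thesis by (simp add: C_def)
    qed
    have q2: "\<bar>integral {s..t} (\<lambda>x. f x * (exp (F x) - exp (F s)))\<bar> \<le> C * (R t - R s) * (R t - R s)"
    proof -
      have "\<bar>exp (F x) - exp (F s)\<bar> \<le> C * (R t - R s)" if x: "x \<in> {s..t}" for x
      proof -
        have "exp (F x) - exp (F s) = exp (F s) * (exp (F x - F s) - 1)"
          by (simp add: algebra_simps exp_diff)
        then have "\<bar>exp (F x) - exp (F s)\<bar> = exp (F s) * \<bar>exp (F x - F s) - 1\<bar>" by (simp add: abs_mult)
        also have "\<dots> \<le> exp B0 * (exp (2 * B0) * \<bar>F x - F s\<bar>)"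
          using es exp_remainder_bound(2)[OF dB[OF x]] by (intro mult_mono) auto
        also have "\<dots> \<le> exp B0 * (exp (2 * B0) * (R t - R s))"
          using dR[OF x] by (intro mult_left_mono) auto
        finally show ?thesis by (simp add: C_def)
      qed
      then have "\<bar>integral {s..t} (\<lambda>x. f x * (exp (F x) - exp (F s)))\<bar> \<le> C * (R t - R s) * integral {s..t} (\<lambda>x. \<bar>f x\<bar>)"
        using fi' c' by (intro integral_mult_le_sup continuous_on_diff continuous_on_const) auto
      then show ?thesis using RR(2)[OF st] by simp
    qed
    have e1: "integral {s..t} (\<lambda>x. f x * (exp (F x) - exp (F s))) = integral {s..t} (\<lambda>x. f x * exp (F x)) - integral {s..t} f * exp (F s)"
      using absolutely_integrable_mult_continuous(1)[OF fi' c'] fi'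
        integral_diff[of "\<lambda>x. f x * exp (F x)" "{s..t}" "\<lambda>x. f x * exp (F s)"]
      by (simp add: right_diff_distrib absolutely_integrable_on_def integrable_on_mult_left)
    have "D t - D s = exp (F t) - exp (F s) - integral {s..t} (\<lambda>x. f x * exp (F x))"
      using primitive_on_diff[OF pD, of s t] st by (simp add: D_def)
    then have "D t - D s = (exp (F t) - exp (F s) - exp (F s) * (F t - F s)) - integral {s..t} (\<lambda>x. f x * (exp (F x) - exp (F s)))"
      unfolding e1 using primitive_on_diff[OF F st] by (simp add: algebra_simps)
    then have "\<bar>D t - D s\<bar> \<le> C * (R t - R s)\<^sup>2 + C * (R t - R s) * (R t - R s)" using q1 q2 by linarith
    then show ?thesis by (simp add: algebra_simps power2_eq_square)
  qed
  then have "D t = D 0" if "t \<in> {0..b}" for t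
    using that RR C0 by (intro const_if_increment_le_product[of b "\<lambda>t. 2 * C * R t" R D]) (auto intro!: continuous_intros)
  then show ?thesis using i by (fastforce simp: primitive_on_def D_def)
qed

section \<open>Weak derivatives on an interval\<close>

definition smooth :: "(real \<Rightarrow> real) \<Rightarrow> bool" where
  "smooth f \<longleftrightarrow> (\<forall>n x. ((deriv ^^ n) f) differentiable (at x))"

lemma smooth_imp_DERIV: "smooth f \<Longrightarrow> (f has_real_derivative deriv f x) (at x)"
  unfolding smooth_def by (metis DERIV_deriv_iff_real_differentiable funpow_0)

lemma smooth_deriv: "smooth f \<Longrightarrow> smooth (deriv f)"
  unfolding smooth_def by (metis funpow_Suc_right o_apply)

text \<open>A coinduction principle: membership in a class closed under differentiation passes to
  all iterated derivatives. Each use below only has to exhibit a suitable class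
  \<open>P\<close>.\<close>

lemma smooth_if_closed:
  assumes f: "P f" and closed: "\<And>g. P g \<Longrightarrow> \<exists>g'. (\<forall>x. (g has_real_derivative g' x) (at x)) \<and> P g'"
  shows "smooth f"
proof -
  have *: "(\<forall>x. g differentiable (at x)) \<and> P (deriv g)" if g: "P g" for g
  proof -
    obtain g' where g': "\<And>x. (g has_real_derivative g' x) (at x)" "P g'" using closed[OF g] by blast
    then have "deriv g = g'" by (auto intro: DERIV_imp_deriv)
    then show ?thesis using g' real_differentiable_def by auto
  qed
  have "P ((deriv ^^ n) f)" for n by (induction n) (use f * in auto)
  then show ?thesis using * unfolding smooth_def by blast
qed

lemma smooth_if_DERIV:
  assumes "\<And>x. (f has_real_derivative f' x) (at x)" "smooth f'"
  shows "smooth f"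
proof (rule smooth_if_closed[of "\<lambda>g. smooth g \<or> g = f"])
  fix g assume "smooth g \<or> g = f"
  then show "\<exists>g'. (\<forall>x. (g has_real_derivative g' x) (at x)) \<and> (smooth g' \<or> g' = f)"
    using assms smooth_imp_DERIV smooth_deriv by metis
qed simp

text \<open>The coefficients and both functions vary within the closed class, while the affine
  arguments stay fixed: differentiation only multiplies the coefficients by \<open>k\<close> and
  \<open>l\<close>. This one form covers sums, multiples, shifts, dilations and reflections.\<close>

lemma smooth_affine_combination:
  assumes "smooth f" "smooth g"
  shows "smooth (\<lambda>x. c * f (k * x + r) + e * g (l * x + s))"
proof (rule smooth_if_closed[of "\<lambda>h. \<exists>f g c e. smooth f \<and> smooth g \<and> h = (\<lambda>x. c * f (k * x + r) + e * g (l * x + s))"])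
  fix h assume "\<exists>f g c e. smooth f \<and> smooth g \<and> h = (\<lambda>x. c * f (k * x + r) + e * g (l * x + s))"
  then obtain f g c e where h: "smooth f" "smooth g" "h = (\<lambda>x. c * f (k * x + r) + e * g (l * x + s))" by blast
  let ?h' = "\<lambda>x. (c * k) * deriv f (k * x + r) + (e * l) * deriv g (l * x + s)"
  have "(h has_real_derivative ?h' x) (at x)" for x
    unfolding h(3)
    by (auto intro!: derivative_eq_intros DERIV_chain2[OF smooth_imp_DERIV] h(1,2))
  moreover have "\<exists>f g c e. smooth f \<and> smooth g \<and> ?h' = (\<lambda>x. c * f (k * x + r) + e * g (l * x + s))"
    using smooth_deriv[OF h(1)] smooth_deriv[OF h(2)] by blast
  ultimately show "\<exists>h'. (\<forall>x. (h has_real_derivative h' x) (at x)) \<and>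
      (\<exists>f g c e. smooth f \<and> smooth g \<and> h' = (\<lambda>x. c * f (k * x + r) + e * g (l * x + s)))"
    by (intro exI[of _ ?h']) blast
qed (use assms in blast)

text \<open>The product rule turns one product into a sum of two, so products alone are not closed
  under differentiation; their finite sums are.\<close>

inductive smooth_sum_of_products :: "(real \<Rightarrow> real) \<Rightarrow> bool" where
  mult: "smooth f \<Longrightarrow> smooth g \<Longrightarrow> smooth_sum_of_products (\<lambda>x. f x * g x)"
| add: "smooth_sum_of_products f \<Longrightarrow> smooth_sum_of_products g \<Longrightarrow> smooth_sum_of_products (\<lambda>x. f x + g x)"

lemma smooth_mult:
  assumes "smooth f" "smooth g"
  shows "smooth (\<lambda>x. f x * g x)"
proof (rule smooth_if_closed[of smooth_sum_of_products])
  fix h assume "smooth_sum_of_products h"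
  then show "\<exists>h'. (\<forall>x. (h has_real_derivative h' x) (at x)) \<and> smooth_sum_of_products h'"
  proof induction
    case (mult f g)
    have "((\<lambda>x. f x * g x) has_real_derivative deriv f x * g x + f x * deriv g x) (at x)" for x
      using mult by (auto intro!: derivative_eq_intros smooth_imp_DERIV)
    moreover have "smooth_sum_of_products (\<lambda>x. deriv f x * g x + f x * deriv g x)"
      using mult by (intro smooth_sum_of_products.intros smooth_deriv)
    ultimately show ?case by (intro exI[of _ "\<lambda>x. deriv f x * g x + f x * deriv g x"]) blast
  next
    case (add f g)
    then obtain f' g' where "\<And>x. (f has_real_derivative f' x) (at x)" "\<And>x. (g has_real_derivative g' x) (at x)"
      "smooth_sum_of_products f'" "smooth_sum_of_products g'" by blast
    then show ?case
      by (intro exI[of _ "\<lambda>x. f' x + g' x"]) (auto intro!: derivative_eq_intros smooth_sum_of_products.add)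
  qed
qed (use assms smooth_sum_of_products.mult in blast)

section \<open>A smooth bump, step and ramp\<close>

lemma poly_times_exp_tendsto_0:
  fixes p :: "real poly"
  shows "((\<lambda>y. poly p y * y ^ k / exp y) \<longlongrightarrow> 0) at_top"
\<comment> \<open>The extra power \<open>y ^ k\<close> absorbs the factor \<open>y\<close> that
  splits off with each coefficient of the polynomial.\<close>
proof (induction p arbitrary: k)
  case (pCons a p)
  have "((\<lambda>y. a * (y ^ k / exp y) + poly p y * y ^ Suc k / exp y) \<longlongrightarrow> a * 0 + 0) at_top"
    by (intro tendsto_intros pCons tendsto_power_div_exp_0)
  then show ?case by (simp add: algebra_simps add_divide_distrib)
qed simp

text \<open>For \<open>p = 1\<close> this is the classical flat function \<open>exp (-1/x)\<close>.
  The polynomial in \<open>1/x\<close> is carried along so that the class is closed under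
  differentiation.\<close>

definition flat :: "real poly \<Rightarrow> real \<Rightarrow> real" where
  "flat p x = (if 0 < x then poly p (1 / x) * exp (- (1 / x)) else 0)"

lemma flat_DERIV:
  "(flat p has_real_derivative flat ([:0, 0, 1:] * (p - pderiv p)) x) (at x)"
proof -
  consider "x > 0" | "x < 0" | "x = 0" by linarith
  then show ?thesis
  proof cases
    case 1
    have "((\<lambda>x. poly p (1 / x) * exp (- (1 / x))) has_real_derivative
        flat ([:0, 0, 1:] * (p - pderiv p)) x) (at x)"
      using 1 by (auto intro!: derivative_eq_intros DERIV_chain2[OF poly_DERIV]
          simp: flat_def field_simps power2_eq_square)
    then show ?thesis
      by (rule has_field_derivative_transform_within_open[of _ _ _ "{0<..}"]) (use 1 in \<open>auto simp: flat_def\<close>)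
  next
    case 2
    have "((\<lambda>x. 0) has_real_derivative flat ([:0, 0, 1:] * (p - pderiv p)) x) (at x)"
      using 2 by (simp add: flat_def)
    then show ?thesis
      by (rule has_field_derivative_transform_within_open[of _ _ _ "{..<0}"]) (use 2 in \<open>auto simp: flat_def\<close>)
  next
    case 3
    \<comment> \<open>With \<open>y = 1/h\<close> the right difference quotient at \<open>0\<close>
      is a polynomial in \<open>y\<close> times \<open>y\<close>, divided by \<open>exp y\<close>;
      hence it tends to \<open>0\<close>.\<close>
    have "((\<lambda>h. poly p (inverse h) * (inverse h) ^ 1 / exp (inverse h)) \<longlongrightarrow> 0) (at_right 0)"
      by (rule filterlim_compose[OF poly_times_exp_tendsto_0 filterlim_inverse_at_top_right])
    then have "((\<lambda>h. (flat p (0 + h) - flat p 0) / h) \<longlongrightarrow> 0) (at_right 0)"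
      by (rule Lim_transform_eventually)
        (auto simp: flat_def eventually_at_right_less exp_minus field_simps intro!: eventually_mono[OF eventually_at_right_less[of 0]])
    moreover have "((\<lambda>h. (flat p (0 + h) - flat p 0) / h) \<longlongrightarrow> 0) (at_left 0)"
      by (rule Lim_transform_eventually[OF tendsto_const])
        (auto simp: flat_def intro!: eventually_mono[OF eventually_at_left_real[of "-1" 0]])
    ultimately have "((\<lambda>h. (flat p (0 + h) - flat p 0) / h) \<longlongrightarrow> 0) (at 0)"
      by (simp add: filterlim_split_at)
    then show ?thesis using 3 by (simp add: DERIV_def flat_def)
  qed
qed

lemma smooth_flat: "smooth (flat p)"
  by (rule smooth_if_closed[of "\<lambda>f. \<exists>p. f = flat p"]) (use flat_DERIV in blast)+

definition bump :: "real \<Rightarrow> real" where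
  "bump x = flat 1 x * flat 1 (1 - x)"

lemma smooth_bump: "smooth bump"
proof -
  have "smooth (\<lambda>x. 1 * flat 1 ((-1) * x + 1) + 0 * flat 1 (0 * x + 0))"
    by (intro smooth_affine_combination smooth_flat)
  then have "smooth (\<lambda>x. flat 1 (1 - x))" by simp
  from smooth_mult[OF smooth_flat this, of 1] show ?thesis by (simp add: bump_def[abs_def])
qed

lemma bump_nonneg: "0 \<le> bump x" and bump_pos: "0 < x \<Longrightarrow> x < 1 \<Longrightarrow> 0 < bump x"
  and bump_eq_0: "x \<le> 0 \<or> 1 \<le> x \<Longrightarrow> bump x = 0"
  by (auto simp: bump_def flat_def)

lemma smooth_imp_continuous_on: "smooth f \<Longrightarrow> continuous_on S f"
  by (meson DERIV_isCont continuous_at_imp_continuous_on smooth_imp_DERIV)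

text \<open>For negative \<open>x\<close> the interval \<open>{0..x}\<close> is empty and the
  integral has the value \<open>0\<close>. Since \<open>f\<close> vanishes there, this agrees with a
  primitive based at a point to the left of both \<open>0\<close> and \<open>x\<close>, to which the
  fundamental theorem applies.\<close>

lemma DERIV_integral_from_0:
  fixes f :: "real \<Rightarrow> real"
  assumes cont: "\<And>S. continuous_on S f" and zero: "\<And>x. x \<le> 0 \<Longrightarrow> f x = 0"
  shows "((\<lambda>x. integral {0..x} f) has_real_derivative f x) (at x)"
proof -
  define a c where "a = min x 0 - 1" and "c = x + 1"
  have ac: "x \<in> {a..c}" "a < x" "x < c" "a < 0" by (auto simp: a_def c_def)
  have "((\<lambda>y. integral {a..y} f) has_real_derivative f x) (at x within {a..c})"
    by (rule integral_has_real_derivative[OF cont ac(1)])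
  then have "((\<lambda>y. integral {a..y} f) has_real_derivative f x) (at x)"
    using ac by (simp add: at_within_Icc_at)
  moreover have "integral {a..y} f = integral {0..y} f" for y
  proof (cases "y \<ge> 0")
    case True
    have "integral {a..0} f + integral {0..y} f = integral {a..y} f"
      using True ac by (intro Henstock_Kurzweil_Integration.integral_combine integrable_continuous_interval cont) auto
    moreover have "integral {a..0} f = integral {a..0} (\<lambda>x. 0)"
      by (rule Henstock_Kurzweil_Integration.integral_cong) (use zero in auto)
    ultimately show ?thesis by simp
  next
    case False
    have "integral {a..y} f = integral {a..y} (\<lambda>x. 0)"
      by (rule Henstock_Kurzweil_Integration.integral_cong) (use zero False in auto)
    then show ?thesis using False by simp
  qed
  ultimately show ?thesis by simp
qed

definition smooth_step :: "real \<Rightarrow> real" where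
  "smooth_step x = integral {0..x} bump / integral {0..1} bump"

definition smooth_ramp :: "real \<Rightarrow> real" where
  "smooth_ramp x = integral {0..x} smooth_step"

lemma integral_bump_pos: "0 < integral {0..1} bump"
proof -
  have c: "continuous_on {0..1} bump" using smooth_bump by (rule smooth_imp_continuous_on)
  have i: "bump integrable_on {0..1}" using c by (rule integrable_continuous_interval)
  have "integral {0..1} bump \<noteq> 0"
  proof
    assume "integral {0..1} bump = 0"
    then have "(bump has_integral 0) (cbox 0 1)" using i by (simp add: has_integral_iff)
    then have "bump (1/2) = 0"
      by (rule has_integral_0_cbox_imp_0[of 0 1 bump, rotated 2]) (use c bump_nonneg in auto)
    then show False using bump_pos[of "1/2"] by simp
  qed
  moreover have "0 \<le> integral {0..1} bump" using i bump_nonneg by (intro integral_nonneg) auto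
  ultimately show ?thesis by simp
qed

lemma smooth_step_DERIV: "(smooth_step has_real_derivative bump x / integral {0..1} bump) (at x)"
  unfolding smooth_step_def[abs_def]
  by (intro DERIV_cdivide DERIV_integral_from_0) (use smooth_imp_continuous_on smooth_bump bump_eq_0 in auto)

lemma smooth_smooth_step: "smooth smooth_step"
proof (rule smooth_if_DERIV[OF smooth_step_DERIV])
  have "smooth (\<lambda>x. (1 / integral {0..1} bump) * bump (1 * x + 0) + 0 * bump (1 * x + 0))"
    by (intro smooth_affine_combination smooth_bump)
  then show "smooth (\<lambda>x. bump x / integral {0..1} bump)" by simp
qed

lemma smooth_step_mono: "x \<le> y \<Longrightarrow> smooth_step x \<le> smooth_step y"
  using smooth_step_DERIV bump_nonneg integral_bump_pos
  by (intro DERIV_nonneg_imp_nondecreasing[of x y smooth_step]) (auto intro!: exI divide_nonneg_pos)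

lemma smooth_step_eq_0: "x \<le> 0 \<Longrightarrow> smooth_step x = 0"
  by (cases "x = 0") (auto simp: smooth_step_def)

lemma smooth_step_eq_1: "1 \<le> x \<Longrightarrow> smooth_step x = 1"
proof -
  assume x: "1 \<le> x"
  have i: "bump integrable_on {a..b}" for a b
    by (intro integrable_continuous_interval smooth_imp_continuous_on smooth_bump)
  have "integral {0..1} bump + integral {1..x} bump = integral {0..x} bump"
    using x i by (intro Henstock_Kurzweil_Integration.integral_combine) auto
  moreover have "integral {1..x} bump = integral {1..x} (\<lambda>x. 0)"
    by (rule Henstock_Kurzweil_Integration.integral_cong) (auto simp: bump_eq_0)
  ultimately show "smooth_step x = 1" using integral_bump_pos by (simp add: smooth_step_def)
qed

lemma smooth_step_bounds: "0 \<le> smooth_step x" "smooth_step x \<le> 1"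
  using smooth_step_mono[of "min x 0" x] smooth_step_mono[of x "max x 1"]
  by (auto simp: smooth_step_eq_0 smooth_step_eq_1)

lemma smooth_ramp_DERIV: "(smooth_ramp has_real_derivative smooth_step x) (at x)"
  unfolding smooth_ramp_def[abs_def]
  by (intro DERIV_integral_from_0) (use smooth_imp_continuous_on smooth_smooth_step smooth_step_eq_0 in auto)

lemma smooth_smooth_ramp: "smooth smooth_ramp"
  by (rule smooth_if_DERIV[OF smooth_ramp_DERIV smooth_smooth_step])

lemma smooth_ramp_eq_0: "x \<le> 0 \<Longrightarrow> smooth_ramp x = 0"
  by (cases "x = 0") (auto simp: smooth_ramp_def)

lemma smooth_ramp_diff: "1 \<le> x \<Longrightarrow> 1 \<le> y \<Longrightarrow> smooth_ramp x - smooth_ramp y = x - y"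
proof -
  assume x: "1 \<le> x" "1 \<le> y"
  have *: "smooth_ramp x = smooth_ramp 1 + (x - 1)" if "1 \<le> x" for x
  proof -
    have i: "smooth_step integrable_on {a..b}" for a b
      by (intro integrable_continuous_interval smooth_imp_continuous_on smooth_smooth_step)
    have "integral {0..1} smooth_step + integral {1..x} smooth_step = integral {0..x} smooth_step"
      using that i by (intro Henstock_Kurzweil_Integration.integral_combine) auto
    moreover have "integral {1..x} smooth_step = integral {1..x} (\<lambda>x. 1)"
      by (rule Henstock_Kurzweil_Integration.integral_cong) (auto simp: smooth_step_eq_1)
    ultimately show ?thesis using that by (simp add: smooth_ramp_def)
  qed
  show ?thesis using *[OF x(1)] *[OF x(2)] by simp
qed

text \<open>
  As \<open>e \<rightarrow> 0\<close> the derivative tends to the indicator of \<open>(s, t]\<close>, while the total increase \<open>t - s\<close>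
  does not depend on \<open>e\<close>: differences of two such functions are test functions.
\<close>

definition window_ramp :: "real \<Rightarrow> real \<Rightarrow> real \<Rightarrow> real \<Rightarrow> real" where
  "window_ramp e s t x = e * (smooth_ramp ((x - s) / e) - smooth_ramp ((x - t) / e))"

lemma window_ramp_DERIV:
  "e \<noteq> 0 \<Longrightarrow> (window_ramp e s t has_real_derivative smooth_step ((x - s) / e) - smooth_step ((x - t) / e)) (at x)"
  unfolding window_ramp_def[abs_def]
  by (auto intro!: derivative_eq_intros DERIV_chain2[OF smooth_ramp_DERIV] simp: field_simps)

lemma smooth_window_ramp: "e \<noteq> 0 \<Longrightarrow> smooth (window_ramp e s t)"
proof -
  assume e: "e \<noteq> 0"
  have "smooth (\<lambda>x. e * smooth_ramp ((1 / e) * x + (- s / e)) + (- e) * smooth_ramp ((1 / e) * x + (- t / e)))"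
    by (intro smooth_affine_combination smooth_smooth_ramp)
  then show ?thesis by (simp add: window_ramp_def[abs_def] diff_divide_distrib right_diff_distrib)
qed

lemma window_ramp_left: "0 < e \<Longrightarrow> x \<le> s \<Longrightarrow> x \<le> t \<Longrightarrow> window_ramp e s t x = 0"
  by (simp add: window_ramp_def smooth_ramp_eq_0 divide_nonpos_pos)

lemma window_ramp_right: "0 < e \<Longrightarrow> s + e \<le> x \<Longrightarrow> t + e \<le> x \<Longrightarrow> window_ramp e s t x = t - s"
  by (simp add: window_ramp_def smooth_ramp_diff field_simps)

section \<open>The du Bois-Reymond lemma and primitives of weak derivatives\<close>

lemma absolutely_integrable_on_Ioo_iff:
  fixes f :: "real \<Rightarrow> real"
  shows "f absolutely_integrable_on {a<..<b} \<longleftrightarrow> f absolutely_integrable_on {a..b}"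
  by (simp add: absolutely_integrable_on_def integrable_on_open_interval_real)

lemma smooth_step_scaled_tendsto:
  assumes "\<delta> > 0"
  shows "(\<lambda>n. smooth_step ((x - s) / (\<delta> / real (Suc n)))) \<longlonglongrightarrow> (if s < x then 1 else 0)"
proof (cases "s < x")
  case True
  obtain N :: nat where N: "\<delta> / (x - s) < real N" using reals_Archimedean2 by blast
  have "smooth_step ((x - s) / (\<delta> / real (Suc n))) = 1" if n: "n \<ge> N" for n
  proof (rule smooth_step_eq_1)
    have "\<delta> / (x - s) \<le> real (Suc n)" using N n by linarith
    then show "1 \<le> (x - s) / (\<delta> / real (Suc n))" using True assms by (simp add: field_simps)
  qed
  then show ?thesis using True by (auto intro!: tendsto_eventually eventually_sequentiallyI[of N])
next
  case False
  then have "smooth_step ((x - s) / (\<delta> / real (Suc n))) = 0" for n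
    using assms by (intro smooth_step_eq_0 divide_nonpos_pos) auto
  then show ?thesis using False by simp
qed

lemma integral_smooth_step_tendsto:
  fixes z :: "real \<Rightarrow> real"
  assumes z: "z absolutely_integrable_on {0..b}" and s: "0 \<le> s" "s \<le> b" and \<delta>: "\<delta> > 0"
  shows "(\<lambda>n. integral {0..b} (\<lambda>x. z x * smooth_step ((x - s) / (\<delta> / real (Suc n))))) \<longlonglongrightarrow> integral {s..b} z"
proof -
  let ?g = "\<lambda>x. if s < x then z x else 0"
  have int: "(\<lambda>x. z x * smooth_step ((x - s) / (\<delta> / real (Suc n)))) integrable_on {0..b}" for n
  proof -
    have "continuous_on {0..b} (\<lambda>x. smooth_step ((x - s) / (\<delta> / real (Suc n))))"
      by (rule continuous_on_compose2[OF smooth_imp_continuous_on[OF smooth_smooth_step, of UNIV]])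
        (use \<delta> in \<open>auto intro!: continuous_intros\<close>)
    then show ?thesis
      using absolutely_integrable_mult_continuous(1)[OF z] by (simp add: absolutely_integrable_on_def)
  qed
  have abs: "(\<lambda>x. \<bar>z x\<bar>) integrable_on {0..b}" using z by (simp add: absolutely_integrable_on_def)
  have bound: "norm (z x * smooth_step y) \<le> \<bar>z x\<bar>" for x y
    using smooth_step_bounds[of y] by (simp add: abs_mult mult_left_le)
  have lim: "(\<lambda>n. z x * smooth_step ((x - s) / (\<delta> / real (Suc n)))) \<longlonglongrightarrow> ?g x" for x
    using tendsto_mult[OF tendsto_const[of "z x"] smooth_step_scaled_tendsto[OF \<delta>, of x s]]
    by (cases "s < x") auto
  have g: "?g integrable_on {0..b}"
    and conv: "(\<lambda>n. integral {0..b} (\<lambda>x. z x * smooth_step ((x - s) / (\<delta> / real (Suc n))))) \<longlonglongrightarrow> integral {0..b} ?g"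
    using dominated_convergence[OF int abs bound lim] by blast+
  have "integral {0..s} ?g + integral {s..b} ?g = integral {0..b} ?g"
    using s g by (intro Henstock_Kurzweil_Integration.integral_combine) auto
  moreover have "integral {0..s} ?g = integral {0..s} (\<lambda>x. 0)"
    by (rule Henstock_Kurzweil_Integration.integral_cong) auto
  moreover have "integral {s..b} ?g = integral {s..b} z"
    by (rule integral_spike[of "{s}"]) auto
  ultimately show ?thesis using conv by simp
qed

text \<open>At almost every \<open>x\<close>, a Lebesgue point, \<open>z x\<close> is the limit of
  the means over \<open>{x..x + h}\<close>, and these all equal \<open>c\<close>.\<close>

lemma AE_const_if_averages_const:
  fixes z :: "real \<Rightarrow> real"
  assumes z: "z absolutely_integrable_on {0..b}"
    and avg: "\<And>s t. 0 < s \<Longrightarrow> s < t \<Longrightarrow> t < b \<Longrightarrow> integral {s..t} z = c * (t - s)"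
  shows "AE x in lebesgue_on {0<..<b}. z x = c"
proof -
  \<comment> \<open>Extended by zero, because the theorem on Lebesgue points asks for integrability
    on every interval of the line.\<close>
  define f where "f x = (if x \<in> {0..b} then z x - c else 0)" for x
  have "(\<lambda>x. z x - c) integrable_on {0..b}"
    using z by (intro integrable_diff) (auto simp: absolutely_integrable_on_def)
  then have "f integrable_on UNIV" unfolding f_def[abs_def] integrable_restrict_UNIV .
  then have "f integrable_on cbox u v" for u v by (rule integrable_on_subcbox) simp
  then obtain N where N: "negligible N"
    and lebesgue_point: "\<And>x e. x \<notin> N \<Longrightarrow> 0 < e \<Longrightarrow> \<exists>d>0. \<forall>h. 0 < h \<and> h < d \<longrightarrow>
        norm (integral (cbox x (x + h *\<^sub>R One)) f /\<^sub>R h ^ DIM(real) - f x) < e"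
    using integrable_ccontinuous_explicit[of f] by blast
  have "z x = c" if x: "x \<in> {0<..<b}" "x \<notin> N" for x
  proof -
    have "\<bar>f x\<bar> \<le> 0"
    proof (rule field_le_epsilon)
      fix e :: real assume "e > 0"
      then have "\<exists>d>0. \<forall>h. 0 < h \<and> h < d \<longrightarrow> norm (integral (cbox x (x + h *\<^sub>R One)) f /\<^sub>R h ^ DIM(real) - f x) < e"
        by (rule lebesgue_point[OF x(2)])
      then obtain d where d: "d > 0" and
        small: "\<forall>h. 0 < h \<and> h < d \<longrightarrow> norm (integral (cbox x (x + h *\<^sub>R One)) f /\<^sub>R h ^ DIM(real) - f x) < e"
        by (elim exE conjE)
      define h where "h = min (d / 2) ((b - x) / 2)"
      have h: "0 < h" "h < d" "x + h < b" using d x by (auto simp: h_def min_def field_simps)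
      have "integral {x..x + h} f = integral {x..x + h} (\<lambda>y. z y - c)"
        by (rule Henstock_Kurzweil_Integration.integral_cong) (use x h in \<open>auto simp: f_def\<close>)
      also have "\<dots> = integral {x..x + h} z - integral {x..x + h} (\<lambda>y. c)"
        using absolutely_integrable_imp_integrable_sub[OF z, of x "x + h"] x h by (intro integral_diff) auto
      also have "\<dots> = 0" using avg[of x "x + h"] x h by simp
      finally show "\<bar>f x\<bar> \<le> 0 + e" using small[rule_format, of h] h(1,2) by simp
    qed
    then show ?thesis using x by (simp add: f_def)
  qed
  then have "AE x in lebesgue. x \<in> {0<..<b} \<longrightarrow> z x = c"
    by (intro AE_I'[of N]) (use N in \<open>auto simp: negligible_iff_null_sets\<close>)
  then show ?thesis by (simp add: AE_restrict_space_iff)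
qed

text \<open>The du Bois-Reymond lemma. Test functions whose derivatives approximate a combination of
  two indicators of intervals with integral zero show that the integrals of \<open>z\<close> over
  intervals are proportional to their lengths.\<close>

lemma AE_const_if_weak_derivative_zero:
  fixes z :: "real \<Rightarrow> real"
  assumes z: "z absolutely_integrable_on {0..b}" and b: "0 < b"
    and weak: "\<And>\<phi>. test_function {0<..<b} \<phi> \<Longrightarrow> integral {0..b} (\<lambda>x. z x * deriv \<phi> x) = 0"
  obtains c where "AE x in lebesgue_on {0<..<b}. z x = c"
proof -
  have proportional: "(t' - s') * integral {s..t} z = (t - s) * integral {s'..t'} z"
    if st: "0 < s" "s < t" "t < b" "0 < s'" "s' < t'" "t' < b" for s t s' t'
  proof -
    \<comment> \<open>Room to the right of both intervals: a ramp of width at most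
      \<open>\<delta>\<close> that starts at \<open>t\<close> or \<open>t'\<close> ends before
      \<open>b\<close>.\<close>
    define \<delta> where "\<delta> = (b - max t t') / 2"
    have \<delta>: "\<delta> > 0" "t + \<delta> < b" "t' + \<delta> < b" using st by (auto simp: \<delta>_def max_def field_simps)
    let ?e = "\<lambda>n. \<delta> / real (Suc n)"
    let ?I = "\<lambda>s n. integral {0..b} (\<lambda>x. z x * smooth_step ((x - s) / ?e n))"
    have "(t' - s') * (?I s n - ?I t n) - (t - s) * (?I s' n - ?I t' n) = 0" for n
    proof -
      have e: "?e n > 0" "?e n \<le> \<delta>" using \<delta> by (auto simp: field_simps)
      \<comment> \<open>The factors make the total increases of the two ramps, \<open>t - s\<close>
        and \<open>t' - s'\<close>, cancel, so that \<open>\<phi>\<close> vanishes again on the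
        right and has compact support.\<close>
      define \<phi> where "\<phi> x = (t' - s') * window_ramp (?e n) s t x - (t - s) * window_ramp (?e n) s' t' x" for x
      have "smooth (\<lambda>x. (t' - s') * window_ramp (?e n) s t (1 * x + 0) + (s - t) * window_ramp (?e n) s' t' (1 * x + 0))"
        using e by (intro smooth_affine_combination smooth_window_ramp) auto
      then have sm: "smooth \<phi>" by (simp add: \<phi>_def[abs_def] algebra_simps)
      have "\<phi> x = 0" if x: "x \<notin> {min s s'..max t t' + \<delta>}" for x
      proof (cases "x < min s s'")
        case True
        then show ?thesis using st e by (simp add: \<phi>_def window_ramp_left)
      next
        case False
        then have "max t t' + \<delta> < x" using x by auto
        then show ?thesis using st e by (simp add: \<phi>_def window_ramp_right)
      qed
      then have "test_function {0<..<b} \<phi>"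
        unfolding test_function_def using sm st \<delta>
        by (auto simp: smooth_def intro!: exI[of _ "{min s s'..max t t' + \<delta>}"])
      then have "0 = integral {0..b} (\<lambda>x. z x * deriv \<phi> x)" using weak by simp
      also have "\<dots> = integral {0..b} (\<lambda>x. z x * ((t' - s') * (smooth_step ((x - s) / ?e n) - smooth_step ((x - t) / ?e n))
           - (t - s) * (smooth_step ((x - s') / ?e n) - smooth_step ((x - t') / ?e n))))"
      proof -
        have "deriv \<phi> x = (t' - s') * (smooth_step ((x - s) / ?e n) - smooth_step ((x - t) / ?e n))
           - (t - s) * (smooth_step ((x - s') / ?e n) - smooth_step ((x - t') / ?e n))" for x
          unfolding \<phi>_def using e by (intro DERIV_imp_deriv DERIV_diff DERIV_cmult window_ramp_DERIV) auto
        then show ?thesis by simp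
      qed
      also have "\<dots> = (t' - s') * (?I s n - ?I t n) - (t - s) * (?I s' n - ?I t' n)"
      proof (rule integral_unique)
        have *: "((\<lambda>x. z x * smooth_step ((x - s) / ?e n)) has_integral ?I s n) {0..b}" for s
        proof (rule integrable_integral)
          have "continuous_on {0..b} (\<lambda>x. smooth_step ((x - s) / ?e n))"
            by (rule continuous_on_compose2[OF smooth_imp_continuous_on[OF smooth_smooth_step, of UNIV]])
              (use \<delta> in \<open>auto intro!: continuous_intros\<close>)
          then show "(\<lambda>x. z x * smooth_step ((x - s) / ?e n)) integrable_on {0..b}"
            using absolutely_integrable_mult_continuous(1)[OF z] by (simp add: absolutely_integrable_on_def)
        qed
        have "((\<lambda>x. (t' - s') * (z x * smooth_step ((x - s) / ?e n) - z x * smooth_step ((x - t) / ?e n))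
           - (t - s) * (z x * smooth_step ((x - s') / ?e n) - z x * smooth_step ((x - t') / ?e n))) has_integral
           ((t' - s') * (?I s n - ?I t n) - (t - s) * (?I s' n - ?I t' n))) {0..b}"
          by (intro has_integral_diff has_integral_mult_right *)
        then show "((\<lambda>x. z x * ((t' - s') * (smooth_step ((x - s) / ?e n) - smooth_step ((x - t) / ?e n))
           - (t - s) * (smooth_step ((x - s') / ?e n) - smooth_step ((x - t') / ?e n)))) has_integral
           ((t' - s') * (?I s n - ?I t n) - (t - s) * (?I s' n - ?I t' n))) {0..b}"
          by (rule has_integral_eq[rotated]) (simp add: algebra_simps)
      qed
      finally show ?thesis by simp
    qed
    moreover have "(\<lambda>n. (t' - s') * (?I s n - ?I t n) - (t - s) * (?I s' n - ?I t' n)) \<longlonglongrightarrow>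
       (t' - s') * (integral {s..b} z - integral {t..b} z) - (t - s) * (integral {s'..b} z - integral {t'..b} z)"
      using st \<delta> by (intro tendsto_intros integral_smooth_step_tendsto z) auto
    ultimately have "(t' - s') * (integral {s..b} z - integral {t..b} z) - (t - s) * (integral {s'..b} z - integral {t'..b} z) = 0"
      by (simp add: LIMSEQ_const_iff)
    moreover have "integral {s..b} z - integral {t..b} z = integral {s..t} z"
       "integral {s'..b} z - integral {t'..b} z = integral {s'..t'} z"
      using st by (auto simp: eq_diff_eq[symmetric] diff_eq_eq intro!: Henstock_Kurzweil_Integration.integral_combine[symmetric] absolutely_integrable_imp_integrable_sub[OF z])
    ultimately show ?thesis by simp
  qed
  \<comment> \<open>The mean over a fixed reference interval, the middle third, with which every
    other interval is compared.\<close>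
  define c where "c = integral {b/3..2*b/3} z * 3 / b"
  have "integral {s..t} z = c * (t - s)" if "0 < s" "s < t" "t < b" for s t
    using proportional[of s t "b/3" "2*b/3"] that b by (simp add: c_def field_simps)
  then show ?thesis using AE_const_if_averages_const[OF z] that by blast
qed

lemma test_function_primitive:
  assumes "test_function {0<..<b} \<phi>"
  shows "primitive_on b \<phi> (deriv \<phi>)" "\<phi> 0 = 0" "\<phi> b = 0"
    "continuous_on S \<phi>" "continuous_on S (deriv \<phi>)"
proof -
  have sm: "smooth \<phi>" using assms by (simp add: test_function_def smooth_def)
  show c: "continuous_on S \<phi>" "continuous_on S (deriv \<phi>)" for S
    using sm smooth_deriv smooth_imp_continuous_on by blast+
  show "primitive_on b \<phi> (deriv \<phi>)"
    by (rule primitive_on_C1) (use c smooth_imp_DERIV[OF sm] has_field_derivative_at_within in blast)+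
  show "\<phi> 0 = 0" "\<phi> b = 0" using assms by (fastforce simp: test_function_def)+
qed

text \<open>By the product rule the primitive \<open>W\<close> of \<open>w'\<close> also has
  \<open>w'\<close> as its weak derivative, so \<open>w - W\<close> has weak derivative zero and is
  constant almost everywhere.\<close>

theorem weak_derivative_imp_primitive:
  fixes w w' :: "real \<Rightarrow> real"
  assumes w: "w absolutely_integrable_on {0..b}" and w': "w' absolutely_integrable_on {0..b}" and b: "0 < b"
    and weak: "\<And>\<phi>. test_function {0<..<b} \<phi> \<Longrightarrow>
      (LINT x:{0<..<b}|lebesgue. w x * deriv \<phi> x) = - (LINT x:{0<..<b}|lebesgue. w' x * \<phi> x)"
  obtains c where "AE x in lebesgue_on {0<..<b}. w x = c + integral {0..x} w'"
proof -
  define W where "W x = 0 + integral {0..x} w'" for x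
  have W: "primitive_on b W w'" unfolding W_def[abs_def] by (rule primitive_on_integral[OF w'])
  have cW: "continuous_on {0..b} W" by (rule primitive_on_continuous[OF W])
  have z: "(\<lambda>x. w x - W x) absolutely_integrable_on {0..b}"
    using w absolutely_integrable_continuous_real[OF cW] by (rule set_integral_diff)
  have "integral {0..b} (\<lambda>x. (w x - W x) * deriv \<phi> x) = 0" if \<phi>: "test_function {0<..<b} \<phi>" for \<phi>
  proof -
    note \<phi>' = test_function_primitive[OF \<phi>]
    note mc = absolutely_integrable_mult_continuous(1)
    have conv: "(LINT x:{0<..<b}|lebesgue. f x) = integral {0..b} f" if "f absolutely_integrable_on {0..b}" for f :: "real \<Rightarrow> real"
      using set_lebesgue_integral_eq_integral(2)[of "{0<..<b}" f] that
      by (simp add: absolutely_integrable_on_Ioo_iff integral_open_interval_real)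
    have 1: "integral {0..b} (\<lambda>x. w x * deriv \<phi> x) = - integral {0..b} (\<lambda>x. w' x * \<phi> x)"
      using weak[OF \<phi>] conv mc[OF w \<phi>'(5)] mc[OF w' \<phi>'(4)] by simp
    have P: "primitive_on b (\<lambda>x. W x * \<phi> x) (\<lambda>x. w' x * \<phi> x + W x * deriv \<phi> x)"
      by (rule primitive_on_mult[OF W \<phi>'(1)])
    have i: "(\<lambda>x. w x * deriv \<phi> x) integrable_on {0..b}" "(\<lambda>x. w' x * \<phi> x) integrable_on {0..b}"
      "(\<lambda>x. W x * deriv \<phi> x) integrable_on {0..b}"
      using mc[OF w \<phi>'(5)] mc[OF w' \<phi>'(4)] mc[OF absolutely_integrable_continuous_real[OF cW] \<phi>'(5)]
      by (auto simp: absolutely_integrable_on_def)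
    have "0 = integral {0..b} (\<lambda>x. w' x * \<phi> x + W x * deriv \<phi> x)"
      using primitive_on_diff[OF P, of 0 b] b \<phi>'(2,3) by simp
    also have "\<dots> = integral {0..b} (\<lambda>x. w' x * \<phi> x) + integral {0..b} (\<lambda>x. W x * deriv \<phi> x)"
      using i by (intro integral_add)
    finally show ?thesis using 1 i by (simp add: left_diff_distrib integral_diff)
  qed
  from AE_const_if_weak_derivative_zero[OF z b this]
  obtain c where "AE x in lebesgue_on {0<..<b}. w x - W x = c" by blast
  then have "AE x in lebesgue_on {0<..<b}. w x = c + integral {0..x} w'"
    by eventually_elim (simp add: W_def)
  then show ?thesis by (rule that)
qed

section \<open>Fubini's theorem for Lebesgue measurable functions\<close>

lemma AE_lebesgue_on_iff:
  "S \<in> sets borel \<Longrightarrow> (AE x in lebesgue_on S. P x) \<longleftrightarrow> (AE x in lborel. x \<in> S \<longrightarrow> P x)"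
  by (subst AE_restrict_space_iff) (auto simp: AE_completion_iff)

lemma AE_in_lebesgue_on: "AE x in lebesgue_on S. x \<in> S"
  by (rule AE_I2) (simp add: space_restrict_space)

text \<open>\<open>P\<close> need not define a measurable set. The exceptional set is therefore
  enclosed in a Borel null set first, and almost all sections of that set are null.\<close>

lemma AE_lborel_prod:
  fixes P :: "real \<Rightarrow> real \<Rightarrow> bool"
  assumes "AE z in lborel. P (fst z) (snd z)"
  shows "AE a in lborel. AE x in lborel. P a x" "AE x in lborel. AE a in lborel. P a x"
proof -
  obtain N where N: "N \<in> null_sets (lborel :: (real \<times> real) measure)" "{z. \<not> P (fst z) (snd z)} \<subseteq> N"
    using assms by (auto simp: eventually_ae_filter)
  have Nm [measurable]: "N \<in> sets (lborel \<Otimes>\<^sub>M lborel)" unfolding lborel_prod using N(1) by blast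
  have "AE z in lborel. z \<notin> N" using N by (auto intro: AE_not_in)
  then have "AE z in lborel \<Otimes>\<^sub>M lborel. z \<notin> N" unfolding lborel_prod .
  then have 1: "AE a in lborel. AE x in lborel. (a, x) \<notin> N" by (rule lborel_pair.AE_pair)
  have "{z \<in> space (lborel \<Otimes>\<^sub>M lborel). (fst z, snd z) \<notin> N} \<in> sets (lborel \<Otimes>\<^sub>M lborel)"
    by measurable
  then have 2: "AE x in lborel. AE a in lborel. (a, x) \<notin> N"
    using 1 lborel_pair.AE_commute[of "\<lambda>a x. (a, x) \<notin> N"] by blast
  have *: "(a, x) \<notin> N \<Longrightarrow> P a x" for a x using subsetD[OF N(2), of "(a, x)"] by auto
  show "AE a in lborel. AE x in lborel. P a x" using 1 by eventually_elim (auto elim!: eventually_mono intro: *)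
  show "AE x in lborel. AE a in lborel. P a x" using 2 by eventually_elim (auto elim!: eventually_mono intro: *)
qed

lemma AE_lebesgue_on_Times:
  fixes A B :: "real set"
  assumes A: "A \<in> sets borel" and B: "B \<in> sets borel"
    and P: "AE (a, x) in lebesgue_on (A \<times> B). P a x"
  shows "AE a in lebesgue_on A. AE x in lebesgue_on B. P a x"
    "AE x in lebesgue_on B. AE a in lebesgue_on A. P a x"
proof -
  have "A \<times> B \<in> sets borel" using A B by (rule borel_Times)
  then have *: "AE z in lborel. (fst z \<in> A \<longrightarrow> snd z \<in> B \<longrightarrow> P (fst z) (snd z))"
    using P by (subst (asm) AE_lebesgue_on_iff) (auto elim!: eventually_mono)
  show "AE a in lebesgue_on A. AE x in lebesgue_on B. P a x"
    using AE_lborel_prod(1)[OF *] A B by (auto simp: AE_lebesgue_on_iff elim!: eventually_mono)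
  show "AE x in lebesgue_on B. AE a in lebesgue_on A. P a x"
    using AE_lborel_prod(2)[OF *] A B by (auto simp: AE_lebesgue_on_iff elim!: eventually_mono)
qed

lemma lebesgue_on_borel_version:
  fixes f g :: "real \<Rightarrow> real"
  assumes B: "B \<in> sets borel" and g [measurable]: "g \<in> borel_measurable borel"
    and eq: "AE x in lborel. (if x \<in> B then f x else 0) = g x"
  shows "f \<in> borel_measurable (lebesgue_on B)"
    "integrable (lebesgue_on B) f \<longleftrightarrow> integrable lborel g"
    "integral\<^sup>L (lebesgue_on B) f = integral\<^sup>L lborel g"
    "integral\<^sup>L (lebesgue_on B) (\<lambda>x. \<bar>f x\<bar>) = integral\<^sup>L lborel (\<lambda>x. \<bar>g x\<bar>)"
proof -
  let ?f = "\<lambda>x. if x \<in> B then f x else 0"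
  have Bl: "B \<in> sets lebesgue" using B by auto
  have eq': "AE x in lebesgue. g x = ?f x" using eq by (auto simp: AE_completion_iff elim!: eventually_mono)
  have gl: "g \<in> borel_measurable lebesgue" using g by (intro measurable_completion) auto
  have fl: "?f \<in> borel_measurable lebesgue" by (rule borel_measurable_AE[OF gl eq'])
  show "f \<in> borel_measurable (lebesgue_on B)" using fl borel_measurable_if[OF Bl, of f] by simp
  have ind: "(\<lambda>x. indicator B x *\<^sub>R h x) = (\<lambda>x. if x \<in> B then h x else 0)" for h :: "real \<Rightarrow> real"
    by (auto simp: indicator_def)
  have "integrable (lebesgue_on B) f \<longleftrightarrow> integrable lebesgue ?f"
    using integrable_restrict_space[of B lebesgue f] Bl unfolding ind by simp
  also have "\<dots> \<longleftrightarrow> integrable lebesgue g"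
    using eq' by (intro integrable_cong_AE fl gl) (auto elim!: eventually_mono)
  also have "\<dots> \<longleftrightarrow> integrable lborel g" by (rule integrable_completion) simp
  finally show "integrable (lebesgue_on B) f \<longleftrightarrow> integrable lborel g" .
  have "integral\<^sup>L (lebesgue_on B) f = integral\<^sup>L lebesgue ?f"
    using integral_restrict_space[of B lebesgue f] Bl unfolding ind by simp
  also have "\<dots> = integral\<^sup>L lebesgue g"
    using eq' by (intro integral_cong_AE fl gl) (auto elim!: eventually_mono)
  also have "\<dots> = integral\<^sup>L lborel g" by (rule integral_completion) simp
  finally show "integral\<^sup>L (lebesgue_on B) f = integral\<^sup>L lborel g" .
  have "integral\<^sup>L (lebesgue_on B) (\<lambda>x. \<bar>f x\<bar>) = integral\<^sup>L lebesgue (\<lambda>x. if x \<in> B then \<bar>f x\<bar> else 0)"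
    using integral_restrict_space[of B lebesgue "\<lambda>x. \<bar>f x\<bar>"] Bl unfolding ind by simp
  also have "(\<lambda>x. if x \<in> B then \<bar>f x\<bar> else 0) = (\<lambda>x. \<bar>?f x\<bar>)" by auto
  also have "integral\<^sup>L lebesgue (\<lambda>x. \<bar>?f x\<bar>) = integral\<^sup>L lebesgue (\<lambda>x. \<bar>g x\<bar>)"
    using eq' fl gl by (intro integral_cong_AE borel_measurable_abs) (auto elim!: eventually_mono)
  also have "\<dots> = integral\<^sup>L lborel (\<lambda>x. \<bar>g x\<bar>)" by (rule integral_completion) simp
  finally show "integral\<^sup>L (lebesgue_on B) (\<lambda>x. \<bar>f x\<bar>) = integral\<^sup>L lborel (\<lambda>x. \<bar>g x\<bar>)" .
qed

text \<open>Lebesgue measure on the plane is the completion of the product of \<open>lborel\<close>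
  with itself, and it is for the latter that product theorems hold. A Borel version \<open>g\<close>
  of the extension by zero is the bridge between the two, provided that it also agrees with
  \<open>f\<close> on almost every slice.\<close>

lemma lebesgue_on_Times_borel_version:
  fixes f :: "real \<Rightarrow> real \<Rightarrow> real"
  assumes A: "A \<in> sets borel" and B: "B \<in> sets borel"
    and f: "case_prod f \<in> borel_measurable (lebesgue_on (A \<times> B))"
  obtains g :: "real \<times> real \<Rightarrow> real" where "g \<in> borel_measurable borel"
    "AE z in lborel. (if z \<in> A \<times> B then case_prod f z else 0) = g z"
    "AE a in lebesgue_on A. AE x in lborel. (if x \<in> B then f a x else 0) = g (a, x)"
    "AE x in lebesgue_on B. AE a in lborel. (if a \<in> A then f a x else 0) = g (a, x)"
    "AE a in lborel. AE x in lborel. a \<notin> A \<longrightarrow> g (a, x) = 0"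
    "AE x in lborel. AE a in lborel. x \<notin> B \<longrightarrow> g (a, x) = 0"
proof -
  have AB: "A \<times> B \<in> sets borel" using A B by (rule borel_Times)
  have "(\<lambda>z. if z \<in> A \<times> B then case_prod f z else 0) \<in> borel_measurable lebesgue"
    using AB f by (subst borel_measurable_if) auto
  then obtain g where g: "g \<in> borel_measurable lborel"
      and eq: "AE z in lborel. (if z \<in> A \<times> B then case_prod f z else 0) = g z"
    using completion_ex_borel_measurable_real by blast
  have eq': "AE z in lborel. (if fst z \<in> A \<and> snd z \<in> B then f (fst z) (snd z) else 0) = g (fst z, snd z)"
    using eq by eventually_elim (auto split: prod.splits if_splits)
  note E = AE_lborel_prod[OF eq']
  show thesis
  proof (rule that[of g])
    show "AE a in lebesgue_on A. AE x in lborel. (if x \<in> B then f a x else 0) = g (a, x)"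
      using E(1) A by (auto simp: AE_lebesgue_on_iff elim!: eventually_mono)
    show "AE x in lebesgue_on B. AE a in lborel. (if a \<in> A then f a x else 0) = g (a, x)"
      using E(2) B by (auto simp: AE_lebesgue_on_iff elim!: eventually_mono)
    show "AE a in lborel. AE x in lborel. a \<notin> A \<longrightarrow> g (a, x) = 0"
      using E(1) by (auto elim!: eventually_mono)
    show "AE x in lborel. AE a in lborel. x \<notin> B \<longrightarrow> g (a, x) = 0"
      using E(2) by (auto elim!: eventually_mono)
  qed (use g eq in auto)
qed

lemma integrable_lebesgue_on_Times:
  fixes f :: "real \<Rightarrow> real \<Rightarrow> real"
  assumes A: "A \<in> sets borel" and B: "B \<in> sets borel"
    and f: "case_prod f \<in> borel_measurable (lebesgue_on (A \<times> B))"
    and int: "AE a in lebesgue_on A. integrable (lebesgue_on B) (f a)"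
    and bound: "AE a in lebesgue_on A. (\<integral>x. \<bar>f a x\<bar> \<partial>lebesgue_on B) \<le> h a"
    and h: "integrable (lebesgue_on A) h"
  shows "integrable (lebesgue_on (A \<times> B)) (case_prod f)"
proof -
  have AB: "A \<times> B \<in> sets borel" using A B by (rule borel_Times)
  obtain g where g [measurable]: "g \<in> borel_measurable borel"
    and eq0: "AE z in lborel. (if z \<in> A \<times> B then case_prod f z else 0) = g z"
    and eq: "AE a in lebesgue_on A. AE x in lborel. (if x \<in> B then f a x else 0) = g (a, x)"
    and zero: "AE a in lborel. AE x in lborel. a \<notin> A \<longrightarrow> g (a, x) = 0"
    using lebesgue_on_Times_borel_version[OF A B f] by blast
  have [measurable]: "g \<in> borel_measurable (lborel \<Otimes>\<^sub>M lborel)" by (simp add: lborel_prod)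
  have zero': "AE a in lborel. a \<notin> A \<longrightarrow> integrable lborel (\<lambda>x. g (a, x)) \<and> (\<integral>x. \<bar>g (a, x)\<bar> \<partial>lborel) = 0"
    using zero
  proof eventually_elim
    case (elim a)
    show ?case
    proof (intro impI conjI)
      assume "a \<notin> A"
      then have z: "AE x in lborel. g (a, x) = 0" using elim by auto
      show "integrable lborel (\<lambda>x. g (a, x))" using z by (subst integrable_cong_AE[where g = "\<lambda>x. 0"]) auto
      have "(\<integral>x. \<bar>g (a, x)\<bar> \<partial>lborel) = (\<integral>x. 0 \<partial>(lborel :: real measure))"
        using z by (intro integral_cong_AE) auto
      then show "(\<integral>x. \<bar>g (a, x)\<bar> \<partial>lborel) = 0" by simp
    qed
  qed
  have "AE a in lebesgue_on A. integrable lborel (\<lambda>x. g (a, x)) \<and> (\<integral>x. \<bar>g (a, x)\<bar> \<partial>lborel) \<le> h a"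
    using eq int bound
  proof eventually_elim
    case (elim a)
    have [measurable]: "(\<lambda>x. g (a, x)) \<in> borel_measurable borel" by measurable
    show ?case using lebesgue_on_borel_version[OF B _ elim(1)] elim(2,3) by simp
  qed
  then have *: "AE a in lborel. integrable lborel (\<lambda>x. g (a, x)) \<and>
      (\<integral>x. \<bar>g (a, x)\<bar> \<partial>lborel) \<le> (if a \<in> A then h a else 0)"
    using A zero' by (subst (asm) AE_lebesgue_on_iff) auto
  have hi: "integrable lebesgue (\<lambda>a. if a \<in> A then h a else 0)"
  proof -
    have "integrable lebesgue (\<lambda>a. indicator A a *\<^sub>R h a)" using h A by (subst (asm) integrable_restrict_space) auto
    moreover have "(\<lambda>a. indicator A a *\<^sub>R h a) = (\<lambda>a. if a \<in> A then h a else 0)" by (auto simp: indicator_def)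
    ultimately show ?thesis by simp
  qed
  have "integrable lebesgue (\<lambda>a. \<integral>x. norm (g (a, x)) \<partial>lborel)"
  proof (rule Bochner_Integration.integrable_bound[OF hi])
    show "(\<lambda>a. \<integral>x. norm (g (a, x)) \<partial>lborel) \<in> borel_measurable lebesgue"
      by (intro measurable_completion) measurable
    have "AE a in lebesgue. (\<integral>x. \<bar>g (a, x)\<bar> \<partial>lborel) \<le> (if a \<in> A then h a else 0)"
      using * by (auto simp: AE_completion_iff elim!: eventually_mono)
    then show "AE a in lebesgue. norm (\<integral>x. norm (g (a, x)) \<partial>lborel) \<le> norm (if a \<in> A then h a else 0)"
    proof eventually_elim
      case (elim a)
      have "0 \<le> (\<integral>x. \<bar>g (a, x)\<bar> \<partial>lborel)" by simp
      then show ?case using elim by (auto split: if_splits)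
    qed
  qed
  then have "integrable lborel (\<lambda>a. \<integral>x. norm (g (a, x)) \<partial>lborel)"
    by (subst (asm) integrable_completion) measurable
  then have "integrable (lborel \<Otimes>\<^sub>M lborel) g"
    using * by (intro lborel_pair.Fubini_integrable) (auto elim!: eventually_mono)
  then have gi: "integrable lborel g" by (simp add: lborel_prod)
  have gl: "g \<in> borel_measurable lebesgue" by (intro measurable_completion) simp
  have fl: "(\<lambda>z. if z \<in> A \<times> B then case_prod f z else 0) \<in> borel_measurable lebesgue"
    using AB f by (subst borel_measurable_if) auto
  have "integrable lebesgue (\<lambda>z. if z \<in> A \<times> B then case_prod f z else 0)"
    using gi eq0 by (subst integrable_cong_AE[OF fl gl]) (auto simp: AE_completion_iff integrable_completion)
  moreover have "(\<lambda>z. if z \<in> A \<times> B then case_prod f z else 0) = (\<lambda>z. indicator (A \<times> B) z *\<^sub>R case_prod f z)"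
    by (auto simp: indicator_def)
  ultimately show ?thesis using AB by (subst integrable_restrict_space) auto
qed

lemma Fubini_lebesgue_on:
  fixes f :: "real \<Rightarrow> real \<Rightarrow> real"
  assumes A: "A \<in> sets borel" and B: "B \<in> sets borel"
    and int: "integrable (lebesgue_on (A \<times> B)) (case_prod f)"
  shows "AE a in lebesgue_on A. integrable (lebesgue_on B) (f a)"
    "integrable (lebesgue_on A) (\<lambda>a. \<integral>x. f a x \<partial>lebesgue_on B)"
    "AE x in lebesgue_on B. integrable (lebesgue_on A) (\<lambda>a. f a x)"
    "integrable (lebesgue_on B) (\<lambda>x. \<integral>a. f a x \<partial>lebesgue_on A)"
    "(\<integral>a. (\<integral>x. f a x \<partial>lebesgue_on B) \<partial>lebesgue_on A) = (\<integral>x. (\<integral>a. f a x \<partial>lebesgue_on A) \<partial>lebesgue_on B)"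
proof -
  have AB: "A \<times> B \<in> sets borel" using A B by (rule borel_Times)
  have f: "case_prod f \<in> borel_measurable (lebesgue_on (A \<times> B))" using int by simp
  obtain g where g [measurable]: "g \<in> borel_measurable borel"
    and eq0: "AE z in lborel. (if z \<in> A \<times> B then case_prod f z else 0) = g z"
    and eq1: "AE a in lebesgue_on A. AE x in lborel. (if x \<in> B then f a x else 0) = g (a, x)"
    and eq2: "AE x in lebesgue_on B. AE a in lborel. (if a \<in> A then f a x else 0) = g (a, x)"
    and zero1: "AE a in lborel. AE x in lborel. a \<notin> A \<longrightarrow> g (a, x) = 0"
    and zero2: "AE x in lborel. AE a in lborel. x \<notin> B \<longrightarrow> g (a, x) = 0"
    by (rule lebesgue_on_Times_borel_version[OF A B f])
  have [measurable]: "g \<in> borel_measurable (lborel \<Otimes>\<^sub>M lborel)" by (simp add: lborel_prod)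
  have gl: "g \<in> borel_measurable lebesgue" by (intro measurable_completion) simp
  have fl: "(\<lambda>z. if z \<in> A \<times> B then case_prod f z else 0) \<in> borel_measurable lebesgue"
    using AB f by (subst borel_measurable_if) auto
  have "(\<lambda>z. if z \<in> A \<times> B then case_prod f z else 0) = (\<lambda>z. indicator (A \<times> B) z *\<^sub>R case_prod f z)"
    by (auto simp: indicator_def)
  then have "integrable lebesgue (\<lambda>z. if z \<in> A \<times> B then case_prod f z else 0)"
    using int AB by (subst (asm) integrable_restrict_space) auto
  then have "integrable lebesgue g"
    using eq0 by (subst (asm) integrable_cong_AE[OF fl gl]) (auto simp: AE_completion_iff)
  then have "integrable lborel g" by (subst (asm) integrable_completion) auto
  then have gi: "integrable (lborel \<Otimes>\<^sub>M lborel) (\<lambda>(a, x). g (a, x))" by (simp add: lborel_prod)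
  define G1 where "G1 a = (\<integral>x. g (a, x) \<partial>lborel)" for a
  define G2 where "G2 x = (\<integral>a. g (a, x) \<partial>lborel)" for x
  have G1m [measurable]: "G1 \<in> borel_measurable borel" unfolding G1_def by measurable
  have G2m [measurable]: "G2 \<in> borel_measurable borel" unfolding G2_def by measurable
  have s1: "AE a in lebesgue_on A. (integrable (lebesgue_on B) (f a) \<longleftrightarrow> integrable lborel (\<lambda>x. g (a, x))) \<and>
      (\<integral>x. f a x \<partial>lebesgue_on B) = G1 a"
    using eq1
  proof eventually_elim
    case (elim a)
    have [measurable]: "(\<lambda>x. g (a, x)) \<in> borel_measurable borel" by measurable
    show ?case using lebesgue_on_borel_version[OF B _ elim] by (simp add: G1_def)
  qed
  have s2: "AE x in lebesgue_on B. (integrable (lebesgue_on A) (\<lambda>a. f a x) \<longleftrightarrow> integrable lborel (\<lambda>a. g (a, x))) \<and>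
      (\<integral>a. f a x \<partial>lebesgue_on A) = G2 x"
    using eq2
  proof eventually_elim
    case (elim x)
    have [measurable]: "(\<lambda>a. g (a, x)) \<in> borel_measurable borel" by measurable
    show ?case using lebesgue_on_borel_version[OF A _ elim] by (simp add: G2_def)
  qed
  have "AE a in lebesgue_on A. integrable lborel (\<lambda>x. g (a, x))"
    using lborel_pair.AE_integrable_fst[OF gi] A by (auto simp: AE_lebesgue_on_iff elim!: eventually_mono)
  then show "AE a in lebesgue_on A. integrable (lebesgue_on B) (f a)" using s1 by eventually_elim simp
  have "AE x in lebesgue_on B. integrable lborel (\<lambda>a. g (a, x))"
    using lborel_pair.AE_integrable_snd[OF gi] B by (auto simp: AE_lebesgue_on_iff elim!: eventually_mono)
  then show "AE x in lebesgue_on B. integrable (lebesgue_on A) (\<lambda>a. f a x)" using s2 by eventually_elim simp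
  have E1: "AE a in lborel. (if a \<in> A then (\<integral>x. f a x \<partial>lebesgue_on B) else 0) = G1 a"
  proof -
    have "AE a in lborel. a \<in> A \<longrightarrow> (\<integral>x. f a x \<partial>lebesgue_on B) = G1 a"
      using s1 A by (auto simp: AE_lebesgue_on_iff elim!: eventually_mono)
    moreover have "AE a in lborel. a \<notin> A \<longrightarrow> G1 a = 0"
      using zero1
    proof eventually_elim
      case (elim a)
      have "a \<notin> A \<Longrightarrow> G1 a = (\<integral>x. 0 \<partial>(lborel :: real measure))"
        unfolding G1_def using elim by (intro integral_cong_AE) auto
      then show ?case by simp
    qed
    ultimately show ?thesis by eventually_elim auto
  qed
  have E2: "AE x in lborel. (if x \<in> B then (\<integral>a. f a x \<partial>lebesgue_on A) else 0) = G2 x"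
  proof -
    have "AE x in lborel. x \<in> B \<longrightarrow> (\<integral>a. f a x \<partial>lebesgue_on A) = G2 x"
      using s2 B by (auto simp: AE_lebesgue_on_iff elim!: eventually_mono)
    moreover have "AE x in lborel. x \<notin> B \<longrightarrow> G2 x = 0"
      using zero2
    proof eventually_elim
      case (elim x)
      have "x \<notin> B \<Longrightarrow> G2 x = (\<integral>a. 0 \<partial>(lborel :: real measure))"
        unfolding G2_def using elim by (intro integral_cong_AE) auto
      then show ?case by simp
    qed
    ultimately show ?thesis by eventually_elim auto
  qed
  have i1: "integrable lborel G1" unfolding G1_def using lborel_pair.integrable_fst[OF gi] by simp
  have i2: "integrable lborel G2" unfolding G2_def using lborel_pair.integrable_snd[OF gi] by simp
  note V1 = lebesgue_on_borel_version[OF A G1m E1] and V2 = lebesgue_on_borel_version[OF B G2m E2]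
  show "integrable (lebesgue_on A) (\<lambda>a. \<integral>x. f a x \<partial>lebesgue_on B)" using V1(2) i1 by simp
  show "integrable (lebesgue_on B) (\<lambda>x. \<integral>a. f a x \<partial>lebesgue_on A)" using V2(2) i2 by simp
  have "integral\<^sup>L lborel G1 = integral\<^sup>L lborel G2"
    unfolding G1_def G2_def using lborel_pair.integral_fst[OF gi] lborel_pair.integral_snd[OF gi] by simp
  then show "(\<integral>a. (\<integral>x. f a x \<partial>lebesgue_on B) \<partial>lebesgue_on A) = (\<integral>x. (\<integral>a. f a x \<partial>lebesgue_on A) \<partial>lebesgue_on B)"
    using V1(3) V2(3) by simp
qed

text \<open>A Lebesgue measurable function of one variable differs from a Borel function only on a
  null set \<open>N\<close>, and the strip over \<open>N\<close> is null in the plane.\<close>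

lemma borel_measurable_lebesgue_on_Times:
  fixes g :: "real \<Rightarrow> real"
  assumes A: "A \<in> sets borel" and B: "B \<in> sets borel"
  shows "g \<in> borel_measurable (lebesgue_on A) \<Longrightarrow> (\<lambda>(a, x). g a) \<in> borel_measurable (lebesgue_on (A \<times> B))"
    and "g \<in> borel_measurable (lebesgue_on B) \<Longrightarrow> (\<lambda>(a, x). g x) \<in> borel_measurable (lebesgue_on (A \<times> B))"
proof -
  have AB: "A \<times> B \<in> sets borel" using A B by (rule borel_Times)
  have version: "\<exists>h\<in>borel_measurable borel. AE x in lborel. (if x \<in> S then g x else 0) = h x"
    if S: "S \<in> sets borel" and g: "g \<in> borel_measurable (lebesgue_on S)" for S :: "real set"
  proof -
    have "(\<lambda>x. if x \<in> S then g x else 0) \<in> borel_measurable lebesgue"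
      using S g by (subst borel_measurable_if) auto
    from completion_ex_borel_measurable_real[OF this] show ?thesis by simp
  qed
  have null: "AE z in lborel. fst z \<notin> N" "AE z in lborel. snd z \<notin> N"
    if N: "N \<in> null_sets (lborel :: real measure)" for N
  proof -
    have [measurable]: "N \<in> sets borel" using N by auto
    have "AE z in lborel \<Otimes>\<^sub>M lborel. fst z \<notin> N"
      by (rule lborel_pair.AE_pair_measure, measurable) (use AE_not_in[OF N] in \<open>auto elim!: eventually_mono\<close>)
    moreover have "AE z in lborel \<Otimes>\<^sub>M lborel. snd z \<notin> N"
      by (rule lborel_pair.AE_pair_measure, measurable) (use AE_not_in[OF N] in auto)
    ultimately show "AE z in lborel. fst z \<notin> N" "AE z in lborel. snd z \<notin> N" unfolding lborel_prod by blast+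
  qed
  have transfer: "F \<in> borel_measurable (lebesgue_on (A \<times> B))"
    if F: "\<And>z. z \<in> A \<times> B \<Longrightarrow> F z = G z" and h: "h \<in> borel_measurable borel"
    and eq: "AE z in lborel. G z = h z" for F G h :: "real \<times> real \<Rightarrow> real"
  proof -
    have "h \<in> borel_measurable lebesgue" using h by (intro measurable_completion) auto
    then have "G \<in> borel_measurable lebesgue"
      by (rule borel_measurable_AE) (use eq in \<open>auto simp: AE_completion_iff elim!: eventually_mono\<close>)
    then have "G \<in> borel_measurable (lebesgue_on (A \<times> B))" by (rule measurable_restrict_space1)
    then show ?thesis using F by (subst measurable_cong[where g = G]) auto
  qed
  show "(\<lambda>(a, x). g a) \<in> borel_measurable (lebesgue_on (A \<times> B))" if g: "g \<in> borel_measurable (lebesgue_on A)"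
  proof -
    obtain h where h [measurable]: "h \<in> borel_measurable borel" and "AE x in lborel. (if x \<in> A then g x else 0) = h x"
      using version[OF A g] by blast
    then obtain N where N: "N \<in> null_sets lborel" "{x. (if x \<in> A then g x else 0) \<noteq> h x} \<subseteq> N"
      by (auto simp: eventually_ae_filter)
    show ?thesis
    proof (rule transfer)
      show "(case z of (a, x) \<Rightarrow> g a) = (if fst z \<in> A then g (fst z) else 0)" if "z \<in> A \<times> B" for z using that by auto
      show "(\<lambda>z. h (fst z)) \<in> borel_measurable borel" by (intro measurable_compose[OF _ h] borel_measurable_continuous_onI continuous_intros)
      show "AE z in lborel. (if fst z \<in> A then g (fst z) else 0) = h (fst z)"
        using null(1)[OF N(1)] by (rule eventually_mono) (use subsetD[OF N(2)] in blast)
    qed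
  qed
  show "(\<lambda>(a, x). g x) \<in> borel_measurable (lebesgue_on (A \<times> B))" if g: "g \<in> borel_measurable (lebesgue_on B)"
  proof -
    obtain h where h [measurable]: "h \<in> borel_measurable borel" and "AE x in lborel. (if x \<in> B then g x else 0) = h x"
      using version[OF B g] by blast
    then obtain N where N: "N \<in> null_sets lborel" "{x. (if x \<in> B then g x else 0) \<noteq> h x} \<subseteq> N"
      by (auto simp: eventually_ae_filter)
    show ?thesis
    proof (rule transfer)
      show "(case z of (a, x) \<Rightarrow> g x) = (if snd z \<in> B then g (snd z) else 0)" if "z \<in> A \<times> B" for z using that by auto
      show "(\<lambda>z. h (snd z)) \<in> borel_measurable borel" by (intro measurable_compose[OF _ h] borel_measurable_continuous_onI continuous_intros)
      show "AE z in lborel. (if snd z \<in> B then g (snd z) else 0) = h (snd z)"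
        using null(2)[OF N(1)] by (rule eventually_mono) (use subsetD[OF N(2)] in blast)
    qed
  qed
qed

section \<open>Continuous maps into \<open>L\<^sup>\<infinity>\<close>\<close>

lemma borel_measurable_lebesgue_on_AE:
  fixes f g :: "'a::euclidean_space \<Rightarrow> real"
  assumes S: "S \<in> sets borel" and f: "f \<in> borel_measurable (lebesgue_on S)"
    and eq: "AE x in lebesgue_on S. f x = g x"
  shows "g \<in> borel_measurable (lebesgue_on S)"
proof -
  have Sl: "S \<in> sets lebesgue" using S by auto
  have "(\<lambda>x. if x \<in> S then f x else 0) \<in> borel_measurable lebesgue"
    using f Sl by (subst borel_measurable_if) auto
  moreover have "AE x in lebesgue. (if x \<in> S then f x else 0) = (if x \<in> S then g x else 0)"
    using eq Sl by (subst (asm) AE_restrict_space_iff) (auto elim!: eventually_mono)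
  ultimately have "(\<lambda>x. if x \<in> S then g x else 0) \<in> borel_measurable lebesgue" by (rule borel_measurable_AE)
  then show ?thesis using Sl by (subst (asm) borel_measurable_if) auto
qed

lemma AE_lebesgue_on_Times_fst:
  fixes A B :: "real set"
  assumes A: "A \<in> sets borel" and B: "B \<in> sets borel" and P: "AE a in lebesgue_on A. P a"
  shows "AE (a, x) in lebesgue_on (A \<times> B). P a"
proof -
  have AB: "A \<times> B \<in> sets borel" using A B by (rule borel_Times)
  obtain N where N: "N \<in> null_sets (lborel :: real measure)" "{a. \<not> (a \<in> A \<longrightarrow> P a)} \<subseteq> N"
    using P[unfolded AE_lebesgue_on_iff[OF A]] unfolding eventually_ae_filter by auto
  have N2: "a \<notin> N \<Longrightarrow> a \<in> A \<Longrightarrow> P a" for a using N(2) by blast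
  have [measurable]: "N \<in> sets borel" using N by auto
  have "AE z in lborel \<Otimes>\<^sub>M (lborel :: real measure). fst z \<notin> N"
    by (rule lborel_pair.AE_pair_measure, measurable) (use AE_not_in[OF N(1)] in \<open>auto elim!: eventually_mono\<close>)
  then have "AE z in (lborel :: (real \<times> real) measure). fst z \<notin> N" unfolding lborel_prod .
  then have "AE z in lborel. z \<in> A \<times> B \<longrightarrow> (case z of (a, x) \<Rightarrow> P a)"
    by (rule eventually_mono) (auto intro: N2)
  then show ?thesis by (simp add: AE_lebesgue_on_iff[OF AB])
qed

text \<open>A plane set with null slices need not be null unless it is measurable. The inequality is
  therefore moved to a Borel version of \<open>f\<close>, for which slices in either order
  decide.\<close>

lemma AE_lebesgue_on_Times_le:
  fixes f :: "real \<Rightarrow> real \<Rightarrow> real"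
  assumes A: "A \<in> sets borel" and B: "B \<in> sets borel"
    and f: "case_prod f \<in> borel_measurable (lebesgue_on (A \<times> B))"
    and le: "(AE x in lebesgue_on B. AE a in lebesgue_on A. f a x \<le> c) \<or>
      (AE a in lebesgue_on A. AE x in lebesgue_on B. f a x \<le> c)"
  shows "AE (a, x) in lebesgue_on (A \<times> B). f a x \<le> c"
proof -
  have AB: "A \<times> B \<in> sets borel" using A B by (rule borel_Times)
  note [measurable] = A B
  obtain g where g [measurable]: "g \<in> borel_measurable borel"
    and eq0: "AE z in lborel. (if z \<in> A \<times> B then case_prod f z else 0) = g z"
    and eq1: "AE a in lebesgue_on A. AE x in lborel. (if x \<in> B then f a x else 0) = g (a, x)"
    and eq2: "AE x in lebesgue_on B. AE a in lborel. (if a \<in> A then f a x else 0) = g (a, x)"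
    using lebesgue_on_Times_borel_version[OF A B f] by blast
  have [measurable]: "g \<in> borel_measurable (lborel \<Otimes>\<^sub>M lborel)" by (simp add: lborel_prod)
  let ?P = "\<lambda>a x. a \<in> A \<longrightarrow> x \<in> B \<longrightarrow> g (a, x) \<le> c"
  have P [measurable]: "{z \<in> space (lborel \<Otimes>\<^sub>M lborel). ?P (fst z) (snd z)} \<in> sets (lborel \<Otimes>\<^sub>M lborel)"
    by measurable
  have slice: "AE t in lborel. s \<in> S \<longrightarrow> t \<in> T \<longrightarrow> k t \<le> c"
    if "s \<in> S \<longrightarrow> (AE t in lborel. (if t \<in> T then h t else 0) = k t)"
      and "s \<in> S \<longrightarrow> (AE t in lebesgue_on T. h t \<le> c)" and T: "T \<in> sets borel"
    for s :: real and S T and h k :: "real \<Rightarrow> real"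
  proof (cases "s \<in> S")
    case True
    have "AE t in lborel. (if t \<in> T then h t else 0) = k t" using that(1) True by simp
    moreover have "AE t in lborel. t \<in> T \<longrightarrow> h t \<le> c" using that(2) True by (simp add: AE_lebesgue_on_iff[OF T])
    ultimately show ?thesis by eventually_elim auto
  qed simp
  have "AE a in lborel. AE x in lborel. ?P a x"
    using le
  proof
    assume "AE a in lebesgue_on A. AE x in lebesgue_on B. f a x \<le> c"
    with eq1 show ?thesis unfolding AE_lebesgue_on_iff[OF A] by eventually_elim (rule slice[OF _ _ B])
  next
    assume "AE x in lebesgue_on B. AE a in lebesgue_on A. f a x \<le> c"
    with eq2 have "AE x in lborel. AE a in lborel. x \<in> B \<longrightarrow> a \<in> A \<longrightarrow> g (a, x) \<le> c"
      unfolding AE_lebesgue_on_iff[OF B] by eventually_elim (rule slice[OF _ _ A])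
    then have "AE x in lborel. AE a in lborel. ?P a x" by (auto elim!: eventually_mono)
    then show ?thesis using lborel_pair.AE_commute[of ?P, OF P] by blast
  qed
  then have "AE z in lborel \<Otimes>\<^sub>M lborel. ?P (fst z) (snd z)"
    using lborel_pair.AE_pair_iff[of ?P, OF P] by blast
  then have "AE z in lborel. ?P (fst z) (snd z)" unfolding lborel_prod .
  then have "AE z in lborel. z \<in> A \<times> B \<longrightarrow> (case z of (a, x) \<Rightarrow> f a x \<le> c)"
    using eq0 by eventually_elim (auto split: if_splits)
  then show ?thesis by (simp add: AE_lebesgue_on_iff[OF AB])
qed

lemma Linf_norm_less_imp_AE:
  assumes "Linf_norm I g < ennreal c"
  shows "AE a in lebesgue_on I. \<bar>g a\<bar> \<le> c"
proof -
  have "AE a in lebesgue_on I. ennreal \<bar>g a\<bar> \<le> Linf_norm I g"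
    unfolding Linf_norm_def by (rule esssup_AE)
  then show ?thesis
    by eventually_elim (use assms in \<open>smt (verit) ennreal_leI ennreal_neg le_less_trans less_le_not_le not_le zero_less_iff_neq_zero\<close>)
qed

lemma in_Linf_bounded:
  assumes "in_Linf I g"
  obtains c where "0 \<le> c" "AE a in lebesgue_on I. \<bar>g a\<bar> \<le> c"
proof -
  have "Linf_norm I g \<noteq> top" using assms by (auto simp: in_Linf_def)
  then obtain r where r: "0 \<le> r" "Linf_norm I g = ennreal r" by (cases "Linf_norm I g") auto
  then have "Linf_norm I g < ennreal (r + 1)" by (simp add: ennreal_lessI)
  from Linf_norm_less_imp_AE[OF this] show ?thesis using r that[of "r + 1"] by auto
qed

lemma Linf_norm_subset:
  assumes "J \<subseteq> I" "I \<in> sets borel" "J \<in> sets borel" "g \<in> borel_measurable (lebesgue_on I)"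
  shows "Linf_norm J g \<le> Linf_norm I g"
proof -
  have gJ: "g \<in> borel_measurable (lebesgue_on J)"
    using assms measurable_restrict_mono by blast
  have "AE a in lebesgue_on I. ennreal \<bar>g a\<bar> \<le> Linf_norm I g"
    unfolding Linf_norm_def by (rule esssup_AE)
  then have "AE a in lebesgue_on J. ennreal \<bar>g a\<bar> \<le> Linf_norm I g"
    using assms by (auto simp: AE_lebesgue_on_iff elim!: eventually_mono)
  then show ?thesis unfolding Linf_norm_def[of J] using gJ by (intro esssup_I) auto
qed

lemma Linf_continuous_subset:
  assumes f: "Linf_continuous I f" and J: "J \<subseteq> I" "I \<in> sets borel" "J \<in> sets borel"
  shows "Linf_continuous J f"
  unfolding Linf_continuous_def
proof (intro conjI ballI)
  have m: "(\<lambda>a. f a x) \<in> borel_measurable (lebesgue_on I)" if "x \<in> {0..1}" for x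
    using f that by (auto simp: Linf_continuous_def in_Linf_def)
  show "in_Linf J (\<lambda>a. f a x)" if x: "x \<in> {0..1}" for x
    using Linf_norm_subset[OF J m[OF x]] f x m[OF x] J measurable_restrict_mono[of "\<lambda>a. f a x" lebesgue I borel J]
    by (auto simp: Linf_continuous_def in_Linf_def elim!: le_less_trans)
  show "AE a in lebesgue_on J. continuous_on {0..1} (f a)"
    using f J by (auto simp: Linf_continuous_def AE_lebesgue_on_iff elim!: eventually_mono)
  show "((\<lambda>y. Linf_norm J (\<lambda>a. f a y - f a x)) \<longlongrightarrow> 0) (at x within {0..1})" if x: "x \<in> {0..1}" for x
  proof (rule tendsto_sandwich[OF _ _ tendsto_const])
    show "((\<lambda>y. Linf_norm I (\<lambda>a. f a y - f a x)) \<longlongrightarrow> 0) (at x within {0..1})"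
      using f x by (auto simp: Linf_continuous_def)
    show "eventually (\<lambda>y. Linf_norm J (\<lambda>a. f a y - f a x) \<le> Linf_norm I (\<lambda>a. f a y - f a x)) (at x within {0..1})"
      unfolding eventually_at_filter
      by (intro always_eventually allI impI Linf_norm_subset J borel_measurable_diff m x)
  qed simp
qed

text \<open>Uniform continuity on a compact interval by a Lebesgue number: two points closer than
  \<open>\<delta>\<close> lie in a common ball, on which \<open>f\<close> differs from its value at
  the centre by at most \<open>e / 2\<close>. The null set of ages may depend on both
  points.\<close>

lemma Linf_continuous_modulus:
  assumes f: "Linf_continuous I f" and e: "0 < e"
  obtains \<delta> where "0 < \<delta>"
    "\<And>x y. x \<in> {0..1} \<Longrightarrow> y \<in> {0..1} \<Longrightarrow> \<bar>x - y\<bar> < \<delta> \<Longrightarrow> AE a in lebesgue_on I. \<bar>f a x - f a y\<bar> \<le> e"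
proof -
  have "\<exists>r>0. \<forall>y\<in>{0..1}. \<bar>y - x\<bar> < r \<longrightarrow> (AE a in lebesgue_on I. \<bar>f a y - f a x\<bar> \<le> e / 2)"
    if x: "x \<in> {0..1}" for x
  proof -
    have "((\<lambda>y. Linf_norm I (\<lambda>a. f a y - f a x)) \<longlongrightarrow> 0) (at x within {0..1})"
      using f x by (auto simp: Linf_continuous_def)
    then have "eventually (\<lambda>y. Linf_norm I (\<lambda>a. f a y - f a x) < ennreal (e / 2)) (at x within {0..1})"
      by (rule order_tendstoD) (use e in auto)
    then obtain r where r: "r > 0"
      "\<And>y. y \<in> {0..1} \<Longrightarrow> y \<noteq> x \<Longrightarrow> dist y x < r \<Longrightarrow> Linf_norm I (\<lambda>a. f a y - f a x) < ennreal (e / 2)"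
      by (auto simp: eventually_at)
    have "AE a in lebesgue_on I. \<bar>f a y - f a x\<bar> \<le> e / 2" if "y \<in> {0..1}" "\<bar>y - x\<bar> < r" for y
    proof (cases "y = x")
      case True then show ?thesis using e by simp
    next
      case False
      show ?thesis by (rule Linf_norm_less_imp_AE) (use r(2)[of y] False that in \<open>auto simp: dist_real_def\<close>)
    qed
    then show ?thesis using r(1) by blast
  qed
  then have "\<forall>x\<in>{0..1}. \<exists>r>0. \<forall>y\<in>{0..1}. \<bar>y - x\<bar> < r \<longrightarrow> (AE a in lebesgue_on I. \<bar>f a y - f a x\<bar> \<le> e / 2)"
    by (rule ballI)
  from bchoice[OF this] obtain r where
    r': "\<forall>x\<in>{0..1}. r x > 0 \<and> (\<forall>y\<in>{0..1}. \<bar>y - x\<bar> < r x \<longrightarrow> (AE a in lebesgue_on I. \<bar>f a y - f a x\<bar> \<le> e / 2))" ..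
  have r: "\<And>x. x \<in> {0..1} \<Longrightarrow> r x > 0"
    "\<And>x y. x \<in> {0..1} \<Longrightarrow> y \<in> {0..1} \<Longrightarrow> \<bar>y - x\<bar> < r x \<Longrightarrow> AE a in lebesgue_on I. \<bar>f a y - f a x\<bar> \<le> e / 2"
    using r' by blast+
  have "{0..1} \<subseteq> \<Union> ((\<lambda>x. ball x (r x)) ` {0..1::real})" using r(1) by force
  then obtain \<delta> where \<delta>: "\<delta> > 0" "\<And>x. x \<in> {0..1} \<Longrightarrow> \<exists>G\<in>(\<lambda>x. ball x (r x)) ` {0..1::real}. ball x \<delta> \<subseteq> G"
    by (rule Heine_Borel_lemma[OF compact_Icc]) blast+
  show ?thesis
  proof (rule that[OF \<delta>(1)])
    fix x y :: real assume xy: "x \<in> {0..1}" "y \<in> {0..1}" "\<bar>x - y\<bar> < \<delta>"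
    obtain z where z: "z \<in> {0..1}" "ball x \<delta> \<subseteq> ball z (r z)" using \<delta>(2)[OF xy(1)] by auto
    have "x \<in> ball x \<delta>" "y \<in> ball x \<delta>" using xy \<delta> by (auto simp: dist_real_def)
    then have "x \<in> ball z (r z)" "y \<in> ball z (r z)" using z(2) by blast+
    then have "AE a in lebesgue_on I. \<bar>f a x - f a z\<bar> \<le> e / 2" "AE a in lebesgue_on I. \<bar>f a y - f a z\<bar> \<le> e / 2"
      using r(2)[OF z(1)] xy by (auto simp: dist_real_def abs_minus_commute)
    then show "AE a in lebesgue_on I. \<bar>f a x - f a y\<bar> \<le> e" by eventually_elim linarith
  qed
qed

text \<open>
  Replacing \<open>x\<close> by \<open>grid N x\<close> turns \<open>f(a,x)\<close> into a finite sum of products, from which joint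
  measurability, boundedness and approximation all follow.
\<close>

definition grid :: "nat \<Rightarrow> real \<Rightarrow> real" where
  "grid N x = real (nat \<lfloor>real N * x\<rfloor>) / real N"

lemma grid_bounds:
  assumes "0 < N" "x \<in> {0..1}"
  shows "grid N x \<in> {0..1}" "\<bar>x - grid N x\<bar> \<le> 1 / real N" "nat \<lfloor>real N * x\<rfloor> \<le> N" "x < 1 \<Longrightarrow> nat \<lfloor>real N * x\<rfloor> < N"
proof -
  have n: "0 \<le> real N * x" "real N * x \<le> real N" using assms by (auto simp: mult_le_cancel_left1)
  then have fl: "real (nat \<lfloor>real N * x\<rfloor>) \<le> real N * x" "real N * x < real (nat \<lfloor>real N * x\<rfloor>) + 1"
    using of_int_floor_le[of "real N * x"] real_of_int_floor_add_one_gt[of "real N * x"] by simp_all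
  then have "real (nat \<lfloor>real N * x\<rfloor>) \<le> real N" using n by linarith
  then show "nat \<lfloor>real N * x\<rfloor> \<le> N" by simp
  then show "grid N x \<in> {0..1}" using assms by (auto simp: grid_def field_simps)
  have "x - grid N x = (real N * x - real (nat \<lfloor>real N * x\<rfloor>)) / real N" using assms by (simp add: grid_def field_simps)
  then have "\<bar>x - grid N x\<bar> = \<bar>real N * x - real (nat \<lfloor>real N * x\<rfloor>)\<bar> / real N" by (simp add: abs_div)
  also have "\<dots> \<le> 1 / real N" by (rule divide_right_mono) (use fl in linarith, simp)
  finally show "\<bar>x - grid N x\<bar> \<le> 1 / real N" .
  show "nat \<lfloor>real N * x\<rfloor> < N" if "x < 1"
  proof -
    have "real N * x < real N" using that assms by simp
    then show ?thesis using fl by linarith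
  qed
qed

text \<open>For \<open>x < 1\<close> the index of the cell is below \<open>N\<close>, so
  \<open>N\<close> cells suffice on the open interval; at \<open>x = 1\<close> the index
  \<open>N\<close> would occur as well.\<close>

lemma grid_sum:
  fixes f :: "real \<Rightarrow> real"
  assumes "0 < N" "x \<in> {0<..<1}"
  shows "f (grid N x) = (\<Sum>k<N. f (real k / real N) * indicator {x. nat \<lfloor>real N * x\<rfloor> = k} x)"
proof -
  have "(\<Sum>k<N. f (real k / real N) * indicator {x. nat \<lfloor>real N * x\<rfloor> = k} x)
      = (\<Sum>k\<in>{nat \<lfloor>real N * x\<rfloor>}. f (real k / real N) * indicator {x. nat \<lfloor>real N * x\<rfloor> = k} x)"
    using grid_bounds(4)[OF assms(1), of x] assms(2)
    by (intro sum.mono_neutral_right) (auto simp: indicator_def)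
  then show ?thesis by (simp add: grid_def)
qed

lemma grid_tendsto:
  assumes "continuous_on {0..1} h" "x \<in> {0..1}"
  shows "(\<lambda>n. h (grid (Suc n) x)) \<longlonglongrightarrow> h x"
proof -
  have "(\<lambda>n. grid (Suc n) x) \<longlonglongrightarrow> x"
  proof (rule LIM_zero_cancel, rule Lim_null_comparison)
    have "norm (grid (Suc n) x - x) \<le> inverse (real (Suc n))" for n
      using grid_bounds(2)[of "Suc n" x] assms(2) by (simp add: abs_minus_commute inverse_eq_divide)
    then show "eventually (\<lambda>n. norm (grid (Suc n) x - x) \<le> inverse (real (Suc n))) sequentially" by simp
  qed (rule LIMSEQ_inverse_real_of_nat)
  then show ?thesis
    using assms grid_bounds(1)[OF _ assms(2)] by (intro continuous_on_tendsto_compose[OF assms(1)]) auto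
qed

text \<open>Each \<open>x\<close> lies close to one of \<open>N + 1\<close> grid points, so finitely
  many bounds, increased by the modulus \<open>1\<close>, give one for all \<open>x\<close>.\<close>

lemma Linf_continuous_bounded:
  assumes f: "Linf_continuous I f"
  obtains K where "0 \<le> K" "\<And>x. x \<in> {0..1} \<Longrightarrow> AE a in lebesgue_on I. \<bar>f a x\<bar> \<le> K"
proof -
  obtain \<delta> where \<delta>: "0 < \<delta>"
    "\<And>x y. x \<in> {0..1} \<Longrightarrow> y \<in> {0..1} \<Longrightarrow> \<bar>x - y\<bar> < \<delta> \<Longrightarrow> AE a in lebesgue_on I. \<bar>f a x - f a y\<bar> \<le> 1"
    using Linf_continuous_modulus[OF f, of 1] by auto
  obtain N :: nat where N: "1 / \<delta> < real N" using reals_Archimedean2 by blast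
  then have N0: "0 < N" using \<delta>(1) by (cases N) (auto simp: field_simps)
  have N1: "1 / real N < \<delta>" using N \<delta>(1) N0 by (simp add: field_simps)
  have "\<forall>x\<in>{0..1}. \<exists>c. 0 \<le> c \<and> (AE a in lebesgue_on I. \<bar>f a x\<bar> \<le> c)"
  proof
    fix x :: real assume "x \<in> {0..1}"
    then have "in_Linf I (\<lambda>a. f a x)" using f by (auto simp: Linf_continuous_def)
    from in_Linf_bounded[OF this] show "\<exists>c. 0 \<le> c \<and> (AE a in lebesgue_on I. \<bar>f a x\<bar> \<le> c)" by blast
  qed
  from bchoice[OF this] obtain c where c: "\<forall>x\<in>{0..1}. 0 \<le> c x \<and> (AE a in lebesgue_on I. \<bar>f a x\<bar> \<le> c x)" ..
  define K where "K = (\<Sum>k\<le>N. \<bar>c (real k / real N)\<bar>) + 1"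
  show ?thesis
  proof (rule that[of K])
    show "0 \<le> K" by (auto simp: K_def intro!: add_nonneg_nonneg sum_nonneg)
    fix x :: real assume x: "x \<in> {0..1}"
    let ?k = "nat \<lfloor>real N * x\<rfloor>"
    note g = grid_bounds(1-3)[OF N0 x]
    have "AE a in lebesgue_on I. \<bar>f a x - f a (grid N x)\<bar> \<le> 1" using g N1 by (intro \<delta>(2) x) auto
    moreover have "AE a in lebesgue_on I. \<bar>f a (grid N x)\<bar> \<le> c (grid N x)" using c g by blast
    moreover have "\<bar>c (grid N x)\<bar> \<le> (\<Sum>k\<le>N. \<bar>c (real k / real N)\<bar>)"
      unfolding grid_def using g(3) by (intro member_le_sum) auto
    ultimately show "AE a in lebesgue_on I. \<bar>f a x\<bar> \<le> K"
      by (auto simp: K_def elim!: eventually_elim2)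
  qed
qed

lemma borel_measurable_cell: "indicator {x. nat \<lfloor>real N * x\<rfloor> = k} \<in> borel_measurable (lebesgue_on S)" for S :: "real set"
proof -
  have "{x. nat \<lfloor>real N * x\<rfloor> = k} \<in> sets borel" by measurable
  then have "indicator {x. nat \<lfloor>real N * x\<rfloor> = k} \<in> borel_measurable (lebesgue :: real measure)"
    by (intro measurable_completion borel_measurable_indicator) auto
  then show ?thesis by (rule measurable_restrict_space1)
qed

lemma Linf_continuous_grid_measurable:
  assumes f: "Linf_continuous I f" and I: "I \<in> sets borel" and N: "0 < N"
  shows "(\<lambda>(a, x). f a (grid N x)) \<in> borel_measurable (lebesgue_on (I \<times> {0<..<1}))"
proof -
  have U: "{0<..<1::real} \<in> sets borel" by simp
  have "(\<lambda>z. \<Sum>k<N. (\<lambda>(a, x::real). f a (real k / real N)) z * (\<lambda>(a::real, x). indicator {x. nat \<lfloor>real N * x\<rfloor> = k} x) z)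
      \<in> borel_measurable (lebesgue_on (I \<times> {0<..<1}))"
  proof (intro borel_measurable_sum borel_measurable_times)
    fix k assume k: "k \<in> {..<N}"
    have "real k / real N \<in> {0..1}" using k by auto
    then show "(\<lambda>(a, x::real). f a (real k / real N)) \<in> borel_measurable (lebesgue_on (I \<times> {0<..<1}))"
      using f by (intro borel_measurable_lebesgue_on_Times(1)[OF I U]) (auto simp: Linf_continuous_def in_Linf_def)
    show "(\<lambda>(a::real, x). indicator {x. nat \<lfloor>real N * x\<rfloor> = k} x :: real) \<in> borel_measurable (lebesgue_on (I \<times> {0<..<1}))"
      by (rule borel_measurable_lebesgue_on_Times(2)[OF I U borel_measurable_cell])
  qed
  then show ?thesis
    by (rule measurable_cong[THEN iffD1, rotated]) (use grid_sum[OF N] in \<open>auto simp: space_restrict_space\<close>)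
qed

text \<open>The choice of a version continuous in \<open>x\<close> enters here: it makes
  \<open>f\<close> an almost everywhere limit of its grid approximations, which are finite sums of
  products.\<close>

lemma Linf_continuous_measurable:
  assumes f: "Linf_continuous I f" and I: "I \<in> sets borel"
  shows "case_prod f \<in> borel_measurable (lebesgue_on (I \<times> {0<..<1}))"
proof (rule borel_measurable_lebesgue_on_AE)
  have U: "{0<..<1::real} \<in> sets borel" by simp
  show IU: "I \<times> {0<..<1::real} \<in> sets borel" using I U by (rule borel_Times)
  show "(\<lambda>z. lim (\<lambda>n. (\<lambda>(a, x). f a (grid (Suc n) x)) z)) \<in> borel_measurable (lebesgue_on (I \<times> {0<..<1}))"
    by (intro borel_measurable_lim_metric Linf_continuous_grid_measurable f I) simp
  have "AE a in lebesgue_on I. continuous_on {0..1} (f a)" using f by (auto simp: Linf_continuous_def)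
  from AE_lebesgue_on_Times_fst[OF I U this]
  have "AE z in lebesgue_on (I \<times> {0<..<1::real}). continuous_on {0..1} (f (fst z))" by (simp add: case_prod_beta)
  moreover have "AE z in lebesgue_on (I \<times> {0<..<1::real}). z \<in> I \<times> {0<..<1}" by (rule AE_in_lebesgue_on)
  ultimately show "AE z in lebesgue_on (I \<times> {0<..<1}). lim (\<lambda>n. (\<lambda>(a, x). f a (grid (Suc n) x)) z) = case_prod f z"
  proof eventually_elim
    case (elim z)
    obtain a x where z: "z = (a, x)" by (cases z)
    have "(\<lambda>n. f a (grid (Suc n) x)) \<longlonglongrightarrow> f a x" using elim z by (intro grid_tendsto) auto
    then show ?case using z by (simp add: limI)
  qed
qed

text \<open>The bound at a fixed \<open>x\<close> fails on a null set of ages that depends on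
  \<open>x\<close>; joint measurability merges these into a single null set of the plane.\<close>

lemma Linf_continuous_AE_bounded:
  assumes f: "Linf_continuous I f" and I: "I \<in> sets borel"
  obtains K where "0 \<le> K" "AE (a, x) in lebesgue_on (I \<times> {0<..<1}). \<bar>f a x\<bar> \<le> K"
proof -
  obtain K where K: "0 \<le> K" "\<And>x. x \<in> {0..1} \<Longrightarrow> AE a in lebesgue_on I. \<bar>f a x\<bar> \<le> K"
    using Linf_continuous_bounded[OF f] by blast
  have "AE (a, x) in lebesgue_on (I \<times> {0<..<1}). (\<lambda>a x. \<bar>f a x\<bar>) a x \<le> K"
  proof (rule AE_lebesgue_on_Times_le[OF I])
    show "(\<lambda>(a, x). \<bar>f a x\<bar>) \<in> borel_measurable (lebesgue_on (I \<times> {0<..<1}))"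
      using borel_measurable_abs[OF Linf_continuous_measurable[OF f I]] by (simp add: case_prod_beta')
    show "(AE x in lebesgue_on {0<..<1}. AE a in lebesgue_on I. \<bar>f a x\<bar> \<le> K) \<or>
        (AE a in lebesgue_on I. AE x in lebesgue_on {0<..<1}. \<bar>f a x\<bar> \<le> K)"
      by (rule disjI1, rule AE_I2) (use K(2) in \<open>simp add: space_restrict_space\<close>)
  qed simp
  then show ?thesis using that K by blast
qed

lemma Linf_continuous_grid_approx:
  assumes f: "Linf_continuous I f" and I: "I \<in> sets borel" and e: "0 < e"
  obtains N where "0 < N" "AE (a, x) in lebesgue_on (I \<times> {0<..<1}). \<bar>f a x - f a (grid N x)\<bar> \<le> e"
proof -
  obtain \<delta> where \<delta>: "0 < \<delta>"
    "\<And>x y. x \<in> {0..1} \<Longrightarrow> y \<in> {0..1} \<Longrightarrow> \<bar>x - y\<bar> < \<delta> \<Longrightarrow> AE a in lebesgue_on I. \<bar>f a x - f a y\<bar> \<le> e"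
    using Linf_continuous_modulus[OF f e] by blast
  obtain N :: nat where N: "1 / \<delta> < real N" using reals_Archimedean2 by blast
  then have N0: "0 < N" using \<delta>(1) by (cases N) (auto simp: field_simps)
  have N1: "1 / real N < \<delta>" using N \<delta>(1) N0 by (simp add: field_simps)
  have "AE (a, x) in lebesgue_on (I \<times> {0<..<1}). (\<lambda>a x. \<bar>f a x - f a (grid N x)\<bar>) a x \<le> e"
  proof (rule AE_lebesgue_on_Times_le[OF I])
    have "(\<lambda>z. \<bar>case_prod f z - (\<lambda>(a, x). f a (grid N x)) z\<bar>) \<in> borel_measurable (lebesgue_on (I \<times> {0<..<1}))"
      by (intro borel_measurable_abs borel_measurable_diff Linf_continuous_measurable Linf_continuous_grid_measurable f I N0)
    then show "(\<lambda>(a, x). \<bar>f a x - f a (grid N x)\<bar>) \<in> borel_measurable (lebesgue_on (I \<times> {0<..<1}))"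
      by (simp add: case_prod_beta')
    have "AE a in lebesgue_on I. \<bar>f a x - f a (grid N x)\<bar> \<le> e" if x: "x \<in> {0..1}" for x
      using grid_bounds(1,2)[OF N0 x] N1 by (intro \<delta>(2) x) auto
    then show "(AE x in lebesgue_on {0<..<1}. AE a in lebesgue_on I. \<bar>f a x - f a (grid N x)\<bar> \<le> e) \<or>
        (AE a in lebesgue_on I. AE x in lebesgue_on {0<..<1}. \<bar>f a x - f a (grid N x)\<bar> \<le> e)"
      by (intro disjI1, intro AE_I2[where M = "lebesgue_on {0<..<1}"]) (simp add: space_restrict_space)
  qed simp
  then show ?thesis using that N0 by blast
qed

section \<open>Integration by parts in space\<close>

lemma integrable_lebesgue_on_iff_absolutely_integrable:
  fixes f :: "real \<Rightarrow> real"
  assumes "S \<in> sets borel"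
  shows "integrable (lebesgue_on S) f \<longleftrightarrow> f absolutely_integrable_on S"
  unfolding set_integrable_def using assms by (intro integrable_restrict_space) auto

lemma set_lebesgue_integral_eq_lebesgue_on:
  fixes f :: "real \<Rightarrow> real"
  assumes "S \<in> sets borel"
  shows "(LINT x:S|lebesgue. f x) = integral\<^sup>L (lebesgue_on S) f"
  unfolding set_lebesgue_integral_def using assms by (intro integral_restrict_space[symmetric]) auto

lemma integrable_lebesgue_on_Ioo_iff:
  fixes f :: "real \<Rightarrow> real"
  shows "integrable (lebesgue_on {a<..<b}) f \<longleftrightarrow> f absolutely_integrable_on {a..b}"
  by (simp add: integrable_lebesgue_on_iff_absolutely_integrable absolutely_integrable_on_Ioo_iff)

lemma integral_lebesgue_on_Ioo:
  fixes f :: "real \<Rightarrow> real"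
  assumes "f absolutely_integrable_on {a..b}"
  shows "integral\<^sup>L (lebesgue_on {a<..<b}) f = integral {a..b} f"
proof -
  have "integral\<^sup>L (lebesgue_on {a<..<b}) f = (LINT x:{a<..<b}|lebesgue. f x)"
    by (rule set_lebesgue_integral_eq_lebesgue_on[symmetric]) simp
  also have "\<dots> = integral {a<..<b} f"
    using assms by (intro set_lebesgue_integral_eq_integral) (simp add: absolutely_integrable_on_Ioo_iff)
  finally show ?thesis by (simp add: integral_open_interval_real)
qed

text \<open>The complement of a null set is dense in the interval, and continuity carries the
  inequality from there to all points, the endpoints included.\<close>

lemma AE_Ioo_imp_le_on_Icc:
  fixes f g :: "real \<Rightarrow> real"
  assumes "AE x in lebesgue_on {0<..<b}. f x \<le> g x" "continuous_on {0..b} f" "continuous_on {0..b} g"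
    "0 < b" "x \<in> {0..b}"
  shows "f x \<le> g x"
proof -
  define N where "N = {x \<in> {0<..<b}. \<not> f x \<le> g x}"
  have N: "negligible N"
  proof -
    have "AE x in lebesgue. x \<in> {0<..<b} \<longrightarrow> f x \<le> g x"
      using assms(1) by (simp add: AE_restrict_space_iff)
    then obtain M where M: "M \<in> null_sets lebesgue" "{x. \<not> (x \<in> {0<..<b} \<longrightarrow> f x \<le> g x)} \<subseteq> M"
      unfolding eventually_ae_filter by auto
    have "N \<subseteq> M" using M(2) unfolding N_def by blast
    then show ?thesis using M(1) negligible_subset negligible_iff_null_sets by blast
  qed
  have "{0..b} \<subseteq> closure ({0<..<b} - N)"
  proof
    fix y assume y: "y \<in> {0..b}"
    show "y \<in> closure ({0<..<b} - N)"
      unfolding closure_approachable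
    proof (intro allI impI)
      fix e :: real assume e: "e > 0"
      define s t where "s = max 0 (y - e)" and "t = min b (y + e)"
      have st: "s < t" using y e assms(4) by (auto simp: s_def t_def)
      have "\<not> {s<..<t} \<subseteq> N" using N st open_not_negligible[of "{s<..<t}"] negligible_subset by auto
      then obtain z where "z \<in> {s<..<t}" "z \<notin> N" by blast
      then show "\<exists>z\<in>{0<..<b} - N. dist z y < e"
        by (intro bexI[of _ z]) (auto simp: s_def t_def dist_real_def)
    qed
  qed
  moreover have "continuous_on (closure ({0<..<b} - N)) (\<lambda>x. g x - f x)"
  proof (rule continuous_on_subset)
    show "closure ({0<..<b} - N) \<subseteq> {0..b}" by (rule closure_minimal) auto
  qed (use assms in \<open>auto intro: continuous_intros\<close>)
  ultimately have "0 \<le> g x - f x"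
    by (rule_tac continuous_ge_on_closure[of "{0<..<b} - N"]) (use assms(5) in \<open>auto simp: N_def\<close>)
  then show ?thesis by simp
qed

section \<open>Functions in \<open>Lp\<close> on the unit interval\<close>

lemma powr_diff_le:
  fixes x y :: real
  assumes "1 < p"
  shows "\<bar>x - y\<bar> powr p \<le> 2 powr p * (\<bar>x\<bar> powr p + \<bar>y\<bar> powr p)"
proof -
  have "\<bar>x - y\<bar> powr p \<le> (2 * max \<bar>x\<bar> \<bar>y\<bar>) powr p"
    using assms by (intro powr_mono2) auto
  also have "\<dots> = 2 powr p * (max \<bar>x\<bar> \<bar>y\<bar>) powr p" by (simp add: powr_mult)
  also have "\<dots> \<le> 2 powr p * (\<bar>x\<bar> powr p + \<bar>y\<bar> powr p)"
    by (intro mult_left_mono) (auto simp: max_def)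
  finally show ?thesis .
qed

lemma in_Lp_iff:
  "in_Lp p v \<longleftrightarrow> v \<in> borel_measurable (lebesgue_on {0<..<1}) \<and>
     integrable (lebesgue_on {0<..<1}) (\<lambda>x. \<bar>v x\<bar> powr p)"
  unfolding in_Lp_def set_borel_measurable_def set_integrable_def
  by (subst borel_measurable_restrict_space_iff, simp, subst integrable_restrict_space, simp, simp)

lemma Lp_norm_eq: "Lp_norm p v = (\<integral>x. \<bar>v x\<bar> powr p \<partial>lebesgue_on {0<..<1}) powr (1 / p)"
  unfolding Lp_norm_def by (simp add: set_lebesgue_integral_eq_lebesgue_on)

lemma in_Lp_diff:
  assumes p: "1 < p" and "in_Lp p v" "in_Lp p w"
  shows "in_Lp p (\<lambda>x. v x - w x)"
proof -
  have m [measurable]: "v \<in> borel_measurable (lebesgue_on {0<..<1})" "w \<in> borel_measurable (lebesgue_on {0<..<1})"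
    using assms by (auto simp: in_Lp_iff)
  have "integrable (lebesgue_on {0<..<1}) (\<lambda>x. 2 powr p * (\<bar>v x\<bar> powr p + \<bar>w x\<bar> powr p))"
    using assms by (intro integrable_mult_right integrable_add) (auto simp: in_Lp_iff)
  then have "integrable (lebesgue_on {0<..<1}) (\<lambda>x. \<bar>v x - w x\<bar> powr p)"
    by (rule Bochner_Integration.integrable_bound) (use powr_diff_le[OF p] in auto)
  then show ?thesis by (simp add: in_Lp_iff)
qed

text \<open>A weak form of Hoelder's inequality. Distinguishing whether
  \<open>\<bar>v x\<bar>\<close> exceeds \<open>N\<close> gives a pointwise bound by
  \<open>N + N powr (1 - p) * \<bar>v x\<bar> powr p\<close>; for \<open>N\<close> equal to the norm
  both summands integrate to \<open>N\<close>, hence the factor \<open>2\<close>. The negative power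
  forces the separate treatment of norm zero.\<close>

lemma in_Lp_imp_L1:
  assumes p: "1 < p" and v: "in_Lp p v"
  shows "integrable (lebesgue_on {0<..<1}) v"
    "(\<integral>x. \<bar>v x\<bar> \<partial>lebesgue_on {0<..<1}) \<le> 2 * Lp_norm p v"
proof -
  let ?M = "lebesgue_on {0<..<1::real}"
  have fin: "finite_measure ?M"
    by (rule finite_measureI) (simp add: space_restrict_space emeasure_restrict_space)
  have m [measurable]: "v \<in> borel_measurable ?M" and i: "integrable ?M (\<lambda>x. \<bar>v x\<bar> powr p)"
    using v by (auto simp: in_Lp_iff)
  have one: "integrable ?M (\<lambda>x. c)" "(\<integral>x. c \<partial>?M) = c" for c :: real
    using finite_measure.integrable_const[OF fin]
    by (auto simp: measure_restrict_space space_restrict_space measure_def emeasure_restrict_space)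
  define J where "J = (\<integral>x. \<bar>v x\<bar> powr p \<partial>?M)"
  define N where "N = J powr (1 / p)"
  have J: "0 \<le> J" unfolding J_def by (intro Bochner_Integration.integral_nonneg) auto
  have "integrable ?M v \<and> (\<integral>x. \<bar>v x\<bar> \<partial>?M) \<le> 2 * N"
  proof (cases "J = 0")
    case True
    then have "AE x in ?M. \<bar>v x\<bar> powr p = 0"
      using integral_nonneg_eq_0_iff_AE[OF i] by (auto simp: J_def)
    then have z: "AE x in ?M. v x = 0" by eventually_elim (use p in auto)
    have "integrable ?M v" using z by (subst integrable_cong_AE[where g = "\<lambda>x. 0"]) auto
    moreover have "(\<integral>x. \<bar>v x\<bar> \<partial>?M) = (\<integral>x. 0 \<partial>?M)" using z by (intro integral_cong_AE) auto
    ultimately show ?thesis using True p by (simp add: N_def)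
  next
    case False
    then have N: "N > 0" using J by (simp add: N_def)
    have le: "\<bar>v x\<bar> \<le> N + N powr (1 - p) * \<bar>v x\<bar> powr p" for x
    proof (cases "\<bar>v x\<bar> \<le> N")
      case True
      have "0 \<le> N powr (1 - p) * \<bar>v x\<bar> powr p" by simp
      then show ?thesis using True by linarith
    next
      case False
      then have "\<bar>v x\<bar> = \<bar>v x\<bar> powr (1 - p) * \<bar>v x\<bar> powr p" using N by (simp flip: powr_add)
      also have "\<dots> \<le> N powr (1 - p) * \<bar>v x\<bar> powr p"
        using False N p by (intro mult_right_mono powr_mono2') auto
      finally show ?thesis using N by linarith
    qed
    have ib: "integrable ?M (\<lambda>x. N + N powr (1 - p) * \<bar>v x\<bar> powr p)"
      using i one by (intro Bochner_Integration.integrable_add integrable_mult_right) auto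
    have iv: "integrable ?M v"
      by (rule Bochner_Integration.integrable_bound[OF ib]) (use le in \<open>auto intro!: AE_I2 order_trans[OF le abs_ge_self]\<close>)
    have "(\<integral>x. \<bar>v x\<bar> \<partial>?M) \<le> (\<integral>x. N + N powr (1 - p) * \<bar>v x\<bar> powr p \<partial>?M)"
      using iv ib le by (intro integral_mono) auto
    also have "\<dots> = N + N powr (1 - p) * J"
      using i one by (simp add: J_def)
    also have "J = N powr p" using False J p by (simp add: N_def powr_powr)
    also have "N + N powr (1 - p) * N powr p = 2 * N" using N by (simp flip: powr_add)
    finally show ?thesis using iv by simp
  qed
  then show "integrable ?M v" "(\<integral>x. \<bar>v x\<bar> \<partial>?M) \<le> 2 * Lp_norm p v"
    by (simp_all add: Lp_norm_eq N_def J_def)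
qed

text \<open>
  The factor that makes \<open>d u\<^sub>x\<^sub>x + \<Lambda> q u\<^sub>x\<close> symmetric; no bound on it is needed later.
\<close>

definition weight :: "real \<Rightarrow> real \<Rightarrow> (real \<Rightarrow> real) \<Rightarrow> real \<Rightarrow> real" where
  "weight d \<Lambda> q x = exp (\<Lambda> / d * integral {0..x} q)"

lemma weight_pos: "0 < weight d \<Lambda> q x"
  by (simp add: weight_def)

lemma primitive_on_weight:
  assumes "continuous_on {0..1} q"
  shows "primitive_on 1 (weight d \<Lambda> q) (\<lambda>x. \<Lambda> / d * q x * weight d \<Lambda> q x)"
proof -
  have "primitive_on 1 (\<lambda>x. integral {0..x} q) q"
    using primitive_on_integral[OF absolutely_integrable_continuous_real[OF assms], of 0] by simp
  then have "primitive_on 1 (\<lambda>x. \<Lambda> / d * integral {0..x} q) (\<lambda>x. \<Lambda> / d * q x)"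
    by (rule primitive_on_cmult)
  from primitive_on_exp[OF this] show ?thesis by (simp add: weight_def[abs_def])
qed

text \<open>The weight satisfies \<open>d * W' = \<Lambda> * q * W\<close>, so the operator applied
  to \<open>v\<close> is \<open>d * (W v')' / W\<close>. Integrating the derivatives of
  \<open>W X v'\<close> and \<open>W X' v\<close> over the interval moves it to \<open>X\<close>;
  the boundary values vanish by the Neumann conditions on \<open>v\<close> and on
  \<open>X\<close>.\<close>

lemma Neumann_integration_by_parts:
  fixes \<Lambda> :: real
  assumes p: "1 < p" and d: "0 < d" and q: "continuous_on {0..1} q"
    and v: "in_W2p p v v1 v2" and v1: "continuous_on {0..1} v1" "v1 0 = 0" "v1 1 = 0"
    and X: "primitive_on 1 X X1" "primitive_on 1 X1 X2" "X1 0 = 0" "X1 1 = 0"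
    and X2: "X2 \<in> borel_measurable (lebesgue_on {0<..<1})"
  defines "W \<equiv> weight d \<Lambda> q"
  shows "(\<integral>x. W x * X x * (d * v2 x + \<Lambda> * q x * v1 x) \<partial>lebesgue_on {0<..<1}) =
    (\<integral>x. W x * (d * X2 x + \<Lambda> * q x * X1 x) * v x \<partial>lebesgue_on {0<..<1})"
proof -
  let ?M = "lebesgue_on {0<..<1::real}"
  have Lp: "in_Lp p v" "in_Lp p v1" "in_Lp p v2" and weak: "weak_derivative v v1" "weak_derivative v1 v2"
    using v by (auto simp: in_W2p_def)
  have ai: "v absolutely_integrable_on {0..1}" "v1 absolutely_integrable_on {0..1}" "v2 absolutely_integrable_on {0..1}"
    using Lp[THEN in_Lp_imp_L1(1)[OF p]] by (simp_all add: integrable_lebesgue_on_Ioo_iff)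
  obtain c1 where c1: "AE x in ?M. v1 x = c1 + integral {0..x} v2"
    by (rule weak_derivative_imp_primitive[OF ai(2,3) zero_less_one]) (use weak(2) in \<open>auto simp: weak_derivative_def\<close>)
  obtain c where c: "AE x in ?M. v x = c + integral {0..x} v1"
    by (rule weak_derivative_imp_primitive[OF ai(1,2) zero_less_one]) (use weak(1) in \<open>auto simp: weak_derivative_def\<close>)
  define V1 where "V1 x = c1 + integral {0..x} v2" for x
  define V where "V x = c + integral {0..x} v1" for x
  have pV1: "primitive_on 1 V1 v2" unfolding V1_def[abs_def] by (rule primitive_on_integral[OF ai(3)])
  have pV: "primitive_on 1 V v1" unfolding V_def[abs_def] by (rule primitive_on_integral[OF ai(2)])
  have le1: "AE x in ?M. v1 x \<le> V1 x" and le2: "AE x in ?M. V1 x \<le> v1 x"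
    using c1 by (auto simp: V1_def elim!: eventually_mono)
  \<comment> \<open>The given derivative \<open>v1\<close> is continuous up to the boundary, so it
    equals the primitive of \<open>v2\<close> at every point. This makes the values
    \<open>v1 0\<close> and \<open>v1 1\<close> usable as boundary terms.\<close>
  have "v1 x = V1 x" if "x \<in> {0..1}" for x
    using AE_Ioo_imp_le_on_Icc[OF le1 v1(1) primitive_on_continuous[OF pV1] _ that]
      AE_Ioo_imp_le_on_Icc[OF le2 primitive_on_continuous[OF pV1] v1(1) _ that] by simp
  then have pv1: "primitive_on 1 v1 v2" by (intro primitive_on_cong[OF pV1]) auto
  note W = primitive_on_weight[OF q, of d \<Lambda>, folded W_def]
  note P1 = primitive_on_mult[OF primitive_on_mult[OF W X(1)] pv1]
  note P2 = primitive_on_mult[OF primitive_on_mult[OF W X(2)] pV]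
  let ?D1 = "\<lambda>x. (\<Lambda> / d * q x * W x * X x + W x * X1 x) * v1 x + W x * X x * v2 x"
  let ?D2 = "\<lambda>x. (\<Lambda> / d * q x * W x * X1 x + W x * X2 x) * V x + W x * X1 x * v1 x"
  have iD: "?D1 integrable_on {0..1}" "?D2 integrable_on {0..1}"
    using primitive_on_integrable[OF P1] primitive_on_integrable[OF P2] by (auto simp: absolutely_integrable_on_def)
  have "integral {0..1} ?D1 = 0" "integral {0..1} ?D2 = 0"
    using primitive_on_diff[OF P1, of 0 1] primitive_on_diff[OF P2, of 0 1] v1 X by auto
  then have zero: "integral {0..1} (\<lambda>x. d * ?D1 x - d * ?D2 x) = 0"
    using iD by (subst integral_diff) (auto intro: integrable_on_mult_right)
  have cts: "continuous_on {0..1} W" "continuous_on {0..1} X" "continuous_on {0..1} X1" "continuous_on {0..1} V"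
    using primitive_on_continuous W X(1,2) pV by blast+
  let ?L = "\<lambda>x. W x * X x * (d * v2 x + \<Lambda> * q x * v1 x)"
  let ?R = "\<lambda>x. W x * (d * X2 x + \<Lambda> * q x * X1 x) * V x"
  have aiL: "?L absolutely_integrable_on {0..1}"
  proof -
    have "(\<lambda>x. v2 x * (W x * X x * d) + v1 x * (W x * X x * \<Lambda> * q x)) absolutely_integrable_on {0..1}"
      by (intro set_integral_add absolutely_integrable_mult_continuous(1) ai continuous_intros cts q)
    then show ?thesis by (simp add: algebra_simps)
  qed
  have aiR: "?R absolutely_integrable_on {0..1}"
  proof -
    have "(\<lambda>x. X2 x * (W x * V x * d) + W x * \<Lambda> * q x * X1 x * V x) absolutely_integrable_on {0..1}"
      by (intro set_integral_add absolutely_integrable_mult_continuous(1)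
          primitive_on_integrable[OF X(2)] absolutely_integrable_continuous_real continuous_intros cts q)
    then show ?thesis by (simp add: algebra_simps)
  qed
  \<comment> \<open>The term \<open>d * W x * X1 x * v1 x\<close> occurs in both scaled derivatives
    and cancels.\<close>
  have "?L x - ?R x = d * ?D1 x - d * ?D2 x" for x using d by (simp add: field_simps)
  then have "integral {0..1} (\<lambda>x. ?L x - ?R x) = 0" using zero by simp
  then have "integral {0..1} ?L = integral {0..1} ?R"
    using aiL aiR by (subst (asm) integral_diff) (auto simp: absolutely_integrable_on_def)
  then have eq: "integral\<^sup>L ?M ?L = integral\<^sup>L ?M ?R"
    using aiL aiR by (simp add: integral_lebesgue_on_Ioo)
  also have "integral\<^sup>L ?M ?R = (\<integral>x. W x * (d * X2 x + \<Lambda> * q x * X1 x) * v x \<partial>?M)"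
  proof (rule integral_cong_AE)
    have m: "f \<in> borel_measurable ?M" if "continuous_on {0..1} f" for f :: "real \<Rightarrow> real"
      by (rule continuous_imp_measurable_on_sets_lebesgue) (auto intro: continuous_on_subset[OF that])
    show "?R \<in> borel_measurable ?M"
      by (intro borel_measurable_times borel_measurable_add X2 cts[THEN m] q[THEN m] borel_measurable_const)
    show "(\<lambda>x. W x * (d * X2 x + \<Lambda> * q x * X1 x) * v x) \<in> borel_measurable ?M"
      using Lp(1) by (intro borel_measurable_times borel_measurable_add X2 cts[THEN m] q[THEN m] borel_measurable_const) (simp add: in_Lp_iff)
    show "AE x in ?M. ?R x = W x * (d * X2 x + \<Lambda> * q x * X1 x) * v x"
      using c by eventually_elim (simp add: V_def)
  qed
  finally show ?thesis .
qed

section \<open>Moments of an eigenfunction\<close>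

lemma primitive_on_cong_AE:
  assumes F: "primitive_on b F f" and eq: "AE a in lebesgue_on {0<..<b}. f a = g a"
  shows "primitive_on b F g"
proof -
  have "AE x in lebesgue. x \<in> {0<..<b} \<longrightarrow> f x = g x"
    using eq by (simp add: AE_restrict_space_iff)
  then obtain M where M: "M \<in> null_sets lebesgue" "{x. \<not> (x \<in> {0<..<b} \<longrightarrow> f x = g x)} \<subseteq> M"
    unfolding eventually_ae_filter by auto
  define N where "N = M \<union> {0, b}"
  have "negligible M" using M(1) negligible_iff_null_sets by blast
  then have N: "negligible N" unfolding N_def by (intro negligible_Un) auto
  have eqN: "g x = f x" if "x \<in> {0..b} - N" for x
  proof -
    have "x \<in> {0<..<b}" "x \<notin> M" using that unfolding N_def by auto
    then show ?thesis using M(2) by auto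
  qed
  have "g absolutely_integrable_on {0..b}"
    by (rule absolutely_integrable_spike[OF primitive_on_integrable[OF F] N]) (use eqN in auto)
  moreover have "integral {0..t} g = integral {0..t} f" if "t \<in> {0..b}" for t
    by (rule integral_spike[OF N]) (use eqN that in auto)
  ultimately show ?thesis using F by (simp add: primitive_on_def)
qed

section \<open>Bounded multipliers\<close>

lemma integrable_bounded_mult:
  fixes f g :: "'a \<Rightarrow> real"
  assumes f: "integrable M f" and g: "g \<in> borel_measurable M" "AE x in M. \<bar>g x\<bar> \<le> K"
  shows "integrable M (\<lambda>x. g x * f x)"
proof (rule Bochner_Integration.integrable_bound)
  show "integrable M (\<lambda>x. K * f x)" using f by simp
  show "(\<lambda>x. g x * f x) \<in> borel_measurable M" using f g by measurable
  show "AE x in M. norm (g x * f x) \<le> norm (K * f x)"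
    using g(2) by eventually_elim (auto simp: abs_mult intro!: mult_right_mono)
qed

definition bounded_measurable :: "(real \<Rightarrow> real) \<Rightarrow> bool" where
  "bounded_measurable Y \<longleftrightarrow> Y \<in> borel_measurable (lebesgue_on {0<..<1}) \<and> (\<exists>K. \<forall>x\<in>{0<..<1}. \<bar>Y x\<bar> \<le> K)"

text \<open>The bound holds only almost everywhere, since for rates continuous into
  \<open>Linf_norm\<close> no better one is known.\<close>

definition bounded_measurable2 :: "real set \<Rightarrow> (real \<Rightarrow> real \<Rightarrow> real) \<Rightarrow> bool" where
  "bounded_measurable2 A G \<longleftrightarrow> case_prod G \<in> borel_measurable (lebesgue_on (A \<times> {0<..<1})) \<and>
     (\<exists>K. AE (a, x) in lebesgue_on (A \<times> {0<..<1}). \<bar>G a x\<bar> \<le> K)"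

lemma bounded_measurable_continuous:
  "continuous_on {0..1} Y \<Longrightarrow> bounded_measurable Y"
proof -
  assume c: "continuous_on {0..1} Y"
  have "bounded (Y ` {0..1})" using c by (intro compact_imp_bounded compact_continuous_image) auto
  then have "\<exists>K. \<forall>x\<in>{0<..<1}. \<bar>Y x\<bar> \<le> K" unfolding bounded_iff by (metis atLeastAtMost_iff greaterThanLessThan_iff image_eqI less_imp_le real_norm_def)
  moreover have "Y \<in> borel_measurable (lebesgue_on {0<..<1})"
    by (rule continuous_imp_measurable_on_sets_lebesgue) (auto intro: continuous_on_subset[OF c])
  ultimately show ?thesis by (simp add: bounded_measurable_def)
qed

lemma bounded_measurable_const: "bounded_measurable (\<lambda>x. c)"
  by (auto simp: bounded_measurable_def)

lemma bounded_measurable_mult: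
  assumes "bounded_measurable Y" "bounded_measurable Z"
  shows "bounded_measurable (\<lambda>x. Y x * Z x)"
proof -
  obtain K L where "\<forall>x\<in>{0<..<1}. \<bar>Y x\<bar> \<le> K" "\<forall>x\<in>{0<..<1}. \<bar>Z x\<bar> \<le> L"
    using assms by (auto simp: bounded_measurable_def)
  then have "\<forall>x\<in>{0<..<1}. \<bar>Y x * Z x\<bar> \<le> K * L"
    unfolding abs_mult by (meson abs_ge_zero mult_mono order_trans)
  then show ?thesis using assms by (auto simp: bounded_measurable_def)
qed

lemma bounded_measurable_integrable:
  assumes "bounded_measurable Y" "integrable (lebesgue_on {0<..<1}) v"
  shows "integrable (lebesgue_on {0<..<1}) (\<lambda>x. Y x * v x)"
proof -
  obtain K where "\<forall>x\<in>{0<..<1}. \<bar>Y x\<bar> \<le> K" using assms by (auto simp: bounded_measurable_def)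
  then have "AE x in lebesgue_on {0<..<1}. \<bar>Y x\<bar> \<le> K" by (auto simp: space_restrict_space)
  then show ?thesis using assms by (intro integrable_bounded_mult) (auto simp: bounded_measurable_def)
qed

lemma integrable_lebesgue_on_const: "integrable (lebesgue_on {0<..<1::real}) (\<lambda>x. c :: real)"
  by (simp add: integrable_lebesgue_on_Ioo_iff)

lemma bounded_measurable_imp_integrable: "bounded_measurable Y \<Longrightarrow> integrable (lebesgue_on {0<..<1}) Y"
  using bounded_measurable_integrable[OF _ integrable_lebesgue_on_const[of 1]] by simp

lemma bounded_measurable2_snd:
  assumes A: "A \<in> sets borel" and Y: "bounded_measurable Y"
  shows "bounded_measurable2 A (\<lambda>a. Y)"
proof -
  obtain K where "\<forall>x\<in>{0<..<1}. \<bar>Y x\<bar> \<le> K" using Y by (auto simp: bounded_measurable_def)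
  then have "AE (a, x) in lebesgue_on (A \<times> {0<..<1}). \<bar>Y x\<bar> \<le> K"
    by (intro AE_I2) (auto simp: space_restrict_space)
  then show ?thesis using borel_measurable_lebesgue_on_Times(2)[OF A, of "{0<..<1}" Y] Y
    by (auto simp: bounded_measurable2_def bounded_measurable_def)
qed

lemma bounded_measurable2_fst:
  assumes A: "A \<in> sets borel" and g: "g \<in> borel_measurable (lebesgue_on A)" "AE a in lebesgue_on A. \<bar>g a\<bar> \<le> K"
  shows "bounded_measurable2 A (\<lambda>a x. g a)"
  using borel_measurable_lebesgue_on_Times(1)[OF A, of "{0<..<1}" g] AE_lebesgue_on_Times_fst[OF A _ g(2), of "{0<..<1}"] g(1)
  by (auto simp: bounded_measurable2_def)

lemma bounded_measurable2_mult:
  assumes "bounded_measurable2 A G" "bounded_measurable2 A H"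
  shows "bounded_measurable2 A (\<lambda>a x. G a x * H a x)"
proof -
  obtain K L where "AE (a, x) in lebesgue_on (A \<times> {0<..<1}). \<bar>G a x\<bar> \<le> K" "AE (a, x) in lebesgue_on (A \<times> {0<..<1}). \<bar>H a x\<bar> \<le> L"
    using assms by (auto simp: bounded_measurable2_def)
  then have "AE (a, x) in lebesgue_on (A \<times> {0<..<1}). \<bar>G a x * H a x\<bar> \<le> K * L"
    by eventually_elim (auto simp: abs_mult intro!: mult_mono intro: order_trans[OF abs_ge_zero])
  moreover have "(\<lambda>z. case_prod G z * case_prod H z) \<in> borel_measurable (lebesgue_on (A \<times> {0<..<1}))"
    using assms by (intro borel_measurable_times) (auto simp: bounded_measurable2_def)
  ultimately show ?thesis by (auto simp: bounded_measurable2_def case_prod_beta')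
qed

lemma bounded_measurable2_Linf:
  assumes "Linf_continuous A f" "A \<in> sets borel"
  shows "bounded_measurable2 A f"
  using Linf_continuous_measurable[OF assms] Linf_continuous_AE_bounded[OF assms]
  unfolding bounded_measurable2_def by blast

lemma bounded_measurable2_integrable:
  assumes "bounded_measurable2 A G" "integrable (lebesgue_on (A \<times> {0<..<1})) (case_prod w)"
  shows "integrable (lebesgue_on (A \<times> {0<..<1})) (\<lambda>(a, x). G a x * w a x)"
proof -
  obtain K where "AE (a, x) in lebesgue_on (A \<times> {0<..<1}). \<bar>G a x\<bar> \<le> K"
    using assms by (auto simp: bounded_measurable2_def)
  then have "integrable (lebesgue_on (A \<times> {0<..<1})) (\<lambda>z. case_prod G z * case_prod w z)"
    using assms by (intro integrable_bounded_mult) (auto simp: bounded_measurable2_def case_prod_beta')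
  then show ?thesis by (simp add: case_prod_beta')
qed

section \<open>The problem, its eigenpairs and their moments\<close>

locale age_space_problem =
  fixes am :: ereal and ac p \<Lambda> :: real
    and q :: "real \<Rightarrow> real" and \<beta> \<mu> :: "real \<Rightarrow> real \<Rightarrow> real"
  assumes q_cont: "continuous_on {0..1} q"
    and beta_cont: "Linf_continuous (ages am) \<beta>"
    and beta_nonneg: "AE a in lebesgue_on (ages am). \<forall>x\<in>{0..1}. 0 \<le> \<beta> a x"
    and ac: "ac \<in> ages am"
    and beta_zero: "AE a in lebesgue_on (ages am). ac \<le> a \<longrightarrow> (\<forall>x\<in>{0..1}. \<beta> a x = 0)"
    and beta_pos: "\<And>a. a \<in> {0..<ac} \<Longrightarrow> 0 < (LINT l:{a..ac}|lebesgue. (INF x\<in>{0..1}. \<beta> l x))"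
    and mu_cont: "\<And>a'. a' \<in> ages am \<Longrightarrow> Linf_continuous {0<..<a'} \<mu>"
    and mu_nonneg: "AE a in lebesgue_on (ages am). \<forall>x\<in>{0..1}. 0 \<le> \<mu> a x"
    and p: "1 < p"
begin

lemma ages_borel [measurable]: "ages am \<in> sets borel"
  unfolding ages_def by measurable

lemma Ioo_subset_ages: "b \<in> ages am \<Longrightarrow> {0<..<b} \<subseteq> ages am"
  by (auto simp: ages_def) (meson ereal_less_eq(3) le_less_trans less_imp_le)

lemma ages_pos: "b \<in> ages am \<Longrightarrow> 0 < b"
  by (simp add: ages_def)

lemma AE_ages_imp_Ioo:
  assumes "b \<in> ages am" "AE a in lebesgue_on (ages am). P a"
  shows "AE a in lebesgue_on {0<..<b}. P a"
  using assms(2) Ioo_subset_ages[OF assms(1)] by (auto simp: AE_lebesgue_on_iff[OF ages_borel] AE_lebesgue_on_iff elim!: eventually_mono)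

lemma AE_ages_Times_imp_Ioo:
  assumes b: "b \<in> ages am" and P: "AE (a, x) in lebesgue_on (ages am \<times> {0<..<1}). P a x"
  shows "AE (a, x) in lebesgue_on ({0<..<b} \<times> {0<..<1::real}). P a x"
proof -
  have 1: "ages am \<times> {0<..<1::real} \<in> sets borel" "{0<..<b} \<times> {0<..<1::real} \<in> sets borel"
    by (intro borel_Times ages_borel; simp)+
  show ?thesis
    using P Ioo_subset_ages[OF b] unfolding AE_lebesgue_on_iff[OF 1(1)] AE_lebesgue_on_iff[OF 1(2)]
    by (auto elim!: eventually_mono)
qed

text \<open>\<open>d\<close> and \<open>u\<close> are explicit arguments so that bounds with one
  constant for all eigenpairs can be stated outside the context of a single one.\<close>

definition mom :: "real \<Rightarrow> (real \<Rightarrow> real \<Rightarrow> real) \<Rightarrow> (real \<Rightarrow> real \<Rightarrow> real) \<Rightarrow> real \<Rightarrow> real" where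
  "mom d u G a = (\<integral>x. weight d \<Lambda> q x * G a x * u a x \<partial>lebesgue_on {0<..<1})"

end

locale eigenpair = age_space_problem +
  fixes d l :: real and u ux uxx ua :: "real \<Rightarrow> real \<Rightarrow> real"
  assumes d: "0 < d"
    and sobolev: "in_W11_W2p am p u ux uxx ua"
    and pde: "AE (a, x) in lebesgue_on (ages am \<times> {0<..<1}).
           ua a x = d * uxx a x + \<Lambda> * q x * ux a x - \<mu> a x * u a x - l * u a x"
    and neumann: "AE a in lebesgue_on (ages am). ux a 0 = 0 \<and> ux a 1 = 0"
    and renewal: "AE x in lebesgue_on {0<..<1}. u 0 x = (LINT a:ages am|lebesgue. \<beta> a x * u a x)"
    and nonneg: "AE (a, x) in lebesgue_on (ages am \<times> {0<..<1}). 0 \<le> u a x"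
    and nontrivial: "\<not> (AE (a, x) in lebesgue_on (ages am \<times> {0<..<1}). u a x = 0)"
begin

abbreviation "W \<equiv> weight d \<Lambda> q"

abbreviation "moment \<equiv> mom d u"

lemmas moment_def = mom_def

lemma W_bounded_measurable: "bounded_measurable W"
  using primitive_on_continuous[OF primitive_on_weight[OF q_cont]] by (rule bounded_measurable_continuous)

lemma integrable_u:
  assumes b: "b \<in> ages am"
  shows "integrable (lebesgue_on ({0<..<b} \<times> {0<..<1})) (case_prod u)"
    "integrable (lebesgue_on ({0<..<b} \<times> {0<..<1})) (case_prod ua)"
proof -
  have 1: "in_L1_W2p {0<..<b} p u ux uxx" "in_L1_Lp {0<..<b} p ua"
    using sobolev b by (auto simp: in_W11_W2p_def)
  have Lp: "AE a in lebesgue_on {0<..<b}. in_Lp p (u a)" "AE a in lebesgue_on {0<..<b}. in_Lp p (ua a)"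
    using 1 by (auto simp: in_L1_W2p_def in_L1_Lp_def in_W2p_def elim!: eventually_mono)
  have Lp_nonneg: "0 \<le> Lp_norm p v" for v by (simp add: Lp_norm_def)
  show "integrable (lebesgue_on ({0<..<b} \<times> {0<..<1})) (case_prod u)"
  proof (rule integrable_lebesgue_on_Times)
    show "case_prod u \<in> borel_measurable (lebesgue_on ({0<..<b} \<times> {0<..<1}))" using 1 by (simp add: in_L1_W2p_def)
    show "AE a in lebesgue_on {0<..<b}. integrable (lebesgue_on {0<..<1}) (u a)"
      using Lp(1) by eventually_elim (rule in_Lp_imp_L1(1)[OF p])
    show "AE a in lebesgue_on {0<..<b}. (\<integral>x. \<bar>u a x\<bar> \<partial>lebesgue_on {0<..<1})
        \<le> 2 * (Lp_norm p (u a) + Lp_norm p (ux a) + Lp_norm p (uxx a))"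
      using Lp(1)
    proof eventually_elim
      case (elim a)
      show ?case by (rule order_trans[OF in_Lp_imp_L1(2)[OF p elim]]) (simp add: Lp_nonneg)
    qed
    show "integrable (lebesgue_on {0<..<b}) (\<lambda>a. 2 * (Lp_norm p (u a) + Lp_norm p (ux a) + Lp_norm p (uxx a)))"
      using 1 by (intro integrable_mult_right) (simp add: in_L1_W2p_def integrable_lebesgue_on_iff_absolutely_integrable)
  qed auto
  show "integrable (lebesgue_on ({0<..<b} \<times> {0<..<1})) (case_prod ua)"
  proof (rule integrable_lebesgue_on_Times)
    show "case_prod ua \<in> borel_measurable (lebesgue_on ({0<..<b} \<times> {0<..<1}))" using 1 by (simp add: in_L1_Lp_def)
    show "AE a in lebesgue_on {0<..<b}. integrable (lebesgue_on {0<..<1}) (ua a)"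
      using Lp(2) by eventually_elim (rule in_Lp_imp_L1(1)[OF p])
    show "AE a in lebesgue_on {0<..<b}. (\<integral>x. \<bar>ua a x\<bar> \<partial>lebesgue_on {0<..<1}) \<le> 2 * Lp_norm p (ua a)"
      using Lp(2) by eventually_elim (rule in_Lp_imp_L1(2)[OF p])
    show "integrable (lebesgue_on {0<..<b}) (\<lambda>a. 2 * Lp_norm p (ua a))"
      using 1 by (intro integrable_mult_right) (simp add: in_L1_Lp_def integrable_lebesgue_on_iff_absolutely_integrable)
  qed auto
qed

lemma bounded_measurable2_W_mult:
  "bounded_measurable2 {0<..<b} G \<Longrightarrow> bounded_measurable2 {0<..<b} (\<lambda>a x. W x * G a x)"
  using bounded_measurable2_mult[OF bounded_measurable2_snd[OF _ W_bounded_measurable]] by simp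

lemma integrable_W_mult_u:
  assumes "b \<in> ages am" "bounded_measurable2 {0<..<b} G"
  shows "integrable (lebesgue_on ({0<..<b} \<times> {0<..<1})) (\<lambda>(a, x). W x * G a x * u a x)"
  using bounded_measurable2_integrable[OF bounded_measurable2_W_mult[OF assms(2)] integrable_u(1)[OF assms(1)]] .

lemma moment_absolutely_integrable:
  assumes "b \<in> ages am" "bounded_measurable2 {0<..<b} G"
  shows "moment G absolutely_integrable_on {0..b}"
    "AE a in lebesgue_on {0<..<b}. integrable (lebesgue_on {0<..<1}) (\<lambda>x. W x * G a x * u a x)"
  using Fubini_lebesgue_on(1,2)[OF _ _ integrable_W_mult_u[OF assms]]
  by (simp_all add: moment_def[abs_def] integrable_lebesgue_on_Ioo_iff)

lemma in_Lp_u: "a \<in> insert 0 (ages am) \<Longrightarrow> in_Lp p (u a)"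
  using sobolev by (auto simp: in_W11_W2p_def)

text \<open>\<open>u\<close> is continuous in age with values in \<open>Lp\<close>, down to
  \<open>a = 0\<close>, by the choice of representative in \<open>in_W11_W2p\<close>; integrating
  against a bounded function preserves this.\<close>

lemma moment_continuous:
  assumes b: "b \<in> ages am" and Y: "bounded_measurable Y"
  shows "continuous_on {0..b} (moment (\<lambda>a. Y))"
proof -
  let ?M = "lebesgue_on {0<..<1::real}"
  have sub: "{0..b} \<subseteq> insert 0 (ages am)"
    using b by (auto simp: ages_def) (meson ereal_less_eq(3) le_less_trans)
  have WY: "bounded_measurable (\<lambda>x. W x * Y x)" by (rule bounded_measurable_mult[OF W_bounded_measurable Y])
  then obtain K where K: "\<forall>x\<in>{0<..<1}. \<bar>W x * Y x\<bar> \<le> K" by (auto simp: bounded_measurable_def)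
  have "(moment (\<lambda>a. Y) \<longlongrightarrow> moment (\<lambda>a. Y) a) (at a within {0..b})" if a: "a \<in> {0..b}" for a
  proof (rule LIM_zero_cancel, rule Lim_null_comparison)
    have "norm (moment (\<lambda>a. Y) s - moment (\<lambda>a. Y) a) \<le> \<bar>K\<bar> * (2 * Lp_norm p (\<lambda>x. u s x - u a x))" if s: "s \<in> {0..b}" for s
    proof -
      have Lp: "in_Lp p (u s)" "in_Lp p (u a)" using s a sub in_Lp_u by auto
      have D: "in_Lp p (\<lambda>x. u s x - u a x)" by (rule in_Lp_diff[OF p Lp])
      note i = bounded_measurable_integrable[OF WY in_Lp_imp_L1(1)[OF p]]
      have "moment (\<lambda>a. Y) s - moment (\<lambda>a. Y) a = (\<integral>x. W x * Y x * (u s x - u a x) \<partial>?M)"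
        unfolding moment_def using Bochner_Integration.integral_diff[OF i[OF Lp(1)] i[OF Lp(2)]]
        by (simp add: right_diff_distrib)
      also have "norm \<dots> \<le> (\<integral>x. \<bar>K\<bar> * \<bar>u s x - u a x\<bar> \<partial>?M)"
      proof (rule Bochner_Integration.integral_norm_bound_integral[OF i[OF D]])
        show "integrable ?M (\<lambda>x. \<bar>K\<bar> * \<bar>u s x - u a x\<bar>)"
          using in_Lp_imp_L1(1)[OF p D] by (intro integrable_mult_right integrable_abs)
        show "norm (W x * Y x * (u s x - u a x)) \<le> \<bar>K\<bar> * \<bar>u s x - u a x\<bar>" if "x \<in> space ?M" for x
        proof -
          have "\<bar>W x * Y x\<bar> \<le> K" using K that by (simp add: space_restrict_space)
          also have "K \<le> \<bar>K\<bar>" by simp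
          finally show ?thesis unfolding real_norm_def abs_mult[of "W x * Y x"] by (rule mult_right_mono) simp
        qed
      qed
      also have "\<dots> = \<bar>K\<bar> * (\<integral>x. \<bar>u s x - u a x\<bar> \<partial>?M)" by simp
      also have "\<dots> \<le> \<bar>K\<bar> * (2 * Lp_norm p (\<lambda>x. u s x - u a x))"
        by (rule mult_left_mono[OF in_Lp_imp_L1(2)[OF p D]]) simp
      finally show ?thesis .
    qed
    then show "eventually (\<lambda>s. norm (moment (\<lambda>a. Y) s - moment (\<lambda>a. Y) a) \<le> \<bar>K\<bar> * (2 * Lp_norm p (\<lambda>x. u s x - u a x))) (at a within {0..b})"
      by (auto simp: eventually_at_filter)
    have "((\<lambda>s. Lp_norm p (\<lambda>x. u s x - u a x)) \<longlongrightarrow> 0) (at a within insert 0 (ages am))"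
      using sobolev a sub by (auto simp: in_W11_W2p_def)
    then have "((\<lambda>s. Lp_norm p (\<lambda>x. u s x - u a x)) \<longlongrightarrow> 0) (at a within {0..b})"
      by (rule tendsto_within_subset[OF _ sub])
    then show "((\<lambda>s. \<bar>K\<bar> * (2 * Lp_norm p (\<lambda>x. u s x - u a x))) \<longlongrightarrow> 0) (at a within {0..b})"
      by (intro tendsto_mult_right_zero)
  qed
  then show ?thesis by (auto simp: continuous_on_def)
qed

end

lemma test_function_vanishes:
  assumes \<phi>: "test_function {0<..<b} \<phi>" and a: "a \<notin> {0<..<b}"
  shows "\<phi> a = 0" "deriv \<phi> a = 0"
proof -
  obtain K where K: "compact K" "K \<subseteq> {0<..<b}" "\<And>x. x \<notin> K \<Longrightarrow> \<phi> x = 0"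
    using \<phi> by (auto simp: test_function_def)
  have aK: "a \<in> - K" using a K(2) by auto
  then show "\<phi> a = 0" using K(3) by auto
  have "open (- K)" using K(1) by (simp add: compact_imp_closed open_Compl)
  then have "(\<phi> has_real_derivative 0) (at a)"
    by (rule has_field_derivative_transform_within_open[OF DERIV_const _ aK]) (use K(3) in auto)
  then show "deriv \<phi> a = 0" by (rule DERIV_imp_deriv)
qed

lemma test_function_subset: "test_function S \<phi> \<Longrightarrow> S \<subseteq> T \<Longrightarrow> test_function T \<phi>"
  unfolding test_function_def by blast

lemma bounded_measurable2_continuous_fst:
  assumes "continuous_on {0..b} g"
  shows "bounded_measurable2 {0<..<b} (\<lambda>a x. g a)"
proof -
  have "bounded (g ` {0..b})" using assms by (intro compact_imp_bounded compact_continuous_image) auto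
  then obtain K where K: "\<And>a. a \<in> {0..b} \<Longrightarrow> \<bar>g a\<bar> \<le> K"
    unfolding bounded_iff by (metis image_eqI real_norm_def)
  show ?thesis
  proof (rule bounded_measurable2_fst)
    show "g \<in> borel_measurable (lebesgue_on {0<..<b})"
      by (rule continuous_imp_measurable_on_sets_lebesgue) (auto intro: continuous_on_subset[OF assms])
    show "AE a in lebesgue_on {0<..<b}. \<bar>g a\<bar> \<le> K" using K by (auto simp: space_restrict_space)
  qed simp
qed

context eigenpair
begin

lemma set_integral_ages_eq:
  fixes \<phi> w :: "real \<Rightarrow> real"
  assumes b: "b \<in> ages am" and \<phi>: "\<And>a. a \<notin> {0<..<b} \<Longrightarrow> \<phi> a = 0"
  shows "(LINT a:ages am|lebesgue. \<phi> a * w a) = (\<integral>a. \<phi> a * w a \<partial>lebesgue_on {0<..<b})"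
proof -
  have "(LINT a:ages am|lebesgue. \<phi> a * w a) = (LINT a:{0<..<b}|lebesgue. \<phi> a * w a)"
    unfolding set_lebesgue_integral_def
  proof (rule Bochner_Integration.integral_cong[OF refl])
    fix a
    show "indicator (ages am) a *\<^sub>R (\<phi> a * w a) = indicator {0<..<b} a *\<^sub>R (\<phi> a * w a)"
      using Ioo_subset_ages[OF b] \<phi>[of a] by (cases "a \<in> {0<..<b}") (auto simp: indicator_def)
  qed
  then show ?thesis by (simp add: set_lebesgue_integral_eq_lebesgue_on)
qed

text \<open>The weak age derivative is given for almost every fixed \<open>x\<close>. Multiplying by
  \<open>W x * X x\<close>, integrating over \<open>x\<close> and exchanging the integrals turns it
  into a weak derivative of a real function of age.\<close>

lemma moment_weak_derivative:
  assumes b: "b \<in> ages am" and X: "bounded_measurable X" and \<phi>: "test_function {0<..<b} \<phi>"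
  shows "(LINT a:{0<..<b}|lebesgue. moment (\<lambda>a. X) a * deriv \<phi> a) =
    - (LINT a:{0<..<b}|lebesgue. (\<integral>x. W x * X x * ua a x \<partial>lebesgue_on {0<..<1}) * \<phi> a)"
proof -
  let ?M = "lebesgue_on {0<..<1::real}" and ?N = "lebesgue_on {0<..<b}"
  have U: "{0<..<1::real} \<in> sets borel" "{0<..<b} \<in> sets borel" by auto
  note vanish = test_function_vanishes[OF \<phi>]
  note \<phi>' = test_function_primitive(4,5)[OF \<phi>]
  have bm: "bounded_measurable2 {0<..<b} (\<lambda>a x. W x * (X x * g a))" if "continuous_on {0..b} g" for g
    by (intro bounded_measurable2_W_mult bounded_measurable2_mult bounded_measurable2_snd X
        bounded_measurable2_continuous_fst that) simp
  note I1 = bounded_measurable2_integrable[OF bm[OF \<phi>'(2)] integrable_u(1)[OF b]]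
  note I2 = bounded_measurable2_integrable[OF bm[OF \<phi>'(1)] integrable_u(2)[OF b]]
  have "test_function (ages am) \<phi>" using \<phi> Ioo_subset_ages[OF b] by (rule test_function_subset)
  then have "AE x in ?M. (LINT a:ages am|lebesgue. deriv \<phi> a * u a x) = - (LINT a:ages am|lebesgue. \<phi> a * ua a x)"
    using sobolev by (simp add: in_W11_W2p_def)
  then have ae: "AE x in ?M. (\<integral>a. W x * (X x * deriv \<phi> a) * u a x \<partial>?N) = - (\<integral>a. W x * (X x * \<phi> a) * ua a x \<partial>?N)"
  proof eventually_elim
    case (elim x)
    have "(\<integral>a. W x * (X x * deriv \<phi> a) * u a x \<partial>?N) = W x * X x * (\<integral>a. deriv \<phi> a * u a x \<partial>?N)"
      by (subst integral_mult_right_zero[symmetric]) (simp add: mult.assoc)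
    moreover have "(\<integral>a. W x * (X x * \<phi> a) * ua a x \<partial>?N) = W x * X x * (\<integral>a. \<phi> a * ua a x \<partial>?N)"
      by (subst integral_mult_right_zero[symmetric]) (simp add: mult.assoc)
    moreover have "(\<integral>a. deriv \<phi> a * u a x \<partial>?N) = - (\<integral>a. \<phi> a * ua a x \<partial>?N)"
      using elim set_integral_ages_eq[of b "deriv \<phi>" "\<lambda>a. u a x", OF b vanish(2)]
        set_integral_ages_eq[of b \<phi> "\<lambda>a. ua a x", OF b vanish(1)] by linarith
    ultimately show ?case by (simp only: mult_minus_right)
  qed
  have "(LINT a:{0<..<b}|lebesgue. moment (\<lambda>a. X) a * deriv \<phi> a) = (\<integral>a. moment (\<lambda>a. X) a * deriv \<phi> a \<partial>?N)"
    by (simp add: set_lebesgue_integral_eq_lebesgue_on)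
  also have "\<dots> = (\<integral>a. (\<integral>x. W x * (X x * deriv \<phi> a) * u a x \<partial>?M) \<partial>?N)"
    unfolding moment_def by (subst integral_mult_left_zero[symmetric]) (simp add: mult_ac)
  also have "\<dots> = (\<integral>x. (\<integral>a. W x * (X x * deriv \<phi> a) * u a x \<partial>?N) \<partial>?M)"
    by (rule Fubini_lebesgue_on(5)[OF U(2,1) I1])
  also have "\<dots> = (\<integral>x. - (\<integral>a. W x * (X x * \<phi> a) * ua a x \<partial>?N) \<partial>?M)"
    using Fubini_lebesgue_on(4)[OF U(2,1) I1] Fubini_lebesgue_on(4)[OF U(2,1) I2] ae
    by (intro integral_cong_AE) (auto intro: borel_measurable_integrable)
  also have "\<dots> = - (\<integral>a. (\<integral>x. W x * (X x * \<phi> a) * ua a x \<partial>?M) \<partial>?N)"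
    using Fubini_lebesgue_on(5)[OF U(2,1) I2] by simp
  also have "\<dots> = - (\<integral>a. (\<integral>x. W x * X x * ua a x \<partial>?M) * \<phi> a \<partial>?N)"
    by (subst integral_mult_left_zero[symmetric]) (simp add: mult_ac)
  finally show ?thesis by (simp add: set_lebesgue_integral_eq_lebesgue_on)
qed

text \<open>At almost every age the differential equation replaces \<open>ua\<close>, and
  \<open>Neumann_integration_by_parts\<close> moves the space derivatives from \<open>u\<close> to
  \<open>X\<close>. What remains are moments of \<open>u\<close> alone.\<close>

lemma AE_age_derivative_moment:
  assumes b: "b \<in> ages am"
    and X: "primitive_on 1 X X1" "primitive_on 1 X1 X2" "X1 0 = 0" "X1 1 = 0" and X2: "bounded_measurable X2"
  shows "AE a in lebesgue_on {0<..<b}. (\<integral>x. W x * X x * ua a x \<partial>lebesgue_on {0<..<1}) =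
    d * moment (\<lambda>a. X2) a + \<Lambda> * moment (\<lambda>a x. q x * X1 x) a - moment (\<lambda>a x. \<mu> a x * X x) a - l * moment (\<lambda>a. X) a"
proof -
  let ?M = "lebesgue_on {0<..<1::real}"
  have U: "{0<..<1::real} \<in> sets borel" "{0<..<b} \<in> sets borel" by auto
  have Xb: "bounded_measurable X" "bounded_measurable X1"
    using X(1,2) primitive_on_continuous bounded_measurable_continuous by blast+
  have qb: "bounded_measurable q" using q_cont by (rule bounded_measurable_continuous)
  have 1: "in_L1_W2p {0<..<b} p u ux uxx" using sobolev b by (auto simp: in_W11_W2p_def)
  have A1: "AE a in lebesgue_on {0<..<b}. in_W2p p (u a) (ux a) (uxx a)" using 1 by (simp add: in_L1_W2p_def)
  have A2: "AE a in lebesgue_on {0<..<b}. continuous_on {0..1} (ux a)"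
    using sobolev by (intro AE_ages_imp_Ioo[OF b]) (simp add: in_W11_W2p_def)
  have A3: "AE a in lebesgue_on {0<..<b}. ux a 0 = 0 \<and> ux a 1 = 0"
    using neumann by (rule AE_ages_imp_Ioo[OF b])
  have A4: "AE a in lebesgue_on {0<..<b}. AE x in ?M. ua a x = d * uxx a x + \<Lambda> * q x * ux a x - \<mu> a x * u a x - l * u a x"
    by (rule AE_lebesgue_on_Times(1)[OF U(2,1) AE_ages_Times_imp_Ioo[OF b pde]])
  have A5: "AE a in lebesgue_on {0<..<b}. integrable ?M (\<lambda>x. W x * (\<mu> a x * X x) * u a x)"
    by (intro moment_absolutely_integrable(2) b bounded_measurable2_mult bounded_measurable2_snd Xb
        bounded_measurable2_Linf mu_cont U)
  have A6: "AE a in lebesgue_on {0<..<b}. integrable ?M (ua a)"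
    by (rule Fubini_lebesgue_on(1)[OF U(2,1) integrable_u(2)[OF b]])
  show ?thesis using A1 A2 A3 A4 A5 A6
  proof eventually_elim
    case (elim a)
    have Lp: "integrable ?M (u a)" "integrable ?M (ux a)" "integrable ?M (uxx a)"
      using elim(1) in_Lp_imp_L1(1)[OF p] by (auto simp: in_W2p_def)
    note WX = bounded_measurable_mult[OF W_bounded_measurable Xb(1)]
    let ?A = "\<lambda>x. W x * X x * (d * uxx a x + \<Lambda> * q x * ux a x)"
    have "integrable ?M (\<lambda>x. d * uxx a x + \<Lambda> * (q x * ux a x))"
      using Lp bounded_measurable_integrable[OF qb] by (intro Bochner_Integration.integrable_add integrable_mult_right) auto
    then have iA: "integrable ?M ?A" using bounded_measurable_integrable[OF WX] by (simp add: mult.assoc)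
    have iu: "integrable ?M (\<lambda>x. W x * X x * u a x)" by (rule bounded_measurable_integrable[OF WX Lp(1)])
    have "(\<integral>x. W x * X x * ua a x \<partial>?M) = (\<integral>x. ?A x - W x * (\<mu> a x * X x) * u a x - l * (W x * X x * u a x) \<partial>?M)"
    proof (rule integral_cong_AE)
      show "(\<lambda>x. W x * X x * ua a x) \<in> borel_measurable ?M"
        by (rule borel_measurable_integrable[OF bounded_measurable_integrable[OF WX elim(6)]])
      show "(\<lambda>x. ?A x - W x * (\<mu> a x * X x) * u a x - l * (W x * X x * u a x)) \<in> borel_measurable ?M"
        by (intro borel_measurable_integrable Bochner_Integration.integrable_diff iA elim(5) integrable_mult_right iu)
      show "AE x in ?M. W x * X x * ua a x = ?A x - W x * (\<mu> a x * X x) * u a x - l * (W x * X x * u a x)"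
        using elim(4) by eventually_elim (erule ssubst, simp add: algebra_simps)
    qed
    also have "\<dots> = integral\<^sup>L ?M ?A - moment (\<lambda>a x. \<mu> a x * X x) a - l * moment (\<lambda>a. X) a"
      using iA elim(5) iu by (simp add: moment_def)
    also have "integral\<^sup>L ?M ?A = (\<integral>x. W x * (d * X2 x + \<Lambda> * q x * X1 x) * u a x \<partial>?M)"
      using elim(1-3) X2 by (intro Neumann_integration_by_parts[OF p d q_cont _ _ _ _ X]) (auto simp: bounded_measurable_def)
    also have "\<dots> = d * moment (\<lambda>a. X2) a + \<Lambda> * moment (\<lambda>a x. q x * X1 x) a"
    proof -
      have "integrable ?M (\<lambda>x. W x * X2 x * u a x)" "integrable ?M (\<lambda>x. W x * (q x * X1 x) * u a x)"
        by (intro bounded_measurable_integrable bounded_measurable_mult W_bounded_measurable X2 qb Xb Lp)+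
      then have "(\<integral>x. d * (W x * X2 x * u a x) + \<Lambda> * (W x * (q x * X1 x) * u a x) \<partial>?M)
          = d * moment (\<lambda>a. X2) a + \<Lambda> * moment (\<lambda>a x. q x * X1 x) a"
        by (simp add: moment_def)
      then show ?thesis by (simp add: algebra_simps)
    qed
    finally show ?case .
  qed
qed

text \<open>The weak derivative determines the moment up to a constant and almost everywhere; as
  both sides are continuous, equality holds at every age. The moment equation thus includes the
  trace at age \<open>0\<close>.\<close>

theorem moment_primitive:
  assumes b: "b \<in> ages am"
    and X: "primitive_on 1 X X1" "primitive_on 1 X1 X2" "X1 0 = 0" "X1 1 = 0" and X2: "bounded_measurable X2"
  shows "primitive_on b (moment (\<lambda>a. X)) (\<lambda>a. d * moment (\<lambda>a. X2) a + \<Lambda> * moment (\<lambda>a x. q x * X1 x) a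
    - moment (\<lambda>a x. \<mu> a x * X x) a - l * moment (\<lambda>a. X) a)"
proof -
  let ?V = "\<lambda>a. \<integral>x. W x * X x * ua a x \<partial>lebesgue_on {0<..<1}"
  have U: "{0<..<1::real} \<in> sets borel" "{0<..<b} \<in> sets borel" by auto
  have Xb: "bounded_measurable X"
    using X(1) primitive_on_continuous bounded_measurable_continuous by blast
  have c: "continuous_on {0..b} (moment (\<lambda>a. X))" by (rule moment_continuous[OF b Xb])
  have "integrable (lebesgue_on ({0<..<b} \<times> {0<..<1})) (\<lambda>(a, x). W x * X x * ua a x)"
    using bounded_measurable2_integrable[OF bounded_measurable2_snd[OF U(2) bounded_measurable_mult[OF W_bounded_measurable Xb]] integrable_u(2)[OF b]] .
  then have V: "?V absolutely_integrable_on {0..b}"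
    using Fubini_lebesgue_on(2)[OF U(2,1)] by (simp add: integrable_lebesgue_on_Ioo_iff)
  obtain c0 where c0: "AE a in lebesgue_on {0<..<b}. moment (\<lambda>a. X) a = c0 + integral {0..a} ?V"
    using weak_derivative_imp_primitive[OF absolutely_integrable_continuous_real[OF c] V ages_pos[OF b] moment_weak_derivative[OF b Xb]]
    by blast
  have P: "primitive_on b (\<lambda>a. c0 + integral {0..a} ?V) ?V" by (rule primitive_on_integral[OF V])
  note cP = primitive_on_continuous[OF P]
  have "moment (\<lambda>a. X) a = c0 + integral {0..a} ?V" if "a \<in> {0..b}" for a
  proof (rule antisym)
    show "moment (\<lambda>a. X) a \<le> c0 + integral {0..a} ?V"
      by (rule AE_Ioo_imp_le_on_Icc[OF _ c cP ages_pos[OF b] that]) (use c0 in \<open>auto elim!: eventually_mono\<close>)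
    show "c0 + integral {0..a} ?V \<le> moment (\<lambda>a. X) a"
      by (rule AE_Ioo_imp_le_on_Icc[OF _ cP c ages_pos[OF b] that]) (use c0 in \<open>auto elim!: eventually_mono\<close>)
  qed
  then have "primitive_on b (moment (\<lambda>a. X)) ?V" by (intro primitive_on_cong[OF P]) auto
  then show ?thesis by (rule primitive_on_cong_AE[OF _ AE_age_derivative_moment[OF b X X2]])
qed

end

section \<open>The mass of an eigenfunction\<close>

lemma integral_Icc_nonneg_AE:
  fixes f :: "real \<Rightarrow> real"
  assumes "f absolutely_integrable_on {s..t}" "AE a in lebesgue_on {s<..<t}. 0 \<le> f a"
  shows "0 \<le> integral {s..t} f"
  using Bochner_Integration.integral_nonneg_AE[OF assms(2)] integral_lebesgue_on_Ioo[OF assms(1)] by simp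

lemma integral_Icc_mono_AE:
  fixes f g :: "real \<Rightarrow> real"
  assumes "f absolutely_integrable_on {s..t}" "g absolutely_integrable_on {s..t}"
    "AE a in lebesgue_on {s<..<t}. f a \<le> g a"
  shows "integral {s..t} f \<le> integral {s..t} g"
proof -
  have "0 \<le> integral {s..t} (\<lambda>a. g a - f a)"
    by (rule integral_Icc_nonneg_AE[OF set_integral_diff(1)[OF assms(2,1)]]) (use assms(3) in \<open>auto elim!: eventually_mono\<close>)
  then show ?thesis using assms(1,2) by (simp add: integral_diff absolutely_integrable_on_def)
qed

lemma AE_Ioo_subset:
  assumes "AE a in lebesgue_on {0<..<b::real}. P a" "t \<le> b"
  shows "AE a in lebesgue_on {0<..<t}. P a"
  using assms by (auto simp: AE_lebesgue_on_iff elim!: eventually_mono)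

lemma primitive_on_nonneg_imp_ge:
  assumes F: "primitive_on b F f" and f: "AE a in lebesgue_on {0<..<b}. 0 \<le> f a" and t: "0 \<le> t" "t \<le> b"
  shows "F 0 \<le> F t"
proof -
  have "f absolutely_integrable_on {0..t}"
    by (rule absolutely_integrable_on_subinterval[OF primitive_on_integrable[OF F]]) (use t in auto)
  from integral_Icc_nonneg_AE[OF this AE_Ioo_subset[OF f t(2)]]
  show ?thesis using primitive_on_diff[OF F, of 0 t] t by simp
qed

lemma bounded_measurable2_const: "A \<in> sets borel \<Longrightarrow> bounded_measurable2 A (\<lambda>a x. c)"
  by (rule bounded_measurable2_snd[OF _ bounded_measurable_const])

context age_space_problem
begin

lemma bounded_measurable2_mu: "b \<in> ages am \<Longrightarrow> bounded_measurable2 {0<..<b} \<mu>"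
  by (intro bounded_measurable2_Linf mu_cont) auto

lemma Linf_continuous_beta: "Linf_continuous {0<..<ac} \<beta>"
  by (rule Linf_continuous_subset[OF beta_cont Ioo_subset_ages[OF ac] ages_borel]) simp

lemma bounded_measurable2_beta: "bounded_measurable2 {0<..<ac} \<beta>"
  by (intro bounded_measurable2_Linf Linf_continuous_beta) auto

lemma AE_Times_nonneg:
  assumes b: "b \<in> ages am" and f: "AE a in lebesgue_on (ages am). \<forall>x\<in>{0..1}. 0 \<le> f a x"
  shows "AE (a, x) in lebesgue_on ({0<..<b} \<times> {0<..<1::real}). 0 \<le> f a x"
proof -
  have "AE z in lebesgue_on ({0<..<b} \<times> {0<..<1::real}). \<forall>x\<in>{0..1}. 0 \<le> f (fst z) x"
    using AE_lebesgue_on_Times_fst[OF _ _ AE_ages_imp_Ioo[OF b f], of "{0<..<1}"] by (simp add: case_prod_beta')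
  moreover have "AE z in lebesgue_on ({0<..<b} \<times> {0<..<1::real}). z \<in> {0<..<b} \<times> {0<..<1}"
    by (rule AE_in_lebesgue_on)
  ultimately show ?thesis by eventually_elim auto
qed

end

context eigenpair
begin

lemma AE_u_nonneg:
  assumes "b \<in> ages am"
  shows "AE a in lebesgue_on {0<..<b}. AE x in lebesgue_on {0<..<1}. 0 \<le> u a x"
  by (rule AE_lebesgue_on_Times(1)[OF _ _ AE_ages_Times_imp_Ioo[OF assms nonneg]]) auto

lemma moment_mono_AE:
  assumes b: "b \<in> ages am" and G: "bounded_measurable2 {0<..<b} G" and H: "bounded_measurable2 {0<..<b} H"
    and le: "AE (a, x) in lebesgue_on ({0<..<b} \<times> {0<..<1}). G a x \<le> H a x"
  shows "AE a in lebesgue_on {0<..<b}. moment G a \<le> moment H a"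
proof -
  have "AE a in lebesgue_on {0<..<b}. AE x in lebesgue_on {0<..<1}. G a x \<le> H a x"
    by (rule AE_lebesgue_on_Times(1)[OF _ _ le]) auto
  with AE_u_nonneg[OF b] moment_absolutely_integrable(2)[OF b G] moment_absolutely_integrable(2)[OF b H]
  show ?thesis
  proof eventually_elim
    case (elim a)
    have "AE x in lebesgue_on {0<..<1}. W x * G a x * u a x \<le> W x * H a x * u a x"
      using elim(1,4) by eventually_elim (auto intro!: mult_right_mono mult_left_mono less_imp_le[OF weight_pos])
    then show ?case unfolding moment_def using elim by (intro integral_mono_AE)
  qed
qed

lemma moment_cmult: "moment (\<lambda>a x. c a * G a x) a = c a * moment G a"
proof -
  have "moment (\<lambda>a x. c a * G a x) a = (\<integral>x. c a * (W x * G a x * u a x) \<partial>lebesgue_on {0<..<1})"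
    by (simp add: moment_def mult_ac)
  then show ?thesis by (simp add: moment_def)
qed

lemma moment_const: "moment (\<lambda>a x. c) a = c * moment (\<lambda>a x. 1) a"
  using moment_cmult[of "\<lambda>a. c" "\<lambda>a x. 1" a] by simp

lemma moment_bound_AE:
  assumes b: "b \<in> ages am" and G: "bounded_measurable2 {0<..<b} G"
    and le: "AE (a, x) in lebesgue_on ({0<..<b} \<times> {0<..<1}). \<bar>G a x\<bar> \<le> K"
  shows "AE a in lebesgue_on {0<..<b}. \<bar>moment G a\<bar> \<le> K * moment (\<lambda>a x. 1) a"
proof -
  have c: "bounded_measurable2 {0<..<b} (\<lambda>a x. K)" "bounded_measurable2 {0<..<b} (\<lambda>a x. - K)"
    by (intro bounded_measurable2_const; simp)+
  have "AE a in lebesgue_on {0<..<b}. moment G a \<le> moment (\<lambda>a x. K) a"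
    by (rule moment_mono_AE[OF b G c(1)]) (use le in \<open>auto elim!: eventually_mono\<close>)
  moreover have "AE a in lebesgue_on {0<..<b}. moment (\<lambda>a x. - K) a \<le> moment G a"
    by (rule moment_mono_AE[OF b c(2) G]) (use le in \<open>auto elim!: eventually_mono\<close>)
  ultimately show ?thesis
    by eventually_elim (simp add: moment_const[of K] moment_const[of "- K"] abs_le_iff)
qed

text \<open>Continuity in age upgrades \<open>moment_bound_AE\<close> to every age, in particular to
  the endpoints, where boundary terms are evaluated.\<close>

lemma moment_bound:
  assumes b: "b \<in> ages am" and Y: "bounded_measurable Y" "\<And>x. x \<in> {0<..<1} \<Longrightarrow> \<bar>Y x\<bar> \<le> K" and a: "a \<in> {0..b}"
  shows "\<bar>moment (\<lambda>a. Y) a\<bar> \<le> K * moment (\<lambda>a x. 1) a"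
proof (rule AE_Ioo_imp_le_on_Icc[OF _ _ _ ages_pos[OF b] a])
  show "AE a in lebesgue_on {0<..<b}. \<bar>moment (\<lambda>a. Y) a\<bar> \<le> K * moment (\<lambda>a x. 1) a"
    by (rule moment_bound_AE[OF b bounded_measurable2_snd[OF _ Y(1)]])
      (use Y(2) in \<open>auto simp: space_restrict_space intro!: AE_I2\<close>)
qed (intro continuous_intros moment_continuous[OF b] Y bounded_measurable_const)+

abbreviation "mass \<equiv> moment (\<lambda>a x. 1)"

lemma mass_nonneg: "b \<in> ages am \<Longrightarrow> a \<in> {0..b} \<Longrightarrow> 0 \<le> mass a"
  using moment_bound[of b "\<lambda>x. 0" 1 a, OF _ bounded_measurable_const] abs_ge_zero order_trans by fastforce

lemma mass_continuous: "b \<in> ages am \<Longrightarrow> continuous_on {0..b} mass"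
  by (intro moment_continuous bounded_measurable_const)

text \<open>Taking \<open>X = 1\<close> removes diffusion and drift, because its derivatives vanish:
  the weighted mass changes only through mortality and through the term with
  \<open>l\<close>.\<close>

lemma mass_primitive:
  assumes b: "b \<in> ages am"
  shows "primitive_on b mass (\<lambda>a. - moment \<mu> a - l * mass a)"
proof -
  have "primitive_on 1 (\<lambda>x. 1) (\<lambda>x. 0)" "primitive_on 1 (\<lambda>x. 0) (\<lambda>x. 0)" by (auto simp: primitive_on_def)
  from moment_primitive[OF b this _ _ bounded_measurable_const] show ?thesis
    using moment_const[of 0] by simp
qed

lemma moment_mu_nonneg:
  assumes b: "b \<in> ages am"
  shows "AE a in lebesgue_on {0<..<b}. 0 \<le> moment \<mu> a"
  using moment_mono_AE[OF b bounded_measurable2_const bounded_measurable2_mu[OF b] AE_Times_nonneg[OF b mu_nonneg]]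
  by (simp add: moment_const[of 0])

text \<open>An integrating factor. With \<open>k = l\<close> the product decreases, as mortality is
  nonnegative; with \<open>k = l + K\<close> it increases, if \<open>K\<close> bounds the mortality
  rate.\<close>

lemma mass_exp_primitive:
  assumes b: "b \<in> ages am"
  shows "primitive_on b (\<lambda>a. mass a * exp (k * a)) (\<lambda>a. (- moment \<mu> a - l * mass a + k * mass a) * exp (k * a))"
proof -
  have "primitive_on b (\<lambda>a. exp (k * a)) (\<lambda>a. k * exp (k * a))"
    by (rule primitive_on_C1) (auto intro!: derivative_eq_intros continuous_intros)
  from primitive_on_mult[OF mass_primitive[OF b] this] show ?thesis
    by (rule primitive_on_cong) (auto simp: algebra_simps)
qed

lemma mass_upper:
  assumes b: "b \<in> ages am" and t: "t \<in> {0..b}"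
  shows "mass t * exp (l * t) \<le> mass 0"
proof -
  have "primitive_on b (\<lambda>a. - 1 * (mass a * exp (l * a))) (\<lambda>a. - 1 * ((- moment \<mu> a - l * mass a + l * mass a) * exp (l * a)))"
    by (rule primitive_on_cmult[OF mass_exp_primitive[OF b]])
  moreover have "AE a in lebesgue_on {0<..<b}. 0 \<le> - 1 * ((- moment \<mu> a - l * mass a + l * mass a) * exp (l * a))"
    using moment_mu_nonneg[OF b] by eventually_elim simp
  ultimately show ?thesis using primitive_on_nonneg_imp_ge[of b _ _ t] t by fastforce
qed

lemma mass_lower:
  assumes b: "b \<in> ages am" and t: "t \<in> {0..b}"
    and K: "AE (a, x) in lebesgue_on ({0<..<b} \<times> {0<..<1}). \<bar>\<mu> a x\<bar> \<le> K"
  shows "mass 0 \<le> mass t * exp ((l + K) * t)"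
proof -
  have "AE a in lebesgue_on {0<..<b}. 0 \<le> (- moment \<mu> a - l * mass a + (l + K) * mass a) * exp ((l + K) * a)"
    using moment_bound_AE[OF b bounded_measurable2_mu[OF b] K]
    by eventually_elim (auto simp: algebra_simps)
  from primitive_on_nonneg_imp_ge[OF mass_exp_primitive[OF b] this, of t] show ?thesis using t by simp
qed

text \<open>The rational \<open>b\<close> below \<open>am\<close> exhaust all ages, whether
  \<open>am\<close> is finite or not, so a countable union of null sets suffices.\<close>

lemma AE_ages_Times_if_Ioo:
  assumes "\<And>b. b \<in> ages am \<Longrightarrow> AE (a, x) in lebesgue_on ({0<..<b} \<times> {0<..<1::real}). P a x"
  shows "AE (a, x) in lebesgue_on (ages am \<times> {0<..<1}). P a x"
proof -
  have B: "{0<..<b} \<times> {0<..<1::real} \<in> sets borel" "ages am \<times> {0<..<1::real} \<in> sets borel" for b :: real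
    by (intro borel_Times ages_borel; simp)+
  have "AE z in lborel. \<forall>b\<in>\<rat> \<inter> ages am. z \<in> {0<..<b} \<times> {0<..<1} \<longrightarrow> (case z of (a, x) \<Rightarrow> P a x)"
  proof (subst AE_ball_countable)
    show "countable (\<rat> \<inter> ages am)" using countable_rat by blast
    show "\<forall>b\<in>\<rat> \<inter> ages am. AE z in lborel. z \<in> {0<..<b} \<times> {0<..<1} \<longrightarrow> (case z of (a, x) \<Rightarrow> P a x)"
      using assms by (auto simp: AE_lebesgue_on_iff[OF B(1)])
  qed
  then have "AE z in lborel. z \<in> ages am \<times> {0<..<1} \<longrightarrow> (case z of (a, x) \<Rightarrow> P a x)"
  proof eventually_elim
    case (elim z)
    show ?case
    proof
      assume z: "z \<in> ages am \<times> {0<..<1}"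
      then have "ereal (fst z) < am" "0 < fst z" by (auto simp: ages_def)
      then obtain c where c: "fst z < c" "ereal c < am" using ereal_dense2[of "ereal (fst z)" am] by auto
      obtain b where b: "b \<in> \<rat>" "fst z < b" "b < c" using Rats_dense_in_real[OF c(1)] by blast
      then have "b \<in> \<rat> \<inter> ages am" using c \<open>0 < fst z\<close> by (auto simp: ages_def intro: less_trans[of _ "ereal c"])
      then show "case z of (a, x) \<Rightarrow> P a x" using elim z b \<open>0 < fst z\<close> by auto
    qed
  qed
  then show ?thesis by (simp add: AE_lebesgue_on_iff[OF B(2)])
qed

text \<open>Without initial mass, \<open>mass_upper\<close> leaves no mass at any age. As
  \<open>W\<close> is positive and \<open>u\<close> nonnegative, \<open>u\<close> would vanish
  almost everywhere.\<close>

lemma mass_0_pos: "0 < mass 0"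
proof (rule ccontr)
  assume "\<not> 0 < mass 0"
  then have m0: "mass 0 \<le> 0" by simp
  have "AE (a, x) in lebesgue_on ({0<..<b} \<times> {0<..<1}). u a x = 0" if b: "b \<in> ages am" for b
  proof -
    have I: "{0<..<b} \<in> sets borel" "{0<..<1::real} \<in> sets borel" by auto
    have z: "mass t = 0" if "t \<in> {0..b}" for t
    proof -
      have "mass t * exp (l * t) \<le> 0" using mass_upper[OF b that] m0 by simp
      then have "mass t \<le> 0" by (simp add: mult_le_0_iff)
      then show ?thesis using mass_nonneg[OF b that] by simp
    qed
    have "AE a in lebesgue_on {0<..<b}. a \<in> {0<..<b}" by (rule AE_in_lebesgue_on)
    then have "AE a in lebesgue_on {0<..<b}. AE x in lebesgue_on {0<..<1}. u a x \<le> 0"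
      using AE_u_nonneg[OF b] moment_absolutely_integrable(2)[OF b bounded_measurable2_const[OF I(1), of 1]]
    proof eventually_elim
      case (elim a)
      have nn: "AE x in lebesgue_on {0<..<1}. 0 \<le> W x * 1 * u a x"
        using elim(2) by eventually_elim (simp add: less_imp_le[OF weight_pos])
      have "(\<integral>x. W x * 1 * u a x \<partial>lebesgue_on {0<..<1}) = 0"
        using z[of a] elim(1) by (simp add: moment_def)
      then have "AE x in lebesgue_on {0<..<1}. W x * 1 * u a x = 0"
        using integral_nonneg_eq_0_iff_AE[OF elim(3) nn] by blast
      then show ?case by eventually_elim (use weight_pos in \<open>auto simp: less_le\<close>)
    qed
    then have "AE (a, x) in lebesgue_on ({0<..<b} \<times> {0<..<1}). u a x \<le> 0"
      using integrable_u(1)[OF b] by (intro AE_lebesgue_on_Times_le I disjI2) auto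
    then show ?thesis using AE_ages_Times_imp_Ioo[OF b nonneg] by eventually_elim auto
  qed
  then have "AE (a, x) in lebesgue_on (ages am \<times> {0<..<1}). u a x = 0" by (rule AE_ages_Times_if_Ioo)
  then show False using nontrivial by simp
qed

text \<open>This is the renewal condition integrated against \<open>W\<close>. Since
  \<open>\<beta>\<close> vanishes from \<open>ac\<close> on, only ages below \<open>ac\<close>
  enter; there \<open>u\<close> is integrable, whatever it does near \<open>am\<close>, and the
  integrals may be exchanged.\<close>

lemma mass_0_renewal: "mass 0 = integral {0..ac} (moment \<beta>)"
proof -
  let ?M = "lebesgue_on {0<..<1::real}" and ?N = "lebesgue_on {0<..<ac}"
  have U: "{0<..<1::real} \<in> sets borel" "{0<..<ac} \<in> sets borel" by auto
  have ages_l: "ages am \<in> sets lebesgue" using ages_borel by auto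
  note I = integrable_W_mult_u[OF ac bounded_measurable2_beta]
  note I' = bounded_measurable2_integrable[OF bounded_measurable2_beta integrable_u(1)[OF ac]]
  have "AE x in ?M. x \<in> {0<..<1}" by (rule AE_in_lebesgue_on)
  then have ae: "AE x in ?M. u 0 x = (\<integral>a. \<beta> a x * u a x \<partial>?N)"
    using renewal Fubini_lebesgue_on(3)[OF U(2,1) I']
  proof eventually_elim
    case (elim x)
    let ?f = "\<lambda>a. \<beta> a x * u a x"
    have m: "(\<lambda>a. indicator {0<..<ac} a *\<^sub>R ?f a) \<in> borel_measurable lebesgue"
      using elim(3) by (subst (asm) integrable_restrict_space) auto
    have "AE a in lebesgue. ac \<le> a \<longrightarrow> a \<in> ages am \<longrightarrow> \<beta> a x = 0"
      using beta_zero elim(1) ages_l by (subst (asm) AE_restrict_space_iff) (auto elim!: eventually_mono)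
    then have eq: "AE a in lebesgue. indicator {0<..<ac} a *\<^sub>R ?f a = indicator (ages am) a *\<^sub>R ?f a"
    proof eventually_elim
      case (elim a)
      have "0 < ac" by (rule ages_pos[OF ac])
      then show ?case using elim subsetD[OF Ioo_subset_ages[OF ac], of a]
        by (cases "a \<in> ages am"; cases "ac \<le> a") (auto simp: indicator_def dest: ages_pos)
    qed
    have "(LINT a:ages am|lebesgue. ?f a) = (LINT a:{0<..<ac}|lebesgue. ?f a)"
      unfolding set_lebesgue_integral_def
      by (rule integral_cong_AE[OF borel_measurable_AE[OF m eq] m]) (use eq in \<open>auto elim!: eventually_mono\<close>)
    then show ?case using elim(2) by (simp add: set_lebesgue_integral_eq_lebesgue_on)
  qed
  have "mass 0 = (\<integral>x. (\<integral>a. W x * \<beta> a x * u a x \<partial>?N) \<partial>?M)"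
    unfolding moment_def
  proof (rule integral_cong_AE)
    have "integrable ?M (\<lambda>x. W x * 1 * u 0 x)"
      using bounded_measurable_integrable[OF W_bounded_measurable in_Lp_imp_L1(1)[OF p in_Lp_u[of 0]]] by simp
    then show "(\<lambda>x. W x * 1 * u 0 x) \<in> borel_measurable ?M" by (rule borel_measurable_integrable)
    show "(\<lambda>x. \<integral>a. W x * \<beta> a x * u a x \<partial>?N) \<in> borel_measurable ?M"
      by (rule borel_measurable_integrable[OF Fubini_lebesgue_on(4)[OF U(2,1) I]])
    show "AE x in ?M. W x * 1 * u 0 x = (\<integral>a. W x * \<beta> a x * u a x \<partial>?N)"
      using ae by eventually_elim (simp add: mult.assoc)
  qed
  also have "\<dots> = (\<integral>a. moment \<beta> a \<partial>?N)"
    unfolding moment_def by (rule Fubini_lebesgue_on(5)[OF U(2,1) I, symmetric])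
  also have "\<dots> = integral {0..ac} (moment \<beta>)"
    by (rule integral_lebesgue_on_Ioo[OF moment_absolutely_integrable(1)[OF ac bounded_measurable2_beta]])
  finally show ?thesis .
qed

end

section \<open>Bounds for the eigenvalue\<close>

lemma abs_integral_Icc_le_AE:
  fixes f :: "real \<Rightarrow> real"
  assumes f: "f absolutely_integrable_on {0..b}" and le: "AE a in lebesgue_on {0<..<b}. \<bar>f a\<bar> \<le> K" and b: "0 < b"
  shows "\<bar>integral {0..b} f\<bar> \<le> K * b"
proof -
  have c: "(\<lambda>a. K) absolutely_integrable_on {0..b}" by simp
  have "\<bar>integral {0..b} f\<bar> \<le> integral {0..b} (\<lambda>a. \<bar>f a\<bar>)" by (rule abs_integral_le[OF f])
  also have "\<dots> \<le> integral {0..b} (\<lambda>a. K)"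
    using set_integrable_norm[OF f] le by (intro integral_Icc_mono_AE c) auto
  finally show ?thesis using b by (simp add: mult.commute)
qed

lemma le_mult_exp_imp:
  fixes A m k :: real
  shows "A \<le> m * exp k \<Longrightarrow> A * exp (- k) \<le> m" "m * exp k \<le> A \<Longrightarrow> m \<le> A * exp (- k)"
  by (simp_all add: exp_minus field_simps)

text \<open>A measurable function is an almost everywhere limit of continuous ones. Dominated
  convergence makes one of these close in the integral, and the Weierstrass theorem replaces it by a
  polynomial; each step may cost \<open>e / 2\<close>.\<close>

lemma C1_dense_L1:
  fixes g :: "real \<Rightarrow> real"
  assumes g: "g \<in> borel_measurable (lebesgue_on {0<..<b})" and le: "AE a in lebesgue_on {0<..<b}. \<bar>g a\<bar> \<le> K"
    and b: "0 < b" and e: "0 < e"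
  obtains G G' where "primitive_on b G G'" "continuous_on {0..b} G'"
    "integral {0..b} (\<lambda>a. \<bar>g a - G a\<bar>) \<le> e"
proof -
  let ?M = "lebesgue_on {0<..<b}"
  \<comment> \<open>A negative \<open>K\<close> would make the bound false everywhere and the
    interval a null set.\<close>
  have K: "0 \<le> K"
  proof (rule ccontr)
    assume "\<not> 0 \<le> K"
    from le have "AE a in ?M. False" by eventually_elim (use \<open>\<not> 0 \<le> K\<close> in auto)
    then have "ae_filter ?M = bot" by (simp only: trivial_limit_def)
    then have "emeasure ?M (space ?M) = 0" by (simp only: ae_filter_eq_bot_iff)
    then show False using b by (simp add: space_restrict_space emeasure_restrict_space)
  qed
  have Il: "{0<..<b} \<in> sets lebesgue" by simp
  have "g measurable_on {0<..<b}" using g measurable_on_iff_borel_measurable[OF Il] by blast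
  then obtain N f where N: "negligible N" and f: "\<And>n. continuous_on UNIV (f n)"
    and lim: "\<And>x. x \<notin> N \<Longrightarrow> (\<lambda>n. f n x) \<longlonglongrightarrow> (if x \<in> {0<..<b} then g x else 0)"
    unfolding measurable_on_def by blast
  \<comment> \<open>Clipping to \<open>{-K..K}\<close> does not affect the limit, which already lies
    there, and supplies the dominating constant \<open>2 * K\<close>.\<close>
  define h where "h n x = max (- K) (min K (f n x))" for n x
  have h: "continuous_on {0..b} (h n)" for n
    unfolding h_def by (intro continuous_intros continuous_on_subset[OF f]) auto
  have "AE x in lebesgue. x \<notin> N" using N AE_not_in negligible_iff_null_sets by blast
  then have "AE x in ?M. x \<in> {0<..<b} \<and> x \<notin> N" using Il by (auto simp: AE_restrict_space_iff elim!: eventually_mono)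
  then have limh: "AE x in ?M. (\<lambda>n. \<bar>g x - h n x\<bar>) \<longlonglongrightarrow> 0"
    using le
  proof eventually_elim
    case (elim x)
    have "(\<lambda>n. h n x) \<longlonglongrightarrow> max (- K) (min K (g x))"
      unfolding h_def using lim[of x] elim by (intro tendsto_max tendsto_min tendsto_const) auto
    then have "(\<lambda>n. h n x) \<longlonglongrightarrow> g x" using elim by (simp add: abs_le_iff min_def max_def split: if_splits)
    then have "(\<lambda>n. g x - h n x) \<longlonglongrightarrow> g x - g x" by (intro tendsto_diff tendsto_const)
    then show ?case by (simp add: tendsto_rabs_zero)
  qed
  have hm: "h n \<in> borel_measurable ?M" for n
    by (rule continuous_imp_measurable_on_sets_lebesgue) (auto intro: continuous_on_subset[OF h])
  have "(\<lambda>n. \<integral>x. \<bar>g x - h n x\<bar> \<partial>?M) \<longlonglongrightarrow> (\<integral>x. 0 \<partial>?M)"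
  proof (rule integral_dominated_convergence)
    show "integrable ?M (\<lambda>x. 2 * K)" by (simp add: integrable_lebesgue_on_Ioo_iff)
    show "AE x in ?M. norm \<bar>g x - h n x\<bar> \<le> 2 * K" for n
      using le by eventually_elim (use K in \<open>auto simp: h_def min_def max_def split: if_splits\<close>)
  qed (use g hm limh in auto)
  then have "\<exists>n. (\<integral>x. \<bar>g x - h n x\<bar> \<partial>?M) < e / 2"
    using order_tendstoD(2)[of _ 0 sequentially "e / 2"] e by (fastforce simp: eventually_sequentially)
  then obtain n where n: "(\<integral>x. \<bar>g x - h n x\<bar> \<partial>?M) < e / 2" by blast
  \<comment> \<open>A uniform error of this size contributes \<open>e / 2\<close> to the integral
    over length \<open>b\<close>.\<close>
  have eb: "0 < e / (2 * b)" using e b by simp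
  obtain G where G: "real_polynomial_function G" "\<And>x. x \<in> {0..b} \<Longrightarrow> \<bar>h n x - G x\<bar> < e / (2 * b)"
    by (rule Stone_Weierstrass_real_polynomial_function[OF compact_Icc h eb]) blast
  obtain G' where G': "real_polynomial_function G'" "\<And>x. (G has_real_derivative G' x) (at x)"
    using has_real_derivative_polynomial_function[OF G(1)] by blast
  have cG: "continuous_on S G" "continuous_on S G'" for S
    using G(1) G'(1) continuous_on_polymonial_function real_polynomial_function_eq by blast+
  show ?thesis
  proof (rule that)
    show "primitive_on b G G'" by (rule primitive_on_C1) (auto intro: has_field_derivative_at_within G' cG)
    show "continuous_on {0..b} G'" by (rule cG)
    have gi: "g absolutely_integrable_on {0..b}"
      using integrable_bounded_mult[OF _ g le, of "\<lambda>x. 1"] by (simp add: integrable_lebesgue_on_Ioo_iff)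
    have ci: "G absolutely_integrable_on {0..b}" "h n absolutely_integrable_on {0..b}"
      by (intro absolutely_integrable_continuous_real cG h)+
    have i1: "(\<lambda>x. \<bar>g x - h n x\<bar>) absolutely_integrable_on {0..b}" "(\<lambda>x. \<bar>g x - G x\<bar>) absolutely_integrable_on {0..b}"
      using set_integrable_norm[OF set_integral_diff(1)[OF gi ci(2)]] set_integrable_norm[OF set_integral_diff(1)[OF gi ci(1)]] by auto
    have "integral {0..b} (\<lambda>x. \<bar>g x - G x\<bar>) \<le> integral {0..b} (\<lambda>x. \<bar>g x - h n x\<bar> + e / (2 * b))"
    proof (rule integral_le)
      show "\<bar>g x - G x\<bar> \<le> \<bar>g x - h n x\<bar> + e / (2 * b)" if "x \<in> {0..b}" for x
        using G(2)[OF that] by linarith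
    qed (use i1 in \<open>auto simp: absolutely_integrable_on_def intro!: integrable_add\<close>)
    also have "\<dots> = integral {0..b} (\<lambda>x. \<bar>g x - h n x\<bar>) + e / 2"
      using i1 b by (subst integral_add) (auto simp: absolutely_integrable_on_def)
    also have "integral {0..b} (\<lambda>x. \<bar>g x - h n x\<bar>) < e / 2"
      using n integral_lebesgue_on_Ioo[OF i1(1)] by simp
    finally show "integral {0..b} (\<lambda>a. \<bar>g a - G a\<bar>) \<le> e" by simp
  qed
qed

context age_space_problem
begin

definition beta_min :: "real \<Rightarrow> real" where
  "beta_min a = (INF x\<in>{0..1}. \<beta> a x)"

lemma beta_min_integrable:
  assumes "s \<in> {0..<ac}"
  shows "beta_min absolutely_integrable_on {s..ac}" "0 < integral {s..ac} beta_min"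
proof -
  have pos: "0 < (LINT a:{s..ac}|lebesgue. beta_min a)" using beta_pos[OF assms] by (simp add: beta_min_def)
  \<comment> \<open>The integral of a non-integrable function is \<open>0\<close> by convention, so
    its positivity already implies integrability.\<close>
  show i: "beta_min absolutely_integrable_on {s..ac}"
  proof (rule ccontr)
    assume "\<not> beta_min absolutely_integrable_on {s..ac}"
    then have "(LINT a:{s..ac}|lebesgue. beta_min a) = 0"
      unfolding set_lebesgue_integral_def set_integrable_def by (rule not_integrable_integral_eq)
    then show False using pos by simp
  qed
  show "0 < integral {s..ac} beta_min" using pos set_lebesgue_integral_eq_integral(2)[OF i] by simp
qed

lemma AE_beta_min:
  "AE a in lebesgue_on {0<..<ac}. 0 \<le> beta_min a \<and> (\<forall>x\<in>{0..1}. beta_min a \<le> \<beta> a x)"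
  using AE_ages_imp_Ioo[OF ac beta_nonneg]
proof eventually_elim
  case (elim a)
  have "bdd_below (\<beta> a ` {0..1})" using elim by (intro bdd_belowI[of _ 0]) auto
  then show ?case unfolding beta_min_def using elim by (auto intro: cINF_greatest cINF_lower)
qed

end

context eigenpair
begin

text \<open>If \<open>l > B\<close>, the mass decays at least like \<open>exp (-l * a)\<close>, and
  the births amount to at most \<open>B / l\<close> times the initial mass: less than the renewal
  condition requires.\<close>

lemma eigenvalue_upper:
  assumes B: "AE (a, x) in lebesgue_on ({0<..<ac} \<times> {0<..<1}). \<bar>\<beta> a x\<bar> \<le> B" "0 \<le> B"
  shows "l \<le> B"
proof (rule ccontr)
  assume "\<not> l \<le> B"
  then have l: "B < l" "0 < l" using B(2) by auto
  have ac0: "0 < ac" by (rule ages_pos[OF ac])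
  have P: "primitive_on ac (\<lambda>a. - exp (- l * a) / l) (\<lambda>a. exp (- l * a))"
    using l by (intro primitive_on_C1) (auto intro!: derivative_eq_intros continuous_intros)
  have "AE a in lebesgue_on {0<..<ac}. a \<in> {0<..<ac}" by (rule AE_in_lebesgue_on)
  then have le: "AE a in lebesgue_on {0<..<ac}. moment \<beta> a \<le> B * mass 0 * exp (- l * a)"
    using moment_bound_AE[OF ac bounded_measurable2_beta B(1)]
  proof eventually_elim
    case (elim a)
    have "mass a \<le> mass 0 * exp (- l * a)"
      using mass_upper[OF ac, of a] elim(1) by (simp add: exp_minus field_simps)
    then have "B * mass a \<le> B * (mass 0 * exp (- l * a))" using B(2) by (rule mult_left_mono)
    then show ?case using elim(2) by linarith
  qed
  have "mass 0 \<le> integral {0..ac} (\<lambda>a. B * mass 0 * exp (- l * a))"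
    unfolding mass_0_renewal
    by (rule integral_Icc_mono_AE[OF moment_absolutely_integrable(1)[OF ac bounded_measurable2_beta] _ le[unfolded mass_0_renewal]])
      (intro absolutely_integrable_continuous_real continuous_intros)
  also have "\<dots> = B * mass 0 * integral {0..ac} (\<lambda>a. exp (- l * a))" by simp
  also have "integral {0..ac} (\<lambda>a. exp (- l * a)) = (1 - exp (- l * ac)) / l"
    using primitive_on_diff[OF P, of 0 ac] ac0 by (simp add: diff_divide_distrib)
  also have "B * mass 0 * ((1 - exp (- l * ac)) / l) \<le> B * mass 0 * (1 / l)"
    using B(2) mass_0_pos l by (intro mult_left_mono divide_right_mono) auto
  also have "\<dots> < mass 0" using l mass_0_pos B(2) by (simp add: field_simps)
  finally show False by simp
qed

text \<open>If \<open>l + K\<close> is negative, then by \<open>mass_lower\<close> and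
  \<open>exp y \<ge> y\<close> the mass at age \<open>a\<close> is at least
  \<open>- (l + K) * a * mass 0\<close>. At ages above \<open>ac / 2\<close> this alone produces
  births of at least \<open>k * (- (l + K)) * (ac / 2) * mass 0\<close>, while the renewal condition
  allows no more than \<open>mass 0\<close>.\<close>

lemma eigenvalue_lower:
  assumes K: "AE (a, x) in lebesgue_on ({0<..<ac} \<times> {0<..<1}). \<bar>\<mu> a x\<bar> \<le> K"
  defines "k \<equiv> integral {ac / 2..ac} beta_min"
  shows "- (K + 2 / (ac * k)) \<le> l"
proof (cases "0 \<le> l + K")
  case True
  have "0 < k" unfolding k_def using ages_pos[OF ac] by (intro beta_min_integrable(2)) auto
  then have "0 \<le> 2 / (ac * k)" using ages_pos[OF ac] by simp
  then show ?thesis using True by linarith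
next
  case False
  define s where "s = mass 0 * (- (l + K) * (ac / 2))"
  have ac0: "0 < ac" by (rule ages_pos[OF ac])
  have k: "0 < k" and i\<beta>m: "beta_min absolutely_integrable_on {ac / 2..ac}"
    unfolding k_def using ac0 by (auto intro!: beta_min_integrable)
  note bi = moment_absolutely_integrable(1)[OF ac bounded_measurable2_beta]
  have bi2: "moment \<beta> absolutely_integrable_on {ac / 2..ac}" "moment \<beta> absolutely_integrable_on {0..ac / 2}"
    using bi ac0 by (auto elim!: absolutely_integrable_on_subinterval)
  have I1: "AE a in lebesgue_on {0<..<ac}. a \<in> {0<..<ac}" by (rule AE_in_lebesgue_on)
  have I: "{0<..<ac} \<in> sets borel" by simp
  have AEb: "AE a in lebesgue_on {0<..<ac}. 0 \<le> moment \<beta> a \<and> beta_min a * mass a \<le> moment \<beta> a \<and> 0 \<le> beta_min a"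
    using AE_u_nonneg[OF ac] AE_beta_min
      moment_absolutely_integrable(2)[OF ac bounded_measurable2_beta]
      moment_absolutely_integrable(2)[OF ac bounded_measurable2_const[OF I, of 1]] I1
  proof eventually_elim
    case (elim a)
    have 0: "0 \<le> beta_min a" using elim(2) by simp
    note le = elim(2)
    have "AE x in lebesgue_on {0<..<1}. x \<in> {0<..<1::real}" by (rule AE_in_lebesgue_on)
    then have "AE x in lebesgue_on {0<..<1}. beta_min a * (W x * 1 * u a x) \<le> W x * \<beta> a x * u a x"
      using elim(1)
    proof eventually_elim
      case (elim x)
      have "beta_min a \<le> \<beta> a x" using le elim(1) by auto
      then have "beta_min a * (W x * u a x) \<le> \<beta> a x * (W x * u a x)"
        using elim less_imp_le[OF weight_pos] by (intro mult_right_mono) auto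
      then show ?case by (simp add: mult_ac)
    qed
    then have "(\<integral>x. beta_min a * (W x * 1 * u a x) \<partial>lebesgue_on {0<..<1}) \<le> moment \<beta> a"
      unfolding moment_def using elim by (intro integral_mono_AE integrable_mult_right)
    then have "beta_min a * mass a \<le> moment \<beta> a" by (simp add: moment_def)
    moreover have "0 \<le> beta_min a * mass a" using 0 mass_nonneg[OF ac, of a] elim(5) by simp
    ultimately show ?case using 0 by simp
  qed
  have sub: "AE a in lebesgue_on {ac / 2<..<ac}. P a" if "AE a in lebesgue_on {0<..<ac}. P a" for P
    using that ac0 by (auto simp: AE_lebesgue_on_iff elim!: eventually_mono)
  have I2: "AE a in lebesgue_on {ac / 2<..<ac}. a \<in> {ac / 2<..<ac}" by (rule AE_in_lebesgue_on)
  have le: "AE a in lebesgue_on {ac / 2<..<ac}. beta_min a * s \<le> moment \<beta> a"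
    using sub[OF AEb] I2
  proof eventually_elim
    case (elim a)
    have "- (l + K) * (ac / 2) \<le> - (l + K) * a" using False elim(2) by (intro mult_left_mono) auto
    also have "\<dots> \<le> exp (- ((l + K) * a))" using exp_ge_add_one_self[of "- ((l + K) * a)"] unfolding mult_minus_left by linarith
    finally have "s \<le> mass 0 * exp (- ((l + K) * a))" unfolding s_def using mass_0_pos by (intro mult_left_mono) auto
    also have "\<dots> \<le> mass a"
      using le_mult_exp_imp(1)[OF mass_lower[OF ac _ K, of a]] elim(2) ac0 by simp
    finally have "beta_min a * s \<le> beta_min a * mass a" using elim(1) by (intro mult_left_mono) auto
    then show ?case using elim(1) by linarith
  qed
  have "k * s = integral {ac / 2..ac} (\<lambda>a. beta_min a * s)" by (simp add: k_def)
  also have "\<dots> \<le> integral {ac / 2..ac} (moment \<beta>)"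
    by (rule integral_Icc_mono_AE[OF _ bi2(1) le]) (use i\<beta>m in simp)
  also have "\<dots> \<le> integral {0..ac / 2} (moment \<beta>) + integral {ac / 2..ac} (moment \<beta>)"
  proof -
    have "AE a in lebesgue_on {0<..<ac / 2}. 0 \<le> moment \<beta> a"
      by (rule AE_Ioo_subset[where b = ac]) (use AEb ac0 in \<open>auto elim!: eventually_mono\<close>)
    from integral_Icc_nonneg_AE[OF bi2(2) this] show ?thesis by simp
  qed
  also have "\<dots> = mass 0"
    unfolding mass_0_renewal using bi ac0
    by (intro Henstock_Kurzweil_Integration.integral_combine) (auto simp: absolutely_integrable_on_def)
  finally have "k * (- (l + K) * (ac / 2)) \<le> 1" using mass_0_pos by (simp add: s_def mult.left_commute[of k])
  then show ?thesis using k ac0 by (simp add: field_simps)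
qed

end

context age_space_problem
begin

text \<open>The weak derivatives are hidden, so that a constant can be said to serve all
  \<open>d\<close>, \<open>l\<close> and \<open>u\<close> at once.\<close>

definition eigen :: "real \<Rightarrow> real \<Rightarrow> (real \<Rightarrow> real \<Rightarrow> real) \<Rightarrow> bool" where
  "eigen d l u \<longleftrightarrow> (\<exists>ux uxx ua. eigenpair am ac p \<Lambda> q \<beta> \<mu> d l u ux uxx ua)"

abbreviation "mass0 d u \<equiv> mom d u (\<lambda>a x. 1) 0"

lemma mu_bound:
  obtains K where "0 \<le> K" "AE (a, x) in lebesgue_on ({0<..<ac} \<times> {0<..<1}). \<bar>\<mu> a x\<bar> \<le> K"
  by (rule Linf_continuous_AE_bounded[OF mu_cont[OF ac]]) auto

lemma beta_bound:
  obtains B where "0 \<le> B" "AE (a, x) in lebesgue_on ({0<..<ac} \<times> {0<..<1}). \<bar>\<beta> a x\<bar> \<le> B"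
  by (rule Linf_continuous_AE_bounded[OF Linf_continuous_subset[OF beta_cont Ioo_subset_ages[OF ac] ages_borel]]) auto

text \<open>Uniformity in \<open>d\<close> is the point. Both bounds come from the mass equation and
  the renewal condition, in which \<open>d\<close> does not occur as a coefficient.\<close>

lemma eigenvalue_bound:
  obtains L where "0 \<le> L" "\<And>d l u. eigen d l u \<Longrightarrow> \<bar>l\<bar> \<le> L"
proof -
  obtain K where K: "0 \<le> K" "AE (a, x) in lebesgue_on ({0<..<ac} \<times> {0<..<1}). \<bar>\<mu> a x\<bar> \<le> K" by (rule mu_bound)
  obtain B where B: "0 \<le> B" "AE (a, x) in lebesgue_on ({0<..<ac} \<times> {0<..<1}). \<bar>\<beta> a x\<bar> \<le> B" by (rule beta_bound)
  define k where "k = K + 2 / (ac * integral {ac / 2..ac} beta_min)"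
  show ?thesis
  proof (rule that[of "\<bar>B\<bar> + \<bar>k\<bar>"])
    fix d l u assume "eigen d l u"
    then obtain ux uxx ua where "eigenpair am ac p \<Lambda> q \<beta> \<mu> d l u ux uxx ua" unfolding eigen_def by blast
    then interpret e: eigenpair am ac p \<Lambda> q \<beta> \<mu> d l u ux uxx ua .
    show "\<bar>l\<bar> \<le> \<bar>B\<bar> + \<bar>k\<bar>" using e.eigenvalue_upper[OF B(2,1)] e.eigenvalue_lower[OF K(2)] by (simp add: k_def)
  qed simp
qed

lemma mass0_pos: "eigen d l u \<Longrightarrow> 0 < mass0 d u"
  unfolding eigen_def using eigenpair.mass_0_pos by blast

lemma mass_bounds:
  obtains c C where "0 < c" "0 < C"
    "\<And>d l u a. eigen d l u \<Longrightarrow> a \<in> {0..ac} \<Longrightarrow>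
      c * mass0 d u \<le> mom d u (\<lambda>a x. 1) a \<and> mom d u (\<lambda>a x. 1) a \<le> C * mass0 d u"
proof -
  obtain L where L: "0 \<le> L" "\<And>d l u. eigen d l u \<Longrightarrow> \<bar>l\<bar> \<le> L" by (rule eigenvalue_bound) blast
  obtain K where K: "0 \<le> K" "AE (a, x) in lebesgue_on ({0<..<ac} \<times> {0<..<1}). \<bar>\<mu> a x\<bar> \<le> K" by (rule mu_bound)
  have ac0: "0 < ac" by (rule ages_pos[OF ac])
  show ?thesis
  \<comment> \<open>The worst cases of the two exponential estimates over
    \<open>\<bar>l\<bar> \<le> L\<close> and \<open>a \<le> ac\<close>.\<close>
  proof (rule that[of "exp (- ((L + K) * ac))" "exp (L * ac)"])
    fix d l u a assume ei: "eigen d l u" and a: "a \<in> {0..ac}"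
    then obtain ux uxx ua where "eigenpair am ac p \<Lambda> q \<beta> \<mu> d l u ux uxx ua" unfolding eigen_def by blast
    then interpret e: eigenpair am ac p \<Lambda> q \<beta> \<mu> d l u ux uxx ua .
    have m0: "0 < mass0 d u" by (rule e.mass_0_pos)
    have l: "\<bar>l\<bar> \<le> L" by (rule L(2)[OF ei])
    have "exp (- ((L + K) * ac)) * mass0 d u \<le> mom d u (\<lambda>a x. 1) a"
    proof -
      have "(l + K) * a \<le> (L + K) * ac" using l a K L by (intro mult_mono) auto
      then have "exp (- ((L + K) * ac)) * mass0 d u \<le> exp (- ((l + K) * a)) * mass0 d u"
        using m0 by (intro mult_right_mono) auto
      also have "\<dots> \<le> mom d u (\<lambda>a x. 1) a" using le_mult_exp_imp(1)[OF e.mass_lower[OF ac a K(2)]] by (simp add: mult.commute)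
      finally show ?thesis .
    qed
    moreover have "mom d u (\<lambda>a x. 1) a \<le> exp (L * ac) * mass0 d u"
    proof -
      have "- l * a \<le> L * ac" using l a L by (intro mult_mono) auto
      then have "exp (- l * a) * mass0 d u \<le> exp (L * ac) * mass0 d u"
        using m0 by (intro mult_right_mono) auto
      moreover have "mom d u (\<lambda>a x. 1) a \<le> exp (- l * a) * mass0 d u"
        using e.mass_upper[OF ac a] by (simp add: exp_minus field_simps)
      ultimately show ?thesis by linarith
    qed
    ultimately show "exp (- ((L + K) * ac)) * mass0 d u \<le> mom d u (\<lambda>a x. 1) a \<and>
        mom d u (\<lambda>a x. 1) a \<le> exp (L * ac) * mass0 d u" ..
  qed auto
qed

end

section \<open>Averaging in space for large diffusion\<close>

context eigenpair
begin

lemma moment_diff: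
  assumes "a \<in> insert 0 (ages am)" "bounded_measurable Y" "bounded_measurable Z"
  shows "moment (\<lambda>a x. Y x - Z x) a = moment (\<lambda>a. Y) a - moment (\<lambda>a. Z) a"
proof -
  have "integrable (lebesgue_on {0<..<1}) (\<lambda>x. W x * Y x * u a x)" "integrable (lebesgue_on {0<..<1}) (\<lambda>x. W x * Z x * u a x)"
    by (intro bounded_measurable_integrable bounded_measurable_mult W_bounded_measurable assms in_Lp_imp_L1(1)[OF p in_Lp_u])+
  then show ?thesis by (simp add: moment_def algebra_simps)
qed

end

lemma bounded_measurable_diff:
  assumes "bounded_measurable Y" "bounded_measurable Z"
  shows "bounded_measurable (\<lambda>x. Y x - Z x)"
proof -
  obtain K L where "\<forall>x\<in>{0<..<1}. \<bar>Y x\<bar> \<le> K" "\<forall>x\<in>{0<..<1}. \<bar>Z x\<bar> \<le> L"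
    using assms by (auto simp: bounded_measurable_def)
  then have "\<forall>x\<in>{0<..<1}. \<bar>Y x - Z x\<bar> \<le> K + L" by (meson abs_triangle_ineq4 add_mono order_trans)
  then show ?thesis using assms by (auto simp: bounded_measurable_def)
qed

lemma continuous_on_Icc_bounded:
  fixes f :: "real \<Rightarrow> real"
  assumes "continuous_on {a..b} f"
  obtains K where "0 \<le> K" "\<And>x. x \<in> {a..b} \<Longrightarrow> \<bar>f x\<bar> \<le> K"
proof -
  have "bounded (f ` {a..b})" using assms by (intro compact_imp_bounded compact_continuous_image) auto
  then obtain K where "\<And>x. x \<in> {a..b} \<Longrightarrow> \<bar>f x\<bar> \<le> K"
    unfolding bounded_iff by (metis image_eqI real_norm_def)
  then show ?thesis using that[of "\<bar>K\<bar>"] by force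
qed

text \<open>Integrating twice from \<open>0\<close> gives \<open>X1 0 = 0\<close> at once;
  subtracting the mean is the solvability condition that gives \<open>X1 1 = 0\<close> as
  well.\<close>

lemma space_corrector:
  assumes \<eta>: "bounded_measurable \<eta>"
  obtains X X1 where
    "primitive_on 1 X X1" "primitive_on 1 X1 (\<lambda>x. \<eta> x - integral\<^sup>L (lebesgue_on {0<..<1}) \<eta>)" "X1 0 = 0" "X1 1 = 0"
    "bounded_measurable (\<lambda>x. \<eta> x - integral\<^sup>L (lebesgue_on {0<..<1}) \<eta>)"
proof -
  let ?c = "integral\<^sup>L (lebesgue_on {0<..<1}) \<eta>"
  have b: "bounded_measurable (\<lambda>x. \<eta> x - ?c)" by (rule bounded_measurable_diff[OF \<eta> bounded_measurable_const])
  have ai: "\<eta> absolutely_integrable_on {0..1}"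
    using bounded_measurable_imp_integrable[OF \<eta>] by (simp add: integrable_lebesgue_on_Ioo_iff)
  have ai2: "(\<lambda>x. \<eta> x - ?c) absolutely_integrable_on {0..1}"
    using bounded_measurable_imp_integrable[OF b] by (simp add: integrable_lebesgue_on_Ioo_iff)
  define X1 where "X1 x = 0 + integral {0..x} (\<lambda>x. \<eta> x - ?c)" for x
  have P1: "primitive_on 1 X1 (\<lambda>x. \<eta> x - ?c)" unfolding X1_def[abs_def] by (rule primitive_on_integral[OF ai2])
  have X1: "X1 0 = 0" "X1 1 = 0"
  proof -
    show "X1 0 = 0" by (simp add: X1_def)
    have "X1 1 = integral {0..1} \<eta> - ?c"
      using ai integral_diff[of \<eta> "{0..1}" "\<lambda>x. ?c"] by (simp add: X1_def absolutely_integrable_on_def integrable_const_ivl)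
    then show "X1 1 = 0" by (simp add: integral_lebesgue_on_Ioo[OF ai])
  qed
  have "primitive_on 1 (\<lambda>x. 0 + integral {0..x} X1) X1"
    by (intro primitive_on_integral absolutely_integrable_continuous_real primitive_on_continuous[OF P1])
  from that[OF this P1 X1 b] show ?thesis .
qed

context age_space_problem
begin

text \<open>
  Integrate the equation for the moment of the corrector \<open>X\<close> against \<open>G\<close>: only the term \<open>d X''\<close> carries
  the factor \<open>d\<close>, all others are bounded by the mass.
\<close>

lemma averaging_C1:
  assumes \<eta>: "bounded_measurable \<eta>" and G: "primitive_on ac G G'" "continuous_on {0..ac} G'"
  obtains C where "0 \<le> C" "\<And>d l u. eigen d l u \<Longrightarrow>
    \<bar>integral {0..ac} (\<lambda>a. G a * (mom d u (\<lambda>a. \<eta>) a - integral\<^sup>L (lebesgue_on {0<..<1}) \<eta> * mom d u (\<lambda>a x. 1) a))\<bar>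
      \<le> C / d * mass0 d u"
proof -
  let ?c = "integral\<^sup>L (lebesgue_on {0<..<1}) \<eta>"
  let ?X2 = "\<lambda>x. \<eta> x - ?c"
  have ac0: "0 < ac" by (rule ages_pos[OF ac])
  obtain X X1 where X: "primitive_on 1 X X1" "primitive_on 1 X1 ?X2" "X1 0 = 0" "X1 1 = 0"
    and X2: "bounded_measurable ?X2" by (rule space_corrector[OF \<eta>])
  define Y where "Y x = q x * X1 x" for x
  have cX: "continuous_on {0..1} X" "continuous_on {0..1} Y"
    unfolding Y_def using X(1,2)[THEN primitive_on_continuous] by (auto intro!: continuous_intros q_cont)
  have bX: "bounded_measurable X" "bounded_measurable Y" using cX by (auto intro: bounded_measurable_continuous)
  obtain KX where KX: "0 \<le> KX" "\<And>x. x \<in> {0..1} \<Longrightarrow> \<bar>X x\<bar> \<le> KX" using continuous_on_Icc_bounded[OF cX(1)] by blast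
  obtain KY where KY: "0 \<le> KY" "\<And>x. x \<in> {0..1} \<Longrightarrow> \<bar>Y x\<bar> \<le> KY" using continuous_on_Icc_bounded[OF cX(2)] by blast
  have cG: "continuous_on {0..ac} G" by (rule primitive_on_continuous[OF G(1)])
  obtain KG where KG: "0 \<le> KG" "\<And>x. x \<in> {0..ac} \<Longrightarrow> \<bar>G x\<bar> \<le> KG" using continuous_on_Icc_bounded[OF cG] by blast
  obtain KG' where KG': "0 \<le> KG'" "\<And>x. x \<in> {0..ac} \<Longrightarrow> \<bar>G' x\<bar> \<le> KG'" using continuous_on_Icc_bounded[OF G(2)] by blast
  obtain K where K: "0 \<le> K" "AE (a, x) in lebesgue_on ({0<..<ac} \<times> {0<..<1}). \<bar>\<mu> a x\<bar> \<le> K" by (rule mu_bound)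
  obtain L where L: "0 \<le> L" "\<And>d l u. eigen d l u \<Longrightarrow> \<bar>l\<bar> \<le> L" by (rule eigenvalue_bound) blast
  obtain c0 C0 where C0: "0 < c0" "0 < C0"
    and "\<And>d l u a. eigen d l u \<Longrightarrow> a \<in> {0..ac} \<Longrightarrow>
      c0 * mass0 d u \<le> mom d u (\<lambda>a x. 1) a \<and> mom d u (\<lambda>a x. 1) a \<le> C0 * mass0 d u"
    by (rule mass_bounds) blast
  then have mass_le: "\<And>d l u a. eigen d l u \<Longrightarrow> a \<in> {0..ac} \<Longrightarrow> mom d u (\<lambda>a x. 1) a \<le> C0 * mass0 d u"
    by blast
  \<comment> \<open>The three summands bound, relative to the mass, the drift term, the mortality
    term and the term with \<open>l\<close> of the moment equation.\<close>
  define CE where "CE = \<bar>\<Lambda>\<bar> * KY + K * KX + L * KX"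
  \<comment> \<open>The first summand accounts for the boundary terms at \<open>0\<close> and
    \<open>ac\<close>, the second for everything that remains under the integral over a length
    \<open>ac\<close>.\<close>
  define C where "C = 2 * KX * KG * C0 + (CE * KG + KX * KG') * C0 * ac"
  have CE0: "0 \<le> CE" unfolding CE_def using KX KY K L by (intro add_nonneg_nonneg mult_nonneg_nonneg) auto
  show ?thesis
  proof (rule that[of C])
    show "0 \<le> C" unfolding C_def using KX KG KG' C0 CE0 ac0 by (intro add_nonneg_nonneg mult_nonneg_nonneg) auto
    fix d l u assume ei: "eigen d l u"
    then obtain ux uxx ua where "eigenpair am ac p \<Lambda> q \<beta> \<mu> d l u ux uxx ua" unfolding eigen_def by blast
    then interpret e: eigenpair am ac p \<Lambda> q \<beta> \<mu> d l u ux uxx ua .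
    have m0: "0 < mass0 d u" by (rule mass0_pos[OF ei])
    have l: "\<bar>l\<bar> \<le> L" by (rule L(2)[OF ei])
    have d: "0 < d" by (rule e.d)
    \<comment> \<open>All terms of the moment equation without the factor \<open>d\<close>.\<close>
    define E where "E a = \<Lambda> * e.moment (\<lambda>a. Y) a - e.moment (\<lambda>a x. \<mu> a x * X x) a - l * e.moment (\<lambda>a. X) a" for a
    define D where "D a = d * e.moment (\<lambda>a. ?X2) a + E a" for a
    have PX: "primitive_on ac (e.moment (\<lambda>a. X)) D"
      using e.moment_primitive[OF ac X X2] by (simp add: D_def[abs_def] E_def Y_def[abs_def] add_diff_eq)
    have cM: "continuous_on {0..ac} (e.moment (\<lambda>a. Z))" if "bounded_measurable Z" for Z
      by (rule e.moment_continuous[OF ac that])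
    have U: "{0<..<ac} \<in> sets borel" "ac \<in> {0..ac}" "0 \<in> {0..ac}" using ac0 by auto
    have bmX: "bounded_measurable2 {0<..<ac} (\<lambda>a x. \<mu> a x * X x)"
      by (intro bounded_measurable2_mult bounded_measurable2_mu ac bounded_measurable2_snd U bX)
    have iE: "E absolutely_integrable_on {0..ac}"
      unfolding E_def[abs_def]
      by (intro set_integral_diff set_integrable_mult_right e.moment_absolutely_integrable(1)[OF ac bmX]
          absolutely_integrable_continuous_real continuous_intros cM bX)
    have mX: "\<bar>e.moment (\<lambda>a. X) a\<bar> \<le> KX * e.mass a" and mY: "\<bar>e.moment (\<lambda>a. Y) a\<bar> \<le> KY * e.mass a" if "a \<in> {0..ac}" for a
      using e.moment_bound[OF ac bX(1) _ that, of KX] e.moment_bound[OF ac bX(2) _ that, of KY] KX KY by auto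
    have mX0: "\<bar>e.moment (\<lambda>a. X) a\<bar> \<le> KX * (C0 * mass0 d u)" if "a \<in> {0..ac}" for a
      by (rule order_trans[OF mX[OF that]]) (use KX mass_le[OF ei that] in \<open>auto intro: mult_left_mono\<close>)
    have muX: "AE a in lebesgue_on {0<..<ac}. \<bar>e.moment (\<lambda>a x. \<mu> a x * X x) a\<bar> \<le> K * KX * e.mass a"
    proof (rule e.moment_bound_AE[OF ac bmX])
      have "AE z in lebesgue_on ({0<..<ac} \<times> {0<..<1::real}). z \<in> {0<..<ac} \<times> {0<..<1}" by (rule AE_in_lebesgue_on)
      then show "AE (a, x) in lebesgue_on ({0<..<ac} \<times> {0<..<1}). \<bar>\<mu> a x * X x\<bar> \<le> K * KX"
        using K(2)
      proof eventually_elim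
        case (elim z)
        then show ?case using KX(2)[of "snd z"] K(1) by (auto simp: abs_mult intro!: mult_mono)
      qed
    qed
    have I: "AE a in lebesgue_on {0<..<ac}. a \<in> {0<..<ac}" by (rule AE_in_lebesgue_on)
    have rest: "AE a in lebesgue_on {0<..<ac}. \<bar>E a * G a + e.moment (\<lambda>a. X) a * G' a\<bar> \<le> (CE * KG + KX * KG') * (C0 * mass0 d u)"
      using muX I
    proof eventually_elim
      case (elim a)
      then have a: "a \<in> {0..ac}" by auto
      have ms: "0 \<le> e.mass a" "e.mass a \<le> C0 * mass0 d u" using e.mass_nonneg[OF ac a] mass_le[OF ei a] by auto
      have "\<bar>E a\<bar> \<le> \<bar>\<Lambda>\<bar> * \<bar>e.moment (\<lambda>a. Y) a\<bar> + \<bar>e.moment (\<lambda>a x. \<mu> a x * X x) a\<bar> + \<bar>l\<bar> * \<bar>e.moment (\<lambda>a. X) a\<bar>"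
        unfolding E_def abs_mult[symmetric] by linarith
      also have "\<dots> \<le> \<bar>\<Lambda>\<bar> * (KY * e.mass a) + K * KX * e.mass a + L * (KX * e.mass a)"
        using mX[OF a] mY[OF a] elim l L(1) by (intro add_mono mult_mono) auto
      also have "\<dots> = CE * e.mass a" by (simp add: CE_def algebra_simps)
      also have "\<dots> \<le> CE * (C0 * mass0 d u)" by (rule mult_left_mono[OF ms(2) CE0])
      finally have "\<bar>E a\<bar> * \<bar>G a\<bar> \<le> CE * (C0 * mass0 d u) * KG"
        using KG(2)[OF a] CE0 C0 m0 by (intro mult_mono mult_nonneg_nonneg) auto
      moreover have "\<bar>e.moment (\<lambda>a. X) a\<bar> * \<bar>G' a\<bar> \<le> KX * (C0 * mass0 d u) * KG'"
        using mX0[OF a] KG'(2)[OF a] KX C0 m0 by (intro mult_mono mult_nonneg_nonneg) auto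
      ultimately have "\<bar>E a * G a + e.moment (\<lambda>a. X) a * G' a\<bar> \<le> CE * (C0 * mass0 d u) * KG + KX * (C0 * mass0 d u) * KG'"
        unfolding abs_mult[symmetric] by linarith
      then show ?case by (simp add: algebra_simps)
    qed
    have iR: "(\<lambda>a. E a * G a + e.moment (\<lambda>a. X) a * G' a) absolutely_integrable_on {0..ac}"
      by (intro set_integral_add absolutely_integrable_mult_continuous(1)[OF iE cG]
          absolutely_integrable_continuous_real continuous_intros cM bX G(2))
    have R: "\<bar>integral {0..ac} (\<lambda>a. E a * G a + e.moment (\<lambda>a. X) a * G' a)\<bar> \<le> (CE * KG + KX * KG') * (C0 * mass0 d u) * ac"
      by (rule abs_integral_Icc_le_AE[OF iR rest ac0])
    have iM: "(\<lambda>a. d * (G a * e.moment (\<lambda>a. ?X2) a)) absolutely_integrable_on {0..ac}"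
      by (intro absolutely_integrable_continuous_real continuous_intros cM X2 cG)
    note P = primitive_on_mult[OF PX G(1)]
    have "e.moment (\<lambda>a. X) ac * G ac - e.moment (\<lambda>a. X) 0 * G 0
       = integral {0..ac} (\<lambda>a. D a * G a + e.moment (\<lambda>a. X) a * G' a)"
      using primitive_on_diff[OF P, of 0 ac] ac0 by simp
    also have "\<dots> = integral {0..ac} (\<lambda>a. d * (G a * e.moment (\<lambda>a. ?X2) a) + (E a * G a + e.moment (\<lambda>a. X) a * G' a))"
      by (simp add: D_def algebra_simps)
    also have "\<dots> = d * integral {0..ac} (\<lambda>a. G a * e.moment (\<lambda>a. ?X2) a) + integral {0..ac} (\<lambda>a. E a * G a + e.moment (\<lambda>a. X) a * G' a)"
      using iM iR by (subst integral_add) (auto simp: absolutely_integrable_on_def)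
    finally have "d * integral {0..ac} (\<lambda>a. G a * e.moment (\<lambda>a. ?X2) a) = e.moment (\<lambda>a. X) ac * G ac - e.moment (\<lambda>a. X) 0 * G 0
       - integral {0..ac} (\<lambda>a. E a * G a + e.moment (\<lambda>a. X) a * G' a)" by simp
    moreover have "\<bar>e.moment (\<lambda>a. X) a * G a\<bar> \<le> KX * (C0 * mass0 d u) * KG" if "a \<in> {0..ac}" for a
      unfolding abs_mult using mX0[OF that] KG(2)[OF that] KX C0 m0 by (intro mult_mono mult_nonneg_nonneg) auto
    ultimately have "\<bar>d * integral {0..ac} (\<lambda>a. G a * e.moment (\<lambda>a. ?X2) a)\<bar> \<le>
       KX * (C0 * mass0 d u) * KG + KX * (C0 * mass0 d u) * KG + (CE * KG + KX * KG') * (C0 * mass0 d u) * ac"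
      using R U by (smt (verit, best))
    also have "\<dots> = C * mass0 d u" by (simp add: C_def algebra_simps)
    finally have "\<bar>integral {0..ac} (\<lambda>a. G a * e.moment (\<lambda>a. ?X2) a)\<bar> \<le> C / d * mass0 d u"
      using d by (simp add: abs_mult field_simps)
    moreover have "integral {0..ac} (\<lambda>a. G a * e.moment (\<lambda>a. ?X2) a)
      = integral {0..ac} (\<lambda>a. G a * (e.moment (\<lambda>a. \<eta>) a - ?c * e.mass a))"
    proof (rule Henstock_Kurzweil_Integration.integral_cong)
      fix a assume a: "a \<in> {0..ac}"
      then have "a \<in> insert 0 (ages am)"
        using ac by (auto simp: ages_def) (meson ereal_less_eq(3) le_less_trans)
      then have "e.moment (\<lambda>a. ?X2) a = e.moment (\<lambda>a. \<eta>) a - e.moment (\<lambda>a x. ?c) a"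
        by (rule e.moment_diff[OF _ \<eta> bounded_measurable_const])
      then show "G a * e.moment (\<lambda>a. ?X2) a = G a * (e.moment (\<lambda>a. \<eta>) a - ?c * e.mass a)"
        using e.moment_const[of ?c a] by simp
    qed
    ultimately show "\<bar>integral {0..ac} (\<lambda>a. G a * (mom d u (\<lambda>a. \<eta>) a - ?c * mom d u (\<lambda>a x. 1) a))\<bar> \<le> C / d * mass0 d u"
      by simp
  qed
qed

end

lemma integrable_Times_const:
  "integrable (lebesgue_on ({0<..<b::real} \<times> {0<..<1::real})) (\<lambda>(a, x). 1 :: real)"
proof (rule integrable_lebesgue_on_Times)
  show "AE a in lebesgue_on {0<..<b}. (\<integral>x. \<bar>1::real\<bar> \<partial>lebesgue_on {0<..<1::real}) \<le> 1"
    by (simp add: measure_restrict_space space_restrict_space)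
  show "integrable (lebesgue_on {0<..<b}) (\<lambda>a. 1 :: real)" by (simp add: integrable_lebesgue_on_Ioo_iff)
qed (auto simp: integrable_lebesgue_on_const)

lemma bounded_measurable2_imp_integrable:
  assumes "bounded_measurable2 {0<..<b} G"
  shows "integrable (lebesgue_on ({0<..<b} \<times> {0<..<1})) (case_prod G)"
  using bounded_measurable2_integrable[OF assms integrable_Times_const] by simp

lemma bounded_measurable2_slice:
  assumes "bounded_measurable2 {0<..<b} G"
  shows "AE a in lebesgue_on {0<..<b}. integrable (lebesgue_on {0<..<1}) (G a)"
    "(\<lambda>a. integral\<^sup>L (lebesgue_on {0<..<1}) (G a)) absolutely_integrable_on {0..b}"
proof -
  have I: "{0<..<b} \<in> sets borel" "{0<..<1::real} \<in> sets borel" by auto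
  note F = Fubini_lebesgue_on[OF I bounded_measurable2_imp_integrable[OF assms]]
  show "AE a in lebesgue_on {0<..<b}. integrable (lebesgue_on {0<..<1}) (G a)" by (rule F(1))
  show "(\<lambda>a. integral\<^sup>L (lebesgue_on {0<..<1}) (G a)) absolutely_integrable_on {0..b}"
    using F(2) by (simp add: integrable_lebesgue_on_Ioo_iff)
qed

lemma mult_half_divide:
  fixes A e :: real
  shows "0 < A \<Longrightarrow> A * (e / (2 * A)) = e / 2"
  by simp

lemma abs_integral_unit_le:
  fixes f :: "real \<Rightarrow> real"
  assumes i: "integrable (lebesgue_on {0<..<1}) f" and le: "AE x in lebesgue_on {0<..<1}. \<bar>f x\<bar> \<le> K"
  shows "\<bar>\<integral>x. f x \<partial>lebesgue_on {0<..<1::real}\<bar> \<le> K"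
  using abs_integral_Icc_le_AE[where f = f and b = 1 and K = K] integral_lebesgue_on_Ioo[where f = f and a = 0 and b = 1] i le
  by (simp add: integrable_lebesgue_on_Ioo_iff)

lemma bounded_measurable_cell: "bounded_measurable (indicator {x. nat \<lfloor>real N * x\<rfloor> = k})"
  unfolding bounded_measurable_def
  by (intro conjI borel_measurable_cell exI[of _ 1]) (auto simp: indicator_def)

lemma absolutely_integrable_bounded_mult:
  fixes f g :: "real \<Rightarrow> real"
  assumes "f absolutely_integrable_on {0..b}" "g \<in> borel_measurable (lebesgue_on {0<..<b})"
    "AE a in lebesgue_on {0<..<b}. \<bar>g a\<bar> \<le> K"
  shows "(\<lambda>a. g a * f a) absolutely_integrable_on {0..b}"
  using integrable_bounded_mult[OF _ assms(2,3), of f] assms(1) by (simp add: integrable_lebesgue_on_Ioo_iff)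

context age_space_problem
begin

text \<open>The constant of \<open>averaging_C1\<close> depends on \<open>G'\<close>, so a rough
  \<open>g\<close> is first replaced by a smooth \<open>G\<close> close to it in the integral, and
  \<open>d\<close> is chosen large afterwards. The error is harmless because the defect of
  \<open>\<eta>\<close> is bounded by a multiple of the initial mass, uniformly in
  \<open>d\<close>.\<close>

lemma averaging_bounded:
  assumes \<eta>: "bounded_measurable \<eta>" and g: "g \<in> borel_measurable (lebesgue_on {0<..<ac})"
    "AE a in lebesgue_on {0<..<ac}. \<bar>g a\<bar> \<le> Kg" and \<epsilon>: "0 < \<epsilon>"
  obtains D0 where "0 < D0" "\<And>d l u. D0 \<le> d \<Longrightarrow> eigen d l u \<Longrightarrow>
    \<bar>integral {0..ac} (\<lambda>a. g a * (mom d u (\<lambda>a. \<eta>) a - integral\<^sup>L (lebesgue_on {0<..<1}) \<eta> * mom d u (\<lambda>a x. 1) a))\<bar>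
      \<le> \<epsilon> * mass0 d u"
proof -
  let ?c = "integral\<^sup>L (lebesgue_on {0<..<1}) \<eta>"
  have ac0: "0 < ac" by (rule ages_pos[OF ac])
  obtain c0 C0 where C0: "0 < c0" "0 < C0"
    and mass: "\<And>d l u a. eigen d l u \<Longrightarrow> a \<in> {0..ac} \<Longrightarrow>
      c0 * mass0 d u \<le> mom d u (\<lambda>a x. 1) a \<and> mom d u (\<lambda>a x. 1) a \<le> C0 * mass0 d u"
    by (rule mass_bounds) blast
  obtain K\<eta>' where "\<forall>x\<in>{0<..<1}. \<bar>\<eta> x\<bar> \<le> K\<eta>'" using \<eta> by (auto simp: bounded_measurable_def)
  then obtain K\<eta> where K\<eta>: "0 \<le> K\<eta>" "\<And>x. x \<in> {0<..<1} \<Longrightarrow> \<bar>\<eta> x\<bar> \<le> K\<eta>" by (metis abs_ge_self abs_ge_zero order_trans)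
  have cK: "\<bar>?c\<bar> \<le> K\<eta>"
    by (rule abs_integral_unit_le[OF bounded_measurable_imp_integrable[OF \<eta>]])
      (use K\<eta> in \<open>auto simp: space_restrict_space intro!: AE_I2\<close>)
  \<comment> \<open>The defect is at most \<open>2 * K\<eta> * C0\<close> times the initial mass, so
    replacing \<open>g\<close> costs at most \<open>\<epsilon> / 2\<close>; the added
    \<open>1\<close> avoids division by zero.\<close>
  define \<delta> where "\<delta> = \<epsilon> / (2 * (2 * K\<eta> * C0 + 1))"
  have pos: "0 < 2 * K\<eta> * C0 + 1" using K\<eta> C0 by (simp add: add_nonneg_pos)
  have \<delta>: "0 < \<delta>" unfolding \<delta>_def using \<epsilon> pos by simp
  have \<delta>2: "2 * K\<eta> * C0 * \<delta> \<le> \<epsilon> / 2"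
  proof -
    have "2 * K\<eta> * C0 * \<delta> \<le> (2 * K\<eta> * C0 + 1) * \<delta>" using \<delta> by (intro mult_right_mono) auto
    also have "\<dots> = \<epsilon> / 2" unfolding \<delta>_def by (rule mult_half_divide[OF pos])
    finally show ?thesis .
  qed
  obtain G G' where G: "primitive_on ac G G'" "continuous_on {0..ac} G'" "integral {0..ac} (\<lambda>a. \<bar>g a - G a\<bar>) \<le> \<delta>"
    by (rule C1_dense_L1[OF g ac0 \<delta>])
  obtain C where C: "0 \<le> C" "\<And>d l u. eigen d l u \<Longrightarrow>
    \<bar>integral {0..ac} (\<lambda>a. G a * (mom d u (\<lambda>a. \<eta>) a - ?c * mom d u (\<lambda>a x. 1) a))\<bar> \<le> C / d * mass0 d u"
    by (rule averaging_C1[OF \<eta> G(1,2)]) blast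
  show ?thesis
  \<comment> \<open>Large enough for \<open>C / d \<le> \<epsilon> / 2\<close>.\<close>
  proof (rule that[of "2 * C / \<epsilon> + 1"])
    show "0 < 2 * C / \<epsilon> + 1" using C \<epsilon> by (simp add: add_nonneg_pos)
    fix d l u assume dD: "2 * C / \<epsilon> + 1 \<le> d" and ei: "eigen d l u"
    then obtain ux uxx ua where "eigenpair am ac p \<Lambda> q \<beta> \<mu> d l u ux uxx ua" unfolding eigen_def by blast
    then interpret e: eigenpair am ac p \<Lambda> q \<beta> \<mu> d l u ux uxx ua .
    have m0: "0 < mass0 d u" by (rule mass0_pos[OF ei])
    define Q where "Q a = e.moment (\<lambda>a. \<eta>) a - ?c * e.mass a" for a
    have cQ: "continuous_on {0..ac} Q"
      unfolding Q_def[abs_def] by (intro continuous_intros e.moment_continuous[OF ac] \<eta> bounded_measurable_const)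
    have Qb: "\<bar>Q a\<bar> \<le> 2 * K\<eta> * C0 * mass0 d u" if a: "a \<in> {0..ac}" for a
    proof -
      have ms: "0 \<le> e.mass a" "e.mass a \<le> C0 * mass0 d u" using e.mass_nonneg[OF ac a] mass[OF ei a] by auto
      have "\<bar>Q a\<bar> \<le> \<bar>e.moment (\<lambda>a. \<eta>) a\<bar> + \<bar>?c\<bar> * e.mass a"
        unfolding Q_def using ms by (metis abs_mult abs_of_nonneg abs_triangle_ineq4)
      also have "\<dots> \<le> K\<eta> * e.mass a + K\<eta> * e.mass a"
        using e.moment_bound[OF ac \<eta> K\<eta>(2) a] cK ms by (intro add_mono mult_right_mono) auto
      also have "\<dots> = 2 * K\<eta> * e.mass a" by simp
      also have "\<dots> \<le> 2 * K\<eta> * (C0 * mass0 d u)" using ms K\<eta> by (intro mult_left_mono) auto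
      finally show ?thesis by (simp add: mult_ac)
    qed
    have gi: "g absolutely_integrable_on {0..ac}"
      using absolutely_integrable_bounded_mult[OF _ g, of "\<lambda>x. 1"] by simp
    have Gi: "G absolutely_integrable_on {0..ac}"
      by (intro absolutely_integrable_continuous_real primitive_on_continuous[OF G(1)])
    have D: "(\<lambda>a. g a - G a) absolutely_integrable_on {0..ac}" by (rule set_integral_diff(1)[OF gi Gi])
    have "\<bar>integral {0..ac} (\<lambda>a. (g a - G a) * Q a)\<bar> \<le> 2 * K\<eta> * C0 * mass0 d u * integral {0..ac} (\<lambda>a. \<bar>g a - G a\<bar>)"
      by (rule integral_mult_le_sup[OF D cQ Qb])
    also have "\<dots> \<le> 2 * K\<eta> * C0 * mass0 d u * \<delta>"
      using G(3) K\<eta> C0 m0 by (intro mult_left_mono) auto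
    also have "\<dots> \<le> \<epsilon> / 2 * mass0 d u"
      using mult_right_mono[OF \<delta>2, of "mass0 d u"] m0 by (simp add: mult_ac)
    finally have 1: "\<bar>integral {0..ac} (\<lambda>a. (g a - G a) * Q a)\<bar> \<le> \<epsilon> / 2 * mass0 d u" .
    have d: "0 < d" by (rule e.d)
    have "2 * C / \<epsilon> \<le> d" using dD by simp
    then have "C / d \<le> \<epsilon> / 2" using d \<epsilon> by (simp add: field_simps)
    then have "C / d * mass0 d u \<le> \<epsilon> / 2 * mass0 d u" using m0 by (intro mult_right_mono) auto
    then have 2: "\<bar>integral {0..ac} (\<lambda>a. G a * Q a)\<bar> \<le> \<epsilon> / 2 * mass0 d u"
      using C(2)[OF ei] unfolding Q_def by linarith
    have "integral {0..ac} (\<lambda>a. g a * Q a) = integral {0..ac} (\<lambda>a. (g a - G a) * Q a + G a * Q a)"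
      by (simp add: algebra_simps)
    also have "\<dots> = integral {0..ac} (\<lambda>a. (g a - G a) * Q a) + integral {0..ac} (\<lambda>a. G a * Q a)"
      using absolutely_integrable_mult_continuous(1)[OF D cQ] absolutely_integrable_mult_continuous(1)[OF Gi cQ]
      by (intro integral_add) (auto simp: absolutely_integrable_on_def)
    finally show "\<bar>integral {0..ac} (\<lambda>a. g a * (mom d u (\<lambda>a. \<eta>) a - ?c * mom d u (\<lambda>a x. 1) a))\<bar> \<le> \<epsilon> * mass0 d u"
      using 1 2 unfolding Q_def by (simp add: field_simps)
  qed
qed

text \<open>Up to a uniformly small remainder, \<open>f\<close> is a sum over grid cells of a
  function of age times an indicator in space. The age factors join \<open>g\<close>, and
  \<open>averaging_bounded\<close> treats each indicator separately. The remainder needs no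
  averaging, only the mass bound.\<close>

lemma averaging_Linf:
  assumes f: "Linf_continuous {0<..<ac} f" and g: "g \<in> borel_measurable (lebesgue_on {0<..<ac})"
    "AE a in lebesgue_on {0<..<ac}. \<bar>g a\<bar> \<le> Kg" and \<epsilon>: "0 < \<epsilon>"
  obtains D0 where "0 < D0" "\<And>d l u. D0 \<le> d \<Longrightarrow> eigen d l u \<Longrightarrow>
    \<bar>integral {0..ac} (\<lambda>a. g a * (mom d u f a - integral\<^sup>L (lebesgue_on {0<..<1}) (f a) * mom d u (\<lambda>a x. 1) a))\<bar>
      \<le> \<epsilon> * mass0 d u"
proof -
  let ?M = "lebesgue_on {0<..<1::real}" and ?N = "lebesgue_on {0<..<ac}"
  have ac0: "0 < ac" by (rule ages_pos[OF ac])
  have I: "{0<..<ac} \<in> sets borel" "{0<..<1::real} \<in> sets borel" by auto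
  obtain c0 C0 where C0: "0 < c0" "0 < C0"
    and mass: "\<And>d l u a. eigen d l u \<Longrightarrow> a \<in> {0..ac} \<Longrightarrow>
      c0 * mass0 d u \<le> mom d u (\<lambda>a x. 1) a \<and> mom d u (\<lambda>a x. 1) a \<le> C0 * mass0 d u"
    by (rule mass_bounds) blast
  have Kg: "AE a in ?N. \<bar>g a\<bar> \<le> \<bar>Kg\<bar>" using g(2) by eventually_elim linarith
  \<comment> \<open>The remainder has moment and mean at most \<open>\<delta>\<close> relative to
    the mass; with the factor \<open>g\<close>, over a length \<open>ac\<close>, this costs at most
    \<open>\<epsilon> / 2\<close>.\<close>
  define \<delta> where "\<delta> = \<epsilon> / (2 * (2 * \<bar>Kg\<bar> * C0 * ac + 1))"
  have pos: "0 < 2 * \<bar>Kg\<bar> * C0 * ac + 1" using C0 ac0 by (simp add: add_nonneg_pos)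
  have \<delta>: "0 < \<delta>" unfolding \<delta>_def using \<epsilon> pos by simp
  have \<delta>2: "2 * \<bar>Kg\<bar> * C0 * ac * \<delta> \<le> \<epsilon> / 2"
  proof -
    have "2 * \<bar>Kg\<bar> * C0 * ac * \<delta> \<le> (2 * \<bar>Kg\<bar> * C0 * ac + 1) * \<delta>" using \<delta> by (intro mult_right_mono) auto
    also have "\<dots> = \<epsilon> / 2" unfolding \<delta>_def by (rule mult_half_divide[OF pos])
    finally show ?thesis .
  qed
  obtain N where N: "0 < N" "AE (a, x) in lebesgue_on ({0<..<ac} \<times> {0<..<1}). \<bar>f a x - f a (grid N x)\<bar> \<le> \<delta>"
    by (rule Linf_continuous_grid_approx[OF f I(1) \<delta>])
  define cell where "cell k = indicat_real {x. nat \<lfloor>real N * x\<rfloor> = k}" for k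
  have cell: "bounded_measurable (cell k)" for k unfolding cell_def by (rule bounded_measurable_cell)
  define fk where "fk k a = f a (real k / real N)" for k a
  obtain Kf where Kf: "\<And>x. x \<in> {0..1} \<Longrightarrow> AE a in ?N. \<bar>f a x\<bar> \<le> Kf"
    using Linf_continuous_bounded[OF f] by metis
  have kN: "real k / real N \<in> {0..1}" if "k < N" for k using that by auto
  have fk: "fk k \<in> borel_measurable ?N" "AE a in ?N. \<bar>fk k a\<bar> \<le> Kf" if "k < N" for k
    using f Kf[OF kN[OF that]] kN[OF that] by (auto simp: fk_def[abs_def] Linf_continuous_def in_Linf_def)
  have gfk: "(\<lambda>a. g a * fk k a) \<in> borel_measurable ?N" "AE a in ?N. \<bar>g a * fk k a\<bar> \<le> \<bar>Kg\<bar> * Kf" if "k < N" for k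
  proof -
    show "(\<lambda>a. g a * fk k a) \<in> borel_measurable ?N" using g(1) fk(1)[OF that] by (rule borel_measurable_times)
    show "AE a in ?N. \<bar>g a * fk k a\<bar> \<le> \<bar>Kg\<bar> * Kf" using Kg fk(2)[OF that]
      by eventually_elim (auto simp: abs_mult intro!: mult_mono)
  qed
  let ?Q = "\<lambda>d u k a. mom d u (\<lambda>a. cell k) a - integral\<^sup>L ?M (cell k) * mom d u (\<lambda>a x. 1) a"
  have "\<forall>k\<in>{..<N}. \<exists>D. 0 < D \<and> (\<forall>d l u. D \<le> d \<longrightarrow> eigen d l u \<longrightarrow>
    \<bar>integral {0..ac} (\<lambda>a. (g a * fk k a) * ?Q d u k a)\<bar> \<le> \<epsilon> / (2 * real N) * mass0 d u)"
  proof
    fix k assume "k \<in> {..<N}"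
    then have k: "k < N" by simp
    \<comment> \<open>The other half of \<open>\<epsilon>\<close> is shared equally among the
      \<open>N\<close> cells.\<close>
    have e: "0 < \<epsilon> / (2 * real N)" using \<epsilon> N by simp
    show "\<exists>D. 0 < D \<and> (\<forall>d l u. D \<le> d \<longrightarrow> eigen d l u \<longrightarrow>
      \<bar>integral {0..ac} (\<lambda>a. (g a * fk k a) * ?Q d u k a)\<bar> \<le> \<epsilon> / (2 * real N) * mass0 d u)"
      by (rule averaging_bounded[OF cell gfk[OF k] e]) blast
  qed
  from bchoice[OF this] obtain D where D: "\<forall>k\<in>{..<N}. 0 < D k \<and> (\<forall>d l u. D k \<le> d \<longrightarrow> eigen d l u \<longrightarrow>
    \<bar>integral {0..ac} (\<lambda>a. (g a * fk k a) * ?Q d u k a)\<bar> \<le> \<epsilon> / (2 * real N) * mass0 d u)" ..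
  define G where "G a x = f a x - f a (grid N x)" for a x
  have bG: "bounded_measurable2 {0<..<ac} G"
  proof -
    have "(\<lambda>z. case_prod f z - (\<lambda>(a, x). f a (grid N x)) z) \<in> borel_measurable (lebesgue_on ({0<..<ac} \<times> {0<..<1}))"
      by (intro borel_measurable_diff Linf_continuous_measurable Linf_continuous_grid_measurable f I N(1))
    then show ?thesis using N(2) by (auto simp: bounded_measurable2_def G_def case_prod_beta')
  qed
  have G_le: "AE (a, x) in lebesgue_on ({0<..<ac} \<times> {0<..<1}). \<bar>G a x\<bar> \<le> \<delta>" using N(2) by (simp add: G_def)
  have bf: "bounded_measurable2 {0<..<ac} f" by (rule bounded_measurable2_Linf[OF f I(1)])
  have G_cells: "G a x = f a x - (\<Sum>k<N. fk k a * cell k x)" if "x \<in> {0<..<1}" for a x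
    unfolding G_def fk_def cell_def using grid_sum[OF N(1) that, of "f a"] by simp
  show ?thesis
  \<comment> \<open>The sum of the thresholds exceeds each of them, as they are positive; the added
    \<open>1\<close> keeps the result visibly positive.\<close>
  proof (rule that[of "(\<Sum>k<N. D k) + 1"])
    have D0: "0 \<le> D k" if "k \<in> {..<N}" for k using D that by (simp add: less_imp_le)
    show "0 < (\<Sum>k<N. D k) + 1" using sum_nonneg[of "{..<N}" D] D0 by (simp add: add_nonneg_pos)
    fix d l u assume dD: "(\<Sum>k<N. D k) + 1 \<le> d" and ei: "eigen d l u"
    then obtain ux uxx ua where "eigenpair am ac p \<Lambda> q \<beta> \<mu> d l u ux uxx ua" unfolding eigen_def by blast
    then interpret e: eigenpair am ac p \<Lambda> q \<beta> \<mu> d l u ux uxx ua .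
    have m0: "0 < mass0 d u" by (rule mass0_pos[OF ei])
    define fbar where "fbar a = integral\<^sup>L ?M (f a)" for a
    define S where "S a = (\<Sum>k<N. fk k a * ?Q d u k a)" for a
    \<comment> \<open>By linearity this is the averaging defect of the remainder \<open>G\<close>,
      for almost every age.\<close>
    define R where "R a = e.moment f a - fbar a * e.mass a - S a" for a
    have cQ: "continuous_on {0..ac} (?Q d u k)" for k
      by (intro continuous_intros e.moment_continuous[OF ac] cell bounded_measurable_const)
    have term_int: "(\<lambda>a. (g a * fk k a) * ?Q d u k a) absolutely_integrable_on {0..ac}" if "k < N" for k
      by (rule absolutely_integrable_bounded_mult[OF absolutely_integrable_continuous_real[OF cQ] gfk[OF that]])
    have AE_I: "AE a in ?N. a \<in> {0<..<ac}" by (rule AE_in_lebesgue_on)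
    have AE_x: "AE x in ?M. x \<in> {0<..<1}" by (rule AE_in_lebesgue_on)
    have Rb: "AE a in ?N. \<bar>R a\<bar> \<le> 2 * \<delta> * (C0 * mass0 d u)"
      using AE_I e.moment_absolutely_integrable(2)[OF ac bf] e.moment_bound_AE[OF ac bG G_le]
        AE_lebesgue_on_Times(1)[OF I G_le] bounded_measurable2_slice(1)[OF bf] bounded_measurable2_slice(1)[OF bG]
    proof eventually_elim
      case (elim a)
      have a: "a \<in> {0..ac}" using elim(1) by simp
      have "a \<in> insert 0 (ages am)" using Ioo_subset_ages[OF ac] elim(1) by blast
      then have uL: "integrable ?M (u a)" by (intro in_Lp_imp_L1(1)[OF p] e.in_Lp_u)
      have ic: "integrable ?M (\<lambda>x. e.W x * cell k x * u a x)" for k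
        by (intro bounded_measurable_integrable bounded_measurable_mult e.W_bounded_measurable cell uL)
      have "e.moment G a = (\<integral>x. e.W x * f a x * u a x - (\<Sum>k<N. fk k a * (e.W x * cell k x * u a x)) \<partial>?M)"
        unfolding mom_def
        by (rule Bochner_Integration.integral_cong[OF refl])
          (simp add: space_restrict_space G_cells algebra_simps sum_distrib_left)
      also have "\<dots> = e.moment f a - (\<Sum>k<N. fk k a * e.moment (\<lambda>a. cell k) a)"
        using elim(2) ic by (subst Bochner_Integration.integral_diff) (auto simp: mom_def)
      finally have 1: "e.moment G a = e.moment f a - (\<Sum>k<N. fk k a * e.moment (\<lambda>a. cell k) a)" .
      have "integral\<^sup>L ?M (G a) = (\<integral>x. f a x - (\<Sum>k<N. fk k a * cell k x) \<partial>?M)"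
        by (rule Bochner_Integration.integral_cong[OF refl]) (simp add: space_restrict_space G_cells)
      also have "\<dots> = fbar a - (\<Sum>k<N. fk k a * integral\<^sup>L ?M (cell k))"
        using elim(5) bounded_measurable_imp_integrable[OF cell]
        by (subst Bochner_Integration.integral_diff) (auto simp: fbar_def)
      finally have 2: "integral\<^sup>L ?M (G a) = fbar a - (\<Sum>k<N. fk k a * integral\<^sup>L ?M (cell k))" .
      have "R a = e.moment G a - integral\<^sup>L ?M (G a) * e.mass a"
        unfolding R_def S_def 1 2 by (simp add: algebra_simps sum_subtractf sum_distrib_left sum_distrib_right)
      moreover have "\<bar>integral\<^sup>L ?M (G a)\<bar> \<le> \<delta>" by (rule abs_integral_unit_le[OF elim(6,4)])
      moreover have ms: "0 \<le> e.mass a" "e.mass a \<le> C0 * mass0 d u" using e.mass_nonneg[OF ac a] mass[OF ei a] by auto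
      ultimately have "\<bar>R a\<bar> \<le> \<delta> * e.mass a + \<delta> * e.mass a"
        using elim(3) mult_right_mono[of "\<bar>integral\<^sup>L ?M (G a)\<bar>" \<delta> "e.mass a"]
          abs_triangle_ineq4[of "e.moment G a" "integral\<^sup>L ?M (G a) * e.mass a"] by (simp add: abs_mult)
      also have "\<dots> \<le> 2 * \<delta> * (C0 * mass0 d u)" using ms \<delta> by (simp add: mult_left_mono)
      finally show ?case .
    qed
    have iS: "(\<lambda>a. g a * S a) absolutely_integrable_on {0..ac}"
    proof -
      have "(\<lambda>a. \<Sum>k\<in>{..<N}. (g a * fk k a) * ?Q d u k a) absolutely_integrable_on {0..ac}"
        by (rule absolutely_integrable_sum) (use term_int in auto)
      then show ?thesis by (simp add: S_def sum_distrib_left mult_ac)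
    qed
    have "(\<lambda>a. e.moment f a - fbar a * e.mass a) absolutely_integrable_on {0..ac}"
      using set_integral_diff(1)[OF e.moment_absolutely_integrable(1)[OF ac bf]
          absolutely_integrable_mult_continuous(1)[OF bounded_measurable2_slice(2)[OF bf] e.mass_continuous[OF ac]]]
      by (simp add: fbar_def)
    then have ifb: "(\<lambda>a. g a * (e.moment f a - fbar a * e.mass a)) absolutely_integrable_on {0..ac}"
      by (rule absolutely_integrable_bounded_mult[OF _ g])
    have iR: "(\<lambda>a. g a * R a) absolutely_integrable_on {0..ac}"
      using set_integral_diff(1)[OF ifb iS] by (simp add: R_def algebra_simps)
    have "AE a in ?N. \<bar>g a * R a\<bar> \<le> \<bar>Kg\<bar> * (2 * \<delta> * (C0 * mass0 d u))"
      using Kg Rb by eventually_elim (auto simp: abs_mult intro!: mult_mono)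
    from abs_integral_Icc_le_AE[OF iR this ac0]
    have "\<bar>integral {0..ac} (\<lambda>a. g a * R a)\<bar> \<le> (2 * \<bar>Kg\<bar> * C0 * ac * \<delta>) * mass0 d u" by (simp add: mult_ac)
    also have "\<dots> \<le> \<epsilon> / 2 * mass0 d u" using \<delta>2 m0 by (intro mult_right_mono) auto
    finally have 1: "\<bar>integral {0..ac} (\<lambda>a. g a * R a)\<bar> \<le> \<epsilon> / 2 * mass0 d u" .
    have "integral {0..ac} (\<lambda>a. g a * S a) = integral {0..ac} (\<lambda>a. \<Sum>k<N. (g a * fk k a) * ?Q d u k a)"
      by (simp add: S_def sum_distrib_left mult_ac)
    also have "\<dots> = (\<Sum>k<N. integral {0..ac} (\<lambda>a. (g a * fk k a) * ?Q d u k a))"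
      using term_int by (intro integral_sum) (auto simp: absolutely_integrable_on_def)
    finally have eqS: "integral {0..ac} (\<lambda>a. g a * S a) = (\<Sum>k<N. integral {0..ac} (\<lambda>a. (g a * fk k a) * ?Q d u k a))" .
    have "\<bar>integral {0..ac} (\<lambda>a. g a * S a)\<bar> \<le> (\<Sum>k<N. \<bar>integral {0..ac} (\<lambda>a. (g a * fk k a) * ?Q d u k a)\<bar>)"
      unfolding eqS by (rule sum_abs)
    also have "\<dots> \<le> (\<Sum>k<N. \<epsilon> / (2 * real N) * mass0 d u)"
    proof (rule sum_mono)
      fix k assume k: "k \<in> {..<N}"
      have "D k \<le> (\<Sum>k<N. D k)" using k D0 by (intro member_le_sum) auto
      then have "D k \<le> d" using dD by linarith
      then show "\<bar>integral {0..ac} (\<lambda>a. (g a * fk k a) * ?Q d u k a)\<bar> \<le> \<epsilon> / (2 * real N) * mass0 d u"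
        using D k ei by blast
    qed
    also have "\<dots> = \<epsilon> / 2 * mass0 d u" using N(1) by simp
    finally have 2: "\<bar>integral {0..ac} (\<lambda>a. g a * S a)\<bar> \<le> \<epsilon> / 2 * mass0 d u" .
    have "integral {0..ac} (\<lambda>a. g a * (e.moment f a - fbar a * e.mass a)) = integral {0..ac} (\<lambda>a. g a * R a + g a * S a)"
      by (simp add: R_def algebra_simps)
    also have "\<dots> = integral {0..ac} (\<lambda>a. g a * R a) + integral {0..ac} (\<lambda>a. g a * S a)"
      using iR iS by (intro integral_add) (auto simp: absolutely_integrable_on_def)
    finally show "\<bar>integral {0..ac} (\<lambda>a. g a * (mom d u f a - integral\<^sup>L ?M (f a) * mom d u (\<lambda>a x. 1) a))\<bar> \<le> \<epsilon> * mass0 d u"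
      using 1 2 unfolding fbar_def by (simp add: field_simps)
  qed
qed

end

section \<open>The limit equation\<close>

text \<open>Free of side conditions, so it rewrites nested integrals at once: if the integrand is
  not measurable, both sides are \<open>0\<close> by convention.\<close>

lemma LINT_Icc_eq_lebesgue_on_Ioo:
  fixes f :: "real \<Rightarrow> real"
  shows "(LINT x:{a..b}|lebesgue. f x) = integral\<^sup>L (lebesgue_on {a<..<b}) f"
proof -
  let ?c = "\<lambda>x. indicator {a..b} x *\<^sub>R f x" and ?o = "\<lambda>x. indicator {a<..<b} x *\<^sub>R f x"
  have "negligible {a, b}" by simp
  then have "AE x in lebesgue. x \<notin> {a, b}" using AE_not_in negligible_iff_null_sets by blast
  then have eq: "AE x in lebesgue. ?c x = ?o x" by eventually_elim (auto simp: indicator_def)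
  then have eq': "AE x in lebesgue. ?o x = ?c x" by eventually_elim (rule sym)
  have "integral\<^sup>L lebesgue ?c = integral\<^sup>L lebesgue ?o"
  proof (cases "?o \<in> borel_measurable lebesgue")
    case True
    show ?thesis by (rule integral_cong_AE[OF borel_measurable_AE[OF True eq'] True eq])
  next
    case False
    then have "?c \<notin> borel_measurable lebesgue" using borel_measurable_AE[OF _ eq] by blast
    then have "\<not> integrable lebesgue ?c" "\<not> integrable lebesgue ?o" using False borel_measurable_integrable by blast+
    then show ?thesis by (simp add: not_integrable_integral_eq)
  qed
  then have "(LINT x:{a..b}|lebesgue. f x) = (LINT x:{a<..<b}|lebesgue. f x)" by (simp add: set_lebesgue_integral_def)
  then show ?thesis by (simp add: set_lebesgue_integral_eq_lebesgue_on)
qed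

section \<open>The averaged rates and their characteristic equation\<close>

context age_space_problem
begin

definition beta_mean :: "real \<Rightarrow> real" where
  "beta_mean a = integral\<^sup>L (lebesgue_on {0<..<1}) (\<beta> a)"

definition mu_mean :: "real \<Rightarrow> real" where
  "mu_mean a = integral\<^sup>L (lebesgue_on {0<..<1}) (\<mu> a)"

definition mortality :: "real \<Rightarrow> real" where
  "mortality a = integral {0..a} mu_mean"

definition net_births :: "real \<Rightarrow> real" where
  "net_births a = beta_mean a * exp (- mortality a)"

text \<open>The Euler-Lotka function of the spatially averaged population: expected births per
  newborn, discounted at rate \<open>\<alpha>\<close>.\<close>

definition reproduction :: "real \<Rightarrow> real" where
  "reproduction \<alpha> = integral {0..ac} (\<lambda>a. net_births a * exp (- \<alpha> * a))"

lemma ac_pos: "0 < ac"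
  by (rule ages_pos[OF ac])

lemma mean_integrable:
  "beta_mean absolutely_integrable_on {0..ac}" "mu_mean absolutely_integrable_on {0..ac}"
  using bounded_measurable2_slice(2)[OF bounded_measurable2_beta] bounded_measurable2_slice(2)[OF bounded_measurable2_mu[OF ac]]
  by (simp_all add: beta_mean_def[abs_def] mu_mean_def[abs_def])

lemma mortality_primitive: "primitive_on ac mortality mu_mean"
  using primitive_on_integral[OF mean_integrable(2), of 0] by (simp add: mortality_def[abs_def])

lemma exp_mortality_continuous: "continuous_on {0..ac} (\<lambda>a. exp (- mortality a))"
  by (intro continuous_intros primitive_on_continuous[OF mortality_primitive])

lemma net_births_integrable: "net_births absolutely_integrable_on {0..ac}"
  unfolding net_births_def[abs_def]
  by (rule absolutely_integrable_mult_continuous(1)[OF mean_integrable(1) exp_mortality_continuous])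

lemma reproduction_integrable:
  "(\<lambda>a. net_births a * exp (- \<alpha> * a)) absolutely_integrable_on {0..ac}"
  by (intro absolutely_integrable_mult_continuous(1) net_births_integrable continuous_intros)

text \<open>The survival factor does not depend on \<open>x\<close>. After exchanging the integrals
  the integral over space falls on \<open>\<beta>\<close> alone and produces its mean.\<close>

lemma limit_equation_iff: "limit_equation ac \<beta> \<mu> \<alpha> \<longleftrightarrow> reproduction \<alpha> = 1"
proof -
  let ?M = "lebesgue_on {0<..<1::real}" and ?N = "lebesgue_on {0<..<ac}"
  have I: "{0<..<ac} \<in> sets borel" "{0<..<1::real} \<in> sets borel" by auto
  define h where "h a = exp (- \<alpha> * a) * exp (- mortality a)" for a
  have ch: "continuous_on {0..ac} h"
    unfolding h_def by (intro continuous_intros exp_mortality_continuous)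
  have b: "bounded_measurable2 {0<..<ac} (\<lambda>a x. \<beta> a x * h a)"
    by (rule bounded_measurable2_mult[OF bounded_measurable2_beta bounded_measurable2_continuous_fst[OF ch]])
  have mort: "integral\<^sup>L (lebesgue_on {0<..<a}) mu_mean = mortality a" if "a \<in> {0<..<ac}" for a
    unfolding mortality_def
    by (intro integral_lebesgue_on_Ioo absolutely_integrable_on_subinterval[OF mean_integrable(2)]) (use that in auto)
  have "(LINT x:{0..1}|lebesgue. LINT a:{0..ac}|lebesgue. \<beta> a x * exp (- \<alpha> * a) *
        exp (- (LINT s:{0..a}|lebesgue. LINT y:{0..1}|lebesgue. \<mu> s y)))
     = (\<integral>x. (\<integral>a. \<beta> a x * exp (- \<alpha> * a) * exp (- integral\<^sup>L (lebesgue_on {0<..<a}) mu_mean) \<partial>?N) \<partial>?M)"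
    by (simp only: LINT_Icc_eq_lebesgue_on_Ioo mu_mean_def[abs_def])
  also have "\<dots> = (\<integral>x. (\<integral>a. \<beta> a x * h a \<partial>?N) \<partial>?M)"
    by (intro Bochner_Integration.integral_cong refl) (simp add: space_restrict_space mort h_def mult.assoc)
  also have "\<dots> = (\<integral>a. (\<integral>x. \<beta> a x * h a \<partial>?M) \<partial>?N)"
    by (rule Fubini_lebesgue_on(5)[OF I bounded_measurable2_imp_integrable[OF b], symmetric])
  also have "\<dots> = (\<integral>a. net_births a * exp (- \<alpha> * a) \<partial>?N)"
    by (intro Bochner_Integration.integral_cong refl) (simp add: net_births_def beta_mean_def h_def mult_ac)
  also have "\<dots> = reproduction \<alpha>"
    unfolding reproduction_def by (rule integral_lebesgue_on_Ioo[OF reproduction_integrable])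
  finally show ?thesis by (simp add: limit_equation_def)
qed

lemma AE_means:
  obtains B K where "0 \<le> B" "0 \<le> K" "AE a in lebesgue_on {0<..<ac}. beta_min a \<le> beta_mean a \<and> 0 \<le> beta_min a \<and> beta_mean a \<le> B \<and>
    0 \<le> mu_mean a \<and> mu_mean a \<le> K"
proof -
  let ?M = "lebesgue_on {0<..<1::real}"
  have I: "{0<..<ac} \<in> sets borel" "{0<..<1::real} \<in> sets borel" by auto
  obtain K where K: "0 \<le> K" "AE (a, x) in lebesgue_on ({0<..<ac} \<times> {0<..<1}). \<bar>\<mu> a x\<bar> \<le> K" by (rule mu_bound)
  obtain B where B: "0 \<le> B" "AE (a, x) in lebesgue_on ({0<..<ac} \<times> {0<..<1}). \<bar>\<beta> a x\<bar> \<le> B" by (rule beta_bound)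
  have "AE a in lebesgue_on {0<..<ac}. beta_min a \<le> beta_mean a \<and> 0 \<le> beta_min a \<and> beta_mean a \<le> B \<and>
    0 \<le> mu_mean a \<and> mu_mean a \<le> K"
    using AE_beta_min AE_ages_imp_Ioo[OF ac mu_nonneg] AE_lebesgue_on_Times(1)[OF I K(2)] AE_lebesgue_on_Times(1)[OF I B(2)]
      bounded_measurable2_slice(1)[OF bounded_measurable2_beta] bounded_measurable2_slice(1)[OF bounded_measurable2_mu[OF ac]]
  proof eventually_elim
    case (elim a)
    have X: "AE x in ?M. x \<in> {0<..<1}" by (rule AE_in_lebesgue_on)
    have "(\<integral>x. beta_min a \<partial>?M) \<le> beta_mean a"
      unfolding beta_mean_def
    proof (rule integral_mono_AE[OF integrable_lebesgue_on_const elim(5)])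
      show "AE x in ?M. beta_min a \<le> \<beta> a x" using X by eventually_elim (use elim(1) in auto)
    qed
    then have "beta_min a \<le> beta_mean a" by (simp add: measure_restrict_space space_restrict_space)
    moreover have "0 \<le> mu_mean a"
      unfolding mu_mean_def
    proof (rule integral_nonneg_AE)
      show "AE x in ?M. 0 \<le> \<mu> a x" using X by eventually_elim (use elim(2) in auto)
    qed
    moreover have "\<bar>mu_mean a\<bar> \<le> K" "\<bar>beta_mean a\<bar> \<le> B"
      unfolding mu_mean_def beta_mean_def by (rule abs_integral_unit_le; use elim in blast)+
    ultimately show ?case using elim(1) by auto
  qed
  then show ?thesis using that K(1) B(1) by blast
qed

lemma mortality_bounds:
  obtains E where "0 < E" "\<And>a. a \<in> {0..ac} \<Longrightarrow> E \<le> exp (- mortality a) \<and> exp (- mortality a) \<le> 1"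
proof -
  obtain B K where K: "0 \<le> K" and AE: "AE a in lebesgue_on {0<..<ac}. beta_min a \<le> beta_mean a \<and> 0 \<le> beta_min a \<and> beta_mean a \<le> B \<and>
    0 \<le> mu_mean a \<and> mu_mean a \<le> K" by (rule AE_means)
  show ?thesis
  proof (rule that[of "exp (- (K * ac))"])
    fix a assume a: "a \<in> {0..ac}"
    have i: "mu_mean absolutely_integrable_on {0..a}"
      by (rule absolutely_integrable_on_subinterval[OF mean_integrable(2)]) (use a in auto)
    have AEa: "AE s in lebesgue_on {0<..<a}. 0 \<le> mu_mean s \<and> mu_mean s \<le> K"
      by (rule AE_Ioo_subset[where b = ac]) (use AE a in \<open>auto elim!: eventually_mono\<close>)
    have "0 \<le> mortality a" unfolding mortality_def
      by (rule integral_Icc_nonneg_AE[OF i]) (use AEa in \<open>auto elim!: eventually_mono\<close>)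
    moreover have "mortality a \<le> integral {0..a} (\<lambda>s. K)" unfolding mortality_def
      by (rule integral_Icc_mono_AE[OF i]) (use AEa in \<open>auto elim!: eventually_mono\<close>)
    moreover have "integral {0..a} (\<lambda>s. K) \<le> K * ac" using a K by (simp add: mult.commute mult_left_mono)
    ultimately show "exp (- (K * ac)) \<le> exp (- mortality a) \<and> exp (- mortality a) \<le> 1" by simp
  qed simp
qed

lemma net_births_bounds:
  obtains B E where "0 \<le> B" "0 < E" "AE a in lebesgue_on {0<..<ac}. E * beta_min a \<le> net_births a \<and> 0 \<le> beta_min a \<and> net_births a \<le> B"
proof -
  obtain B K where B: "0 \<le> B" and AE: "AE a in lebesgue_on {0<..<ac}. beta_min a \<le> beta_mean a \<and> 0 \<le> beta_min a \<and> beta_mean a \<le> B \<and>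
    0 \<le> mu_mean a \<and> mu_mean a \<le> K" by (rule AE_means)
  obtain E where E: "0 < E" "\<And>a. a \<in> {0..ac} \<Longrightarrow> E \<le> exp (- mortality a) \<and> exp (- mortality a) \<le> 1" by (rule mortality_bounds) blast
  have "AE a in lebesgue_on {0<..<ac}. a \<in> {0<..<ac}" by (rule AE_in_lebesgue_on)
  then have "AE a in lebesgue_on {0<..<ac}. E * beta_min a \<le> net_births a \<and> 0 \<le> beta_min a \<and> net_births a \<le> B"
    using AE
  proof eventually_elim
    case (elim a)
    have e: "E \<le> exp (- mortality a)" "exp (- mortality a) \<le> 1" using E(2)[of a] elim(1) by auto
    have "beta_min a * E \<le> beta_mean a * exp (- mortality a)" using elim(2) e E(1) by (intro mult_mono) auto
    moreover have "beta_mean a * exp (- mortality a) \<le> B * 1" using elim(2) e B by (intro mult_mono) auto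
    ultimately show ?case using elim(2) by (simp add: net_births_def mult.commute)
  qed
  then show ?thesis using that B E(1) by blast
qed

text \<open>Ages above \<open>ac / 2\<close> are bounded away from \<open>0\<close>, so exponentials
  in age can be estimated there by constants, while \<open>beta_min\<close> still has positive
  integral.\<close>

lemma integral_ge_half:
  fixes f :: "real \<Rightarrow> real"
  assumes f: "f absolutely_integrable_on {0..ac}" and E: "0 \<le> E"
    and le: "AE a in lebesgue_on {0<..<ac}. (0 \<le> f a) \<and> (ac / 2 < a \<longrightarrow> E * beta_min a \<le> f a)"
  shows "E * integral {ac / 2..ac} beta_min \<le> integral {0..ac} f"
proof -
  have f2: "f absolutely_integrable_on {0..ac / 2}" "f absolutely_integrable_on {ac / 2..ac}"
    using ac_pos by (auto intro!: absolutely_integrable_on_subinterval[OF f])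
  have "0 \<le> integral {0..ac / 2} f"
    by (rule integral_Icc_nonneg_AE[OF f2(1) AE_Ioo_subset[where b = ac]]) (use le ac_pos in \<open>auto elim!: eventually_mono\<close>)
  moreover have "integral {ac / 2..ac} (\<lambda>a. E * beta_min a) \<le> integral {ac / 2..ac} f"
  proof (rule integral_Icc_mono_AE[OF _ f2(2)])
    show "(\<lambda>a. E * beta_min a) absolutely_integrable_on {ac / 2..ac}"
      using beta_min_integrable(1)[of "ac / 2"] ac_pos by simp
    have "AE a in lborel. a \<in> {0<..<ac} \<longrightarrow> ac / 2 < a \<longrightarrow> E * beta_min a \<le> f a"
      using le unfolding AE_lebesgue_on_iff[OF borel_open[OF open_greaterThanLessThan]] by (rule eventually_mono) blast
    then have "AE a in lborel. a \<in> {ac / 2<..<ac} \<longrightarrow> E * beta_min a \<le> f a"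
      by (rule eventually_mono) (use ac_pos in auto)
    then show "AE a in lebesgue_on {ac / 2<..<ac}. E * beta_min a \<le> f a"
      by (simp add: AE_lebesgue_on_iff)
  qed
  moreover have "integral {0..ac / 2} f + integral {ac / 2..ac} f = integral {0..ac} f"
    using f ac_pos by (intro Henstock_Kurzweil_Integration.integral_combine) (auto simp: absolutely_integrable_on_def)
  ultimately show ?thesis by simp
qed

lemma reproduction_strict_antimono:
  assumes "\<alpha> < \<alpha>'"
  shows "reproduction \<alpha>' < reproduction \<alpha>"
proof -
  obtain B E where E: "0 < E" "AE a in lebesgue_on {0<..<ac}. E * beta_min a \<le> net_births a \<and> 0 \<le> beta_min a \<and> net_births a \<le> B"
    by (rule net_births_bounds)
  \<comment> \<open>A lower bound for \<open>exp (- \<alpha> * a) - exp (- \<alpha>' * a)\<close> on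
    the upper half of \<open>{0..ac}\<close>: factor out \<open>exp (- \<alpha>' * a)\<close> and
    use \<open>exp y - 1 \<ge> y\<close>.\<close>
  define \<delta> where "\<delta> = exp (- \<bar>\<alpha>'\<bar> * ac) * ((\<alpha>' - \<alpha>) * (ac / 2))"
  have \<delta>: "0 < \<delta>" using assms ac_pos by (simp add: \<delta>_def)
  let ?f = "\<lambda>a. net_births a * exp (- \<alpha> * a) - net_births a * exp (- \<alpha>' * a)"
  have I: "AE a in lebesgue_on {0<..<ac}. a \<in> {0<..<ac}" by (rule AE_in_lebesgue_on)
  have "(\<delta> * E) * integral {ac / 2..ac} beta_min \<le> integral {0..ac} ?f"
  proof (rule integral_ge_half)
    show "?f absolutely_integrable_on {0..ac}" by (intro set_integral_diff reproduction_integrable)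
    show "0 \<le> \<delta> * E" using \<delta> E by simp
    show "AE a in lebesgue_on {0<..<ac}. 0 \<le> ?f a \<and> (ac / 2 < a \<longrightarrow> \<delta> * E * beta_min a \<le> ?f a)"
      using E(2) I
    proof eventually_elim
      case (elim a)
      have nb: "0 \<le> net_births a" using elim(1) E(1) by (meson less_imp_le mult_nonneg_nonneg order_trans)
      have eq: "?f a = net_births a * (exp (- \<alpha>' * a) * (exp ((\<alpha>' - \<alpha>) * a) - 1))"
        by (simp add: algebra_simps flip: exp_add)
      have pos: "0 \<le> exp (- \<alpha>' * a) * (exp ((\<alpha>' - \<alpha>) * a) - 1)" using assms elim(2) by simp
      have "\<delta> * E * beta_min a \<le> ?f a" if "ac / 2 < a"
      proof -
        have "- \<bar>\<alpha>'\<bar> * ac \<le> - \<bar>\<alpha>'\<bar> * a" using elim(2) by (intro mult_left_mono_neg) auto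
        also have "\<dots> \<le> - \<alpha>' * a" using elim(2) by (intro mult_right_mono) auto
        finally have "exp (- \<bar>\<alpha>'\<bar> * ac) \<le> exp (- \<alpha>' * a)" by simp
        moreover have "(\<alpha>' - \<alpha>) * (ac / 2) \<le> exp ((\<alpha>' - \<alpha>) * a) - 1"
        proof -
          have "(\<alpha>' - \<alpha>) * (ac / 2) \<le> (\<alpha>' - \<alpha>) * a" using assms that by (intro mult_left_mono) auto
          also have "\<dots> \<le> exp ((\<alpha>' - \<alpha>) * a) - 1" using exp_ge_add_one_self[of "(\<alpha>' - \<alpha>) * a"] by linarith
          finally show ?thesis .
        qed
        ultimately have "\<delta> \<le> exp (- \<alpha>' * a) * (exp ((\<alpha>' - \<alpha>) * a) - 1)"
          unfolding \<delta>_def using assms ac_pos by (intro mult_mono) auto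
        then have "(E * beta_min a) * \<delta> \<le> net_births a * (exp (- \<alpha>' * a) * (exp ((\<alpha>' - \<alpha>) * a) - 1))"
          using elim(1) nb \<delta> by (intro mult_mono) auto
        then show ?thesis unfolding eq by (simp add: mult_ac)
      qed
      then show ?case unfolding eq using nb pos by simp
    qed
  qed
  moreover have "integral {0..ac} ?f = reproduction \<alpha> - reproduction \<alpha>'"
    unfolding reproduction_def using reproduction_integrable by (intro integral_diff) (auto simp: absolutely_integrable_on_def)
  moreover have "0 < (\<delta> * E) * integral {ac / 2..ac} beta_min"
    using \<delta> E(1) beta_min_integrable(2)[of "ac / 2"] ac_pos by simp
  ultimately show ?thesis by linarith
qed

lemma reproduction_continuous: "continuous_on UNIV reproduction"
proof -
  have "(reproduction \<circ> x) \<longlonglongrightarrow> reproduction \<alpha>" if x: "x \<longlonglongrightarrow> \<alpha>" for x \<alpha>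
  proof -
    obtain R where R: "\<And>n. \<bar>x n\<bar> \<le> R" using convergent_imp_Bseq[OF convergentI[OF x]] by (auto simp: Bseq_def)
    have R0: "0 \<le> R" using R[of 0] by linarith
    have "(\<lambda>n. integral {0..ac} (\<lambda>a. net_births a * exp (- x n * a))) \<longlonglongrightarrow> integral {0..ac} (\<lambda>a. net_births a * exp (- \<alpha> * a))"
    proof (rule dominated_convergence(2))
      show "(\<lambda>a. net_births a * exp (- x n * a)) integrable_on {0..ac}" for n
        using reproduction_integrable by (simp add: absolutely_integrable_on_def)
      show "(\<lambda>a. \<bar>net_births a\<bar> * exp (R * ac)) integrable_on {0..ac}"
        using net_births_integrable by (simp add: absolutely_integrable_on_def)
      show "norm (net_births a * exp (- x n * a)) \<le> \<bar>net_births a\<bar> * exp (R * ac)" if a: "a \<in> {0..ac}" for n a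
      proof -
        have "- x n * a \<le> R * ac" using R[of n] R0 a by (intro mult_mono) auto
        then show ?thesis by (simp add: abs_mult mult_left_mono)
      qed
      show "(\<lambda>n. net_births a * exp (- x n * a)) \<longlonglongrightarrow> net_births a * exp (- \<alpha> * a)" for a
        by (intro tendsto_intros x)
    qed
    then show ?thesis by (simp add: reproduction_def[abs_def] o_def)
  qed
  then show ?thesis by (simp add: continuous_on_sequentially)
qed

lemma reproduction_eq_1: "\<exists>\<alpha>. reproduction \<alpha> = 1"
proof -
  obtain B E where B: "0 \<le> B" and E: "0 < E"
    and AE: "AE a in lebesgue_on {0<..<ac}. E * beta_min a \<le> net_births a \<and> 0 \<le> beta_min a \<and> net_births a \<le> B"
    by (rule net_births_bounds)
  have I: "AE a in lebesgue_on {0<..<ac}. a \<in> {0<..<ac}" by (rule AE_in_lebesgue_on)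
  define \<beta>1 where "\<beta>1 = integral {ac / 2..ac} beta_min"
  have \<beta>1: "0 < \<beta>1" unfolding \<beta>1_def using ac_pos by (intro beta_min_integrable(2)) auto
  \<comment> \<open>Above age \<open>ac / 2\<close> the factor \<open>exp (k * a)\<close> is at
    least \<open>k * (ac / 2)\<close>; this \<open>k\<close> makes the resulting lower bound for
    \<open>reproduction (- k)\<close> exactly \<open>1\<close>.\<close>
  define k where "k = 2 / (ac * E * \<beta>1)"
  have k: "0 < k" using ac_pos E \<beta>1 by (simp add: k_def)
  have "1 = (k * (ac / 2) * E) * \<beta>1" using ac_pos E \<beta>1 by (simp add: k_def)
  also have "\<dots> \<le> integral {0..ac} (\<lambda>a. net_births a * exp (- (- k) * a))"
    unfolding \<beta>1_def
  proof (rule integral_ge_half[OF reproduction_integrable])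
    show "0 \<le> k * (ac / 2) * E" using k ac_pos E by simp
    show "AE a in lebesgue_on {0<..<ac}. 0 \<le> net_births a * exp (- (- k) * a) \<and>
       (ac / 2 < a \<longrightarrow> k * (ac / 2) * E * beta_min a \<le> net_births a * exp (- (- k) * a))"
      using AE I
    proof eventually_elim
      case (elim a)
      have nb: "0 \<le> net_births a" using elim(1) E by (meson less_imp_le mult_nonneg_nonneg order_trans)
      have "k * (ac / 2) * E * beta_min a \<le> net_births a * exp (- (- k) * a)" if "ac / 2 < a"
      proof -
        have "k * (ac / 2) \<le> k * a" using k that by (intro mult_left_mono) auto
        also have "\<dots> \<le> exp (- (- k) * a)" using order_trans[OF _ exp_ge_add_one_self[of "k * a"]] by simp
        finally have "(E * beta_min a) * (k * (ac / 2)) \<le> net_births a * exp (- (- k) * a)"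
          using elim(1) nb k ac_pos by (intro mult_mono) auto
        then show ?thesis by (simp add: mult_ac)
      qed
      then show ?case using nb by simp
    qed
  qed
  finally have low: "1 \<le> reproduction (- k)" by (simp add: reproduction_def)
  \<comment> \<open>The integral of \<open>B * exp (- r * a)\<close> is at most
    \<open>B / r\<close>, hence at most \<open>1\<close>.\<close>
  define r where "r = B + 1"
  have r: "0 < r" using B by (simp add: r_def)
  have P: "primitive_on ac (\<lambda>a. - exp (- r * a) / r) (\<lambda>a. exp (- r * a))"
    using r by (intro primitive_on_C1) (auto intro!: derivative_eq_intros continuous_intros)
  have "reproduction r \<le> integral {0..ac} (\<lambda>a. B * exp (- r * a))"
    unfolding reproduction_def
    by (rule integral_Icc_mono_AE[OF reproduction_integrable])
      (use AE in \<open>auto intro!: absolutely_integrable_continuous_real continuous_intros elim!: eventually_mono\<close>)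
  also have "\<dots> = B * integral {0..ac} (\<lambda>a. exp (- r * a))" by (rule integral_mult_right)
  also have "integral {0..ac} (\<lambda>a. exp (- r * a)) = (1 - exp (- r * ac)) / r"
    using primitive_on_diff[OF P, of 0 ac] ac_pos by (simp add: diff_divide_distrib)
  also have "B * ((1 - exp (- r * ac)) / r) \<le> B * (1 / r)"
    using B r by (intro mult_left_mono divide_right_mono) auto
  also have "\<dots> \<le> 1" using B by (simp add: r_def)
  finally have up: "reproduction r \<le> 1" .
  have "\<exists>x\<ge>- k. x \<le> r \<and> reproduction x = 1"
    by (rule IVT2'[where f = reproduction, OF up low]) (use k r continuous_on_subset[OF reproduction_continuous] in auto)
  then show ?thesis by blast
qed

lemma ex1_reproduction: "\<exists>!\<alpha>. reproduction \<alpha> = 1"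
  using reproduction_eq_1 reproduction_strict_antimono by (metis less_irrefl linorder_neqE)

end

section \<open>The adjoint solution and convergence of the eigenvalue\<close>

context age_space_problem
begin

text \<open>
  The solution is \<open>\<psi>(a) = exp (\<alpha> a + M(a)) (1 - \<integral>\<^sub>0\<^sup>a \<beta>m(s) exp (-\<alpha> s - M(s)) ds)\<close> with \<open>\<beta>m\<close> the mean of \<open>\<beta>\<close> and \<open>M\<close>
  the primitive of the mean of \<open>\<mu>\<close>; it vanishes at \<open>ac\<close> because \<open>\<alpha>\<close> solves the limit equation.
\<close>

lemma adjoint_weight:
  assumes \<alpha>: "reproduction \<alpha> = 1"
  obtains \<psi> where "primitive_on ac \<psi> (\<lambda>a. (\<alpha> + mu_mean a) * \<psi> a - beta_mean a)"
    "\<psi> 0 = 1" "\<psi> ac = 0" "\<And>a. a \<in> {0..ac} \<Longrightarrow> 0 \<le> \<psi> a" "0 < integral {0..ac} \<psi>"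
proof -
  let ?r = "\<lambda>a. net_births a * exp (- \<alpha> * a)"
  define H where "H a = \<alpha> * a + mortality a" for a
  have pa: "primitive_on ac (\<lambda>a. \<alpha> * a) (\<lambda>a. \<alpha>)"
    by (rule primitive_on_C1) (auto intro!: derivative_eq_intros)
  have H: "primitive_on ac H (\<lambda>a. \<alpha> + mu_mean a)"
    unfolding H_def[abs_def] by (rule primitive_on_add[OF pa mortality_primitive])
  define J where "J a = 0 + integral {0..a} ?r" for a
  have J: "primitive_on ac J ?r" unfolding J_def[abs_def] by (rule primitive_on_integral[OF reproduction_integrable])
  have one: "primitive_on ac (\<lambda>a. 1) (\<lambda>a. 0)" by (auto simp: primitive_on_def)
  have J1: "primitive_on ac (\<lambda>a. 1 + (- 1) * J a) (\<lambda>a. 0 + (- 1) * ?r a)"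
    by (rule primitive_on_add[OF one primitive_on_cmult[OF J]])
  define \<psi> where "\<psi> a = (1 - J a) * exp (H a)" for a
  have re: "?r a * exp (H a) = beta_mean a" for a
    by (simp add: net_births_def H_def flip: exp_add)
  have P: "primitive_on ac \<psi> (\<lambda>a. (\<alpha> + mu_mean a) * \<psi> a - beta_mean a)"
  proof (rule primitive_on_cong[OF primitive_on_mult[OF J1 primitive_on_exp[OF H]]])
    show "(0 + - 1 * ?r t) * exp (H t) + (1 + - 1 * J t) * ((\<alpha> + mu_mean t) * exp (H t)) = (\<alpha> + mu_mean t) * \<psi> t - beta_mean t" for t
      unfolding re[symmetric] \<psi>_def by (simp add: algebra_simps)
  qed (simp add: \<psi>_def)
  have J_end: "J 0 = 0" "J ac = 1" using \<alpha> by (simp_all add: J_def reproduction_def)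
  have nonneg: "0 \<le> \<psi> a" if a: "a \<in> {0..ac}" for a
  proof -
    obtain B E where E: "0 < E" "AE a in lebesgue_on {0<..<ac}. E * beta_min a \<le> net_births a \<and> 0 \<le> beta_min a \<and> net_births a \<le> B"
      by (rule net_births_bounds)
    have "AE a in lebesgue_on {0<..<ac}. 0 \<le> ?r a"
      using E(2) by eventually_elim (use E(1) in \<open>meson exp_ge_zero less_imp_le mult_nonneg_nonneg order_trans\<close>)
    then have "AE s in lebesgue_on {a<..<ac}. 0 \<le> ?r s"
      using a by (auto simp: AE_lebesgue_on_iff elim!: eventually_mono)
    moreover have "?r absolutely_integrable_on {a..ac}"
      by (rule absolutely_integrable_on_subinterval[OF reproduction_integrable]) (use a in auto)
    ultimately have "0 \<le> integral {a..ac} ?r" by (intro integral_Icc_nonneg_AE)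
    \<comment> \<open>\<open>J ac = 1\<close>, so \<open>1 - J a\<close> is the integral of the
      nonnegative integrand over \<open>{a..ac}\<close>.\<close>
    then have "J a \<le> 1" using primitive_on_diff[OF J, of a ac] a J_end by simp
    then show ?thesis by (simp add: \<psi>_def)
  qed
  have c: "continuous_on {0..ac} \<psi>" by (rule primitive_on_continuous[OF P])
  have \<psi>0: "\<psi> 0 = 1" by (simp add: \<psi>_def H_def J_end mortality_def)
  have "integral {0..ac} \<psi> \<noteq> 0"
  proof
    assume "integral {0..ac} \<psi> = 0"
    then have "(\<psi> has_integral 0) (cbox 0 ac)"
      using integrable_continuous_interval[OF c] by (simp add: has_integral_iff)
    then have "\<psi> 0 = 0"
      by (rule has_integral_0_cbox_imp_0[of 0 ac \<psi>, rotated 2]) (use c nonneg ac_pos in auto)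
    then show False using \<psi>0 by simp
  qed
  moreover have "0 \<le> integral {0..ac} \<psi>"
    using nonneg by (intro integral_nonneg integrable_continuous_interval c) auto
  ultimately have "0 < integral {0..ac} \<psi>" by simp
  moreover have "\<psi> ac = 0" using J_end by (simp add: \<psi>_def)
  ultimately show ?thesis using that[OF P \<psi>0 _ nonneg] by blast
qed

text \<open>Integrate the derivative of \<open>mass * \<psi>\<close> over \<open>{0..ac}\<close>.
  The terms with the means cancel against mortality and, through the renewal condition, against the
  births, up to averaging defects of \<open>\<mu>\<close> and \<open>\<beta>\<close>. Only
  \<open>l - \<alpha>\<close> times the integral of \<open>mass * \<psi>\<close> is left, and that
  integral is bounded below by the initial mass.\<close>

theorem eigenvalue_tendsto:
  assumes \<alpha>: "reproduction \<alpha> = 1" and \<epsilon>: "0 < \<epsilon>"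
  obtains D0 where "0 < D0" "\<And>d l u. D0 \<le> d \<Longrightarrow> eigen d l u \<Longrightarrow> \<bar>l - \<alpha>\<bar> < \<epsilon>"
proof -
  obtain \<psi> where \<psi>: "primitive_on ac \<psi> (\<lambda>a. (\<alpha> + mu_mean a) * \<psi> a - beta_mean a)"
    "\<psi> 0 = 1" "\<psi> ac = 0" "\<And>a. a \<in> {0..ac} \<Longrightarrow> 0 \<le> \<psi> a" "0 < integral {0..ac} \<psi>"
    by (rule adjoint_weight[OF \<alpha>]) blast
  have c\<psi>: "continuous_on {0..ac} \<psi>" by (rule primitive_on_continuous[OF \<psi>(1)])
  obtain K\<psi> where K\<psi>: "\<And>a. a \<in> {0..ac} \<Longrightarrow> \<bar>\<psi> a\<bar> \<le> K\<psi>" using continuous_on_Icc_bounded[OF c\<psi>] by blast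
  obtain c0 C0 where C0: "0 < c0" "0 < C0"
    and mass: "\<And>d l u a. eigen d l u \<Longrightarrow> a \<in> {0..ac} \<Longrightarrow>
      c0 * mass0 d u \<le> mom d u (\<lambda>a x. 1) a \<and> mom d u (\<lambda>a x. 1) a \<le> C0 * mass0 d u"
    by (rule mass_bounds) blast
  \<comment> \<open>Since \<open>c0\<close> times the initial mass bounds the mass from below,
    \<open>\<kappa>\<close> times it bounds the integral of \<open>mass * \<psi>\<close>.\<close>
  define \<kappa> where "\<kappa> = c0 * integral {0..ac} \<psi>"
  have \<kappa>: "0 < \<kappa>" using C0 \<psi>(5) by (simp add: \<kappa>_def)
  \<comment> \<open>There are two averaging errors; two thirds of
    \<open>\<epsilon> * \<kappa>\<close> leave room for a strict inequality.\<close>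
  have e: "0 < \<epsilon> * \<kappa> / 3" using \<epsilon> \<kappa> by simp
  have I: "AE a in lebesgue_on {0<..<ac}. a \<in> {0<..<ac}" by (rule AE_in_lebesgue_on)
  obtain D1 where D1: "0 < D1" "\<And>d l u. D1 \<le> d \<Longrightarrow> eigen d l u \<Longrightarrow>
    \<bar>integral {0..ac} (\<lambda>a. 1 * (mom d u \<beta> a - integral\<^sup>L (lebesgue_on {0<..<1}) (\<beta> a) * mom d u (\<lambda>a x. 1) a))\<bar>
      \<le> \<epsilon> * \<kappa> / 3 * mass0 d u"
    by (rule averaging_Linf[OF Linf_continuous_beta _ _ e, of "\<lambda>a. 1" 1]) auto
  have m\<psi>: "\<psi> \<in> borel_measurable (lebesgue_on {0<..<ac})"
    by (rule continuous_imp_measurable_on_sets_lebesgue) (auto intro: continuous_on_subset[OF c\<psi>])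
  have b\<psi>: "AE a in lebesgue_on {0<..<ac}. \<bar>\<psi> a\<bar> \<le> K\<psi>" using I by eventually_elim (use K\<psi> in auto)
  obtain D2 where D2: "0 < D2" "\<And>d l u. D2 \<le> d \<Longrightarrow> eigen d l u \<Longrightarrow>
    \<bar>integral {0..ac} (\<lambda>a. \<psi> a * (mom d u \<mu> a - integral\<^sup>L (lebesgue_on {0<..<1}) (\<mu> a) * mom d u (\<lambda>a x. 1) a))\<bar>
      \<le> \<epsilon> * \<kappa> / 3 * mass0 d u"
    by (rule averaging_Linf[OF mu_cont[OF ac] m\<psi> b\<psi> e]) blast
  show ?thesis
  proof (rule that[of "max D1 D2"])
    show "0 < max D1 D2" using D1(1) by simp
    fix d l u assume d: "max D1 D2 \<le> d" and ei: "eigen d l u"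
    then obtain ux uxx ua where "eigenpair am ac p \<Lambda> q \<beta> \<mu> d l u ux uxx ua" unfolding eigen_def by blast
    then interpret e: eigenpair am ac p \<Lambda> q \<beta> \<mu> d l u ux uxx ua .
    have m0: "0 < mass0 d u" by (rule mass0_pos[OF ei])
    let ?A = "\<lambda>a. e.moment \<beta> a - beta_mean a * e.mass a"
    let ?B = "\<lambda>a. \<psi> a * (e.moment \<mu> a - mu_mean a * e.mass a)"
    let ?m = "\<lambda>a. e.mass a * \<psi> a"
    note P = primitive_on_mult[OF e.mass_primitive[OF ac] \<psi>(1)]
    have cm: "continuous_on {0..ac} e.mass" by (rule e.mass_continuous[OF ac])
    have i\<beta>: "e.moment \<beta> absolutely_integrable_on {0..ac}"
      by (rule e.moment_absolutely_integrable(1)[OF ac bounded_measurable2_beta])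
    have iA: "?A absolutely_integrable_on {0..ac}"
      by (rule set_integral_diff(1)[OF i\<beta> absolutely_integrable_mult_continuous(1)[OF mean_integrable(1) cm]])
    have iB: "?B absolutely_integrable_on {0..ac}"
      by (rule absolutely_integrable_mult_continuous(2)[OF set_integral_diff(1)[OF
          e.moment_absolutely_integrable(1)[OF ac bounded_measurable2_mu[OF ac]]
          absolutely_integrable_mult_continuous(1)[OF mean_integrable(2) cm]] c\<psi>])
    have im: "?m absolutely_integrable_on {0..ac}"
      by (intro absolutely_integrable_continuous_real continuous_intros cm c\<psi>)
    \<comment> \<open>The boundary term at \<open>ac\<close> vanishes with \<open>\<psi>\<close>, so
      no information about the mass at age \<open>ac\<close> is needed; at \<open>0\<close> the
      normalisation \<open>\<psi> 0 = 1\<close> leaves the initial mass.\<close>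
    have "- e.mass 0 = integral {0..ac} (\<lambda>a. (- e.moment \<mu> a - l * e.mass a) * \<psi> a + e.mass a * ((\<alpha> + mu_mean a) * \<psi> a - beta_mean a))"
      using primitive_on_diff[OF P, of 0 ac] ac_pos \<psi>(2,3) by simp
    also have "\<dots> = integral {0..ac} (\<lambda>a. ((\<alpha> - l) * ?m a - ?B a) + (?A a - e.moment \<beta> a))"
      by (rule Henstock_Kurzweil_Integration.integral_cong) (simp add: algebra_simps)
    also have "\<dots> = ((\<alpha> - l) * integral {0..ac} ?m - integral {0..ac} ?B) + (integral {0..ac} ?A - integral {0..ac} (e.moment \<beta>))"
    proof (rule integral_unique)
      show "((\<lambda>a. ((\<alpha> - l) * ?m a - ?B a) + (?A a - e.moment \<beta> a)) has_integral
        (((\<alpha> - l) * integral {0..ac} ?m - integral {0..ac} ?B) + (integral {0..ac} ?A - integral {0..ac} (e.moment \<beta>)))) {0..ac}"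
        by (intro has_integral_add has_integral_diff has_integral_mult_right integrable_integral)
          (use iA iB im i\<beta> in \<open>auto simp: absolutely_integrable_on_def\<close>)
    qed
    finally have key: "(l - \<alpha>) * integral {0..ac} ?m = integral {0..ac} ?A - integral {0..ac} ?B"
      using e.mass_0_renewal by (simp add: algebra_simps)
    have "\<bar>integral {0..ac} ?A\<bar> \<le> \<epsilon> * \<kappa> / 3 * mass0 d u" "\<bar>integral {0..ac} ?B\<bar> \<le> \<epsilon> * \<kappa> / 3 * mass0 d u"
      using D1(2)[OF _ ei] D2(2)[OF _ ei] d by (simp_all add: beta_mean_def mu_mean_def)
    then have "\<bar>(l - \<alpha>) * integral {0..ac} ?m\<bar> \<le> 2 * (\<epsilon> * \<kappa> / 3 * mass0 d u)" unfolding key by linarith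
    also have "\<dots> < \<epsilon> * (\<kappa> * mass0 d u)" using \<epsilon> \<kappa> m0 by simp
    finally have less: "\<bar>l - \<alpha>\<bar> * \<bar>integral {0..ac} ?m\<bar> < \<epsilon> * (\<kappa> * mass0 d u)" by (simp add: abs_mult)
    have "\<kappa> * mass0 d u = integral {0..ac} (\<lambda>a. (c0 * mass0 d u) * \<psi> a)" by (simp add: \<kappa>_def)
    also have "\<dots> \<le> integral {0..ac} ?m"
    proof (rule integral_le)
      show "(\<lambda>a. c0 * mass0 d u * \<psi> a) integrable_on {0..ac}"
        by (intro integrable_continuous_interval continuous_intros c\<psi>)
      show "?m integrable_on {0..ac}" using im by (simp add: absolutely_integrable_on_def)
      show "c0 * mass0 d u * \<psi> a \<le> ?m a" if "a \<in> {0..ac}" for a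
        using mass[OF ei that] \<psi>(4)[OF that] by (intro mult_right_mono) auto
    qed
    finally have "\<kappa> * mass0 d u \<le> \<bar>integral {0..ac} ?m\<bar>" by linarith
    then have "\<bar>l - \<alpha>\<bar> * (\<kappa> * mass0 d u) \<le> \<bar>l - \<alpha>\<bar> * \<bar>integral {0..ac} ?m\<bar>" by (intro mult_left_mono) auto
    then have "\<bar>l - \<alpha>\<bar> * (\<kappa> * mass0 d u) < \<epsilon> * (\<kappa> * mass0 d u)" using less by linarith
    then show "\<bar>l - \<alpha>\<bar> < \<epsilon>" using \<kappa> m0 by (simp add: mult_less_cancel_right_pos)
  qed
qed

end

theorem theorem2p4:
  fixes am :: ereal and ac p \<Lambda> :: real
    and q :: "real \<Rightarrow> real" and \<beta> \<mu> :: "real \<Rightarrow> real \<Rightarrow> real"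
    and lam0 :: "real \<Rightarrow> real"
  assumes am: "0 < am"
    and q_cont: "continuous_on {0..1} q"
    and q_pos: "\<And>x. x \<in> {0..1} \<Longrightarrow> 0 < q x"
    and beta_C2: "Linf_C2 (ages am) \<beta>"
    and beta_nonneg: "AE a in lebesgue_on (ages am). \<forall>x\<in>{0..1}. 0 \<le> \<beta> a x"
    and ac: "ac \<in> ages am"
    and beta_zero: "AE a in lebesgue_on (ages am). ac \<le> a \<longrightarrow> (\<forall>x\<in>{0..1}. \<beta> a x = 0)"
    and beta_pos: "\<And>a. a \<in> {0..<ac} \<Longrightarrow> 0 < (LINT l:{a..ac}|lebesgue. (INF x\<in>{0..1}. \<beta> l x))"
    and mu_cont: "\<And>a'. a' \<in> ages am \<Longrightarrow> Linf_continuous {0<..<a'} \<mu>"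
    and mu_nonneg: "AE a in lebesgue_on (ages am). \<forall>x\<in>{0..1}. 0 \<le> \<mu> a x"
    and p: "1 < p"
    and lam0: "\<And>d. 0 < d \<Longrightarrow> principal_eigenvalue am p d \<Lambda> q \<beta> \<mu> (lam0 d)"
  shows "(\<exists>!\<alpha>. limit_equation ac \<beta> \<mu> \<alpha>) \<and>
         (lam0 \<longlongrightarrow> (THE \<alpha>. limit_equation ac \<beta> \<mu> \<alpha>)) at_top"
proof -
  have beta_cont: "Linf_continuous (ages am) \<beta>" using beta_C2 by (simp add: Linf_C2_def)
  interpret age_space_problem am ac p \<Lambda> q \<beta> \<mu>
    by unfold_locales fact+
  have ex1: "\<exists>!\<alpha>. limit_equation ac \<beta> \<mu> \<alpha>" unfolding limit_equation_iff by (rule ex1_reproduction)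
  define \<alpha> where "\<alpha> = (THE \<alpha>. limit_equation ac \<beta> \<mu> \<alpha>)"
  have \<alpha>: "reproduction \<alpha> = 1" using theI'[OF ex1] unfolding \<alpha>_def limit_equation_iff .
  have eigen: "\<exists>u. eigen d (lam0 d) u" if d: "0 < d" for d
  proof -
    obtain u where u: "eigen_solution am p d \<Lambda> q \<beta> \<mu> (lam0 d) u"
      "AE (a, x) in lebesgue_on (ages am \<times> {0<..<1}). 0 \<le> u a x"
      "\<not> (AE (a, x) in lebesgue_on (ages am \<times> {0<..<1}). u a x = 0)"
      using lam0[OF d] unfolding principal_eigenvalue_def by blast
    then obtain ux uxx ua where "in_W11_W2p am p u ux uxx ua"
      "AE (a, x) in lebesgue_on (ages am \<times> {0<..<1}).
         ua a x = d * uxx a x + \<Lambda> * q x * ux a x - \<mu> a x * u a x - lam0 d * u a x"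
      "AE a in lebesgue_on (ages am). ux a 0 = 0 \<and> ux a 1 = 0"
      "AE x in lebesgue_on {0<..<1}. u 0 x = (LINT a:ages am|lebesgue. \<beta> a x * u a x)"
      unfolding eigen_solution_def by blast
    then have "eigenpair am ac p \<Lambda> q \<beta> \<mu> d (lam0 d) u ux uxx ua"
      using d u(2,3) by unfold_locales
    then show ?thesis unfolding eigen_def by blast
  qed
  \<comment> \<open>The threshold serves every eigenpair with \<open>D0 \<le> d\<close>, so the
    values chosen by \<open>lam0\<close> are covered without following an eigenfunction from one
    \<open>d\<close> to another.\<close>
  have "(lam0 \<longlongrightarrow> \<alpha>) at_top"
  proof (rule tendstoI)
    fix \<epsilon> :: real assume "0 < \<epsilon>"
    then obtain D0 where D0: "0 < D0" "\<And>d l u. D0 \<le> d \<Longrightarrow> eigen d l u \<Longrightarrow> \<bar>l - \<alpha>\<bar> < \<epsilon>"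
      using eigenvalue_tendsto[OF \<alpha>] by blast
    have "dist (lam0 d) \<alpha> < \<epsilon>" if d: "D0 \<le> d" for d
    proof -
      have "0 < d" using D0(1) d by linarith
      then obtain u where "eigen d (lam0 d) u" using eigen by blast
      then show ?thesis using D0(2)[OF d] by (simp add: dist_real_def)
    qed
    then show "eventually (\<lambda>d. dist (lam0 d) \<alpha> < \<epsilon>) at_top"
      unfolding eventually_at_top_linorder by blast
  qed
  then show ?thesis using ex1 unfolding \<alpha>_def by blast
qed

end
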